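(* Assume that for all $v\in L^2(\rho)$ one has $\partial_x(w*v)=w_x*v$, and that $$M:=\sup_{x\in\mathbb{R}}\int_{x-\mathcal{S}}\Big(\frac{w_x(x-y)}{w(x-y)}\Big)^2p_0(x,y)\,dy<\infty .$$ Assume furthermore that there exists $\kappa_0^0>0$ such that for all $h\in H^1(\mu^0)$, $$\operatorname{Var}_{\mu^0}(h)\le\kappa_0^0\int h_x^2(x)\,\mu^0(dx),$$ where $\mu^0=\frac1{Z_{\mu^0}}\frac qr\,P\hat u_x\,\hat u_x$ with $Z_{\mu^0}=\int\frac qr\,P\hat u_x\,\hat u_x\,dx$. Then there exists $c^*=c^*(w,f,r,q)>0$ such that if the wave speed $c=c(w,f,r,q)$ satisfies $|c|\le c^*$, there exist $\kappa,Z>0$ such that for all $v\in L^2(\mathfrak m)$ $$\langle Lv,v\rangle_{\mathfrak m}\le-\kappa\|v\|_{\mathfrak m}^2+Z\,\langle v,\hat u_x\rangle_{\mathfrak m}^2 .$$ Precisely, $c^*=\min\{|t|:\kappa(t)\le0\}$, where $$\kappa(t)=\kappa_0\Big(1-\frac{2t^2}{Z^0}\Big\|\frac{\hat u_{xx}}{f}\Big\|_{\mathfrak m}^2\Big)-|t|\,\Big\|\frac{\hat u_{xx}}{\hat u_xf}(\kappa_0-f)\Big\|_\infty ,$$ $$\kappa_0=\frac{\inf f}{2}\Big(1-\frac{\kappa_0^0M}{1+\kappa_0^0M}\Big),\qquad Z^0=\int\frac{q}{rf}\,P\hat u_x\,\hat u_x\,dx .$$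
   Context: Notation. For a continuous density $\mu:\mathbb{R}\to(0,\infty)$, $H^k(\mu)$ is the weighted Sobolev space of $k$-times weakly differentiable functions with inner product $\sum_{i=0}^k\int u^{(i)}v^{(i)}\mu\,dx$; $L^2(\mu)=H^0(\mu)$, with inner product $\langle\cdot,\cdot\rangle_\mu$ and norm $\|\cdot\|_\mu$; $H^k$, $L^2$, $\langle\cdot,\cdot\rangle$ are the unweighted versions. $w*h(x)=\int w(x-y)h(y)\,dy$. $\operatorname{Var}_\mu(h)=\int h^2d\mu-(\int h\,d\mu)^2$ for a probability measure $\mu$; a probability density and the corresponding measure are denoted by the same symbol. Standing assumptions. $c\in\mathbb{R}$ (the wave speed); $f,r,q\in C(\mathbb{R})$ are bounded, with $\inf_{\mathbb R} f>0$, $\inf_{\mathbb R} r>0$ and $\inf_{\mathbb R} q>0$; $w\ge0$ is differentiable almost everywhere (derivative $w_x$), $\int w\,dx=1$ and $\int|w_x|\,dx<\infty$. $\mathcal{S}=\{x\in\mathbb{R}:w(x)>0\}$ and $x-\mathcal{S}=\{x-s:s\in\mathcal{S}\}$. Operators. $Pv(x)=\int p(x,y)v(y)\,dy$ with $p(x,y)=r(x)w(x-y)q(y)$, i.e. $Pv=r\,w*(qv)$; $P^*v(x)=\int p(y,x)v(y)\,dy$. The traveling wave operator is $Lv=-fv+Pv$. The frozen wave operator (with no diffusion) is $L^{\#}v=-fv+c\,\partial_xv+Pv$ with adjoint $L^{\#,*}v=-fv-c\,\partial_xv+P^*v$. It is assumed that there exist a unique (up to constant multiples) $0\not\equiv\hat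 u_x\in H^2$ with $L^{\#}\hat u_x=0$ and a unique (up to constant multiples) $0\not\equiv\psi\in H^2$ with $L^{\#,*}\psi=0$, and that $\hat u_x>0$ and $\psi>0$. Here $\hat u_x$ is the name of this function and $\hat u_{xx}$ denotes its derivative. $\psi$ is normalized so that $\langle\hat u_x,\psi\rangle=1$. Set $\rho(x)=\psi(x)/\hat u_x(x)$, let $$p_0(x,y)=\frac{w(x-y)q(y)\hat u_x(y)}{w*(q\hat u_x)(x)},$$ and let $\mathfrak m(x)=q(x)/r(x)$ (called the symmetrizing density of the traveling wave operator $L$).
   Formalization: Symmetry of L in L²(𝔪) (w even a.e.), suggested only by the name "symmetrizing density", is an explicit hypothesis; without it the claim fails. If c=0 and the sup norm in κ(t) is infinite, the minimum does not exist and only existence of c*>0 is claimed. *)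

theory Defs
  imports "HOL-Probability.Probability"
begin

section \<open>Weighted Lebesgue and Sobolev spaces on the line\<close>

definition winner :: "(real \<Rightarrow> real) \<Rightarrow> (real \<Rightarrow> real) \<Rightarrow> (real \<Rightarrow> real) \<Rightarrow> real" where
  "winner \<mu> u v = (\<integral>x. u x * v x * \<mu> x \<partial>lborel)"

definition wnorm :: "(real \<Rightarrow> real) \<Rightarrow> (real \<Rightarrow> real) \<Rightarrow> real" where
  "wnorm \<mu> u = sqrt (winner \<mu> u u)"

definition wL2 :: "(real \<Rightarrow> real) \<Rightarrow> (real \<Rightarrow> real) set" where
  "wL2 \<mu> = {u. u \<in> borel_measurable borel \<and> integrable lborel (\<lambda>x. (u x)\<^sup>2 * \<mu> x)}"

text \<open>
  Distributional derivative of locally integrable functions. Test functions are the compactly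
  supported \<open>C\<^sup>1\<close> functions; by mollification this is the same notion as with smooth ones.
\<close>
definition has_weak_deriv :: "(real \<Rightarrow> real) \<Rightarrow> (real \<Rightarrow> real) \<Rightarrow> bool" where
  "has_weak_deriv u u' \<longleftrightarrow>
     (\<forall>a b. set_integrable lborel {a..b} u) \<and>
     (\<forall>a b. set_integrable lborel {a..b} u') \<and>
     (\<forall>\<phi> \<phi>'. (\<forall>x. (\<phi> has_real_derivative \<phi>' x) (at x)) \<and> continuous_on UNIV \<phi>' \<and>
              bounded {x. \<phi> x \<noteq> 0} \<longrightarrow>
        (\<integral>x. u x * \<phi>' x \<partial>lborel) = - (\<integral>x. u' x * \<phi> x \<partial>lborel))"

definition weakly_differentiable :: "(real \<Rightarrow> real) \<Rightarrow> bool" where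
  "weakly_differentiable u \<longleftrightarrow> (\<exists>u'. has_weak_deriv u u')"

text \<open>
  Some representative of the weak derivative, which is unique up to null sets. Consequently all
  statements about it must be insensitive to changes on null sets.
\<close>
definition wderiv :: "(real \<Rightarrow> real) \<Rightarrow> real \<Rightarrow> real" where
  "wderiv u = (SOME u'. has_weak_deriv u u')"

definition wH :: "nat \<Rightarrow> (real \<Rightarrow> real) \<Rightarrow> (real \<Rightarrow> real) set" where
  "wH k \<mu> = {u. (\<forall>i<k. weakly_differentiable ((wderiv ^^ i) u)) \<and>
                (\<forall>i\<le>k. (wderiv ^^ i) u \<in> wL2 \<mu>)}"

definition ess_norm :: "(real \<Rightarrow> real) \<Rightarrow> ereal" where
  "ess_norm u = esssup lborel (\<lambda>x. ereal \<bar>u x\<bar>)"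

definition conv :: "(real \<Rightarrow> real) \<Rightarrow> (real \<Rightarrow> real) \<Rightarrow> real \<Rightarrow> real" where
  "conv w h x = (\<integral>y. w (x - y) * h y \<partial>lborel)"

text \<open>The variance with respect to the probability measure with Lebesgue density \<open>\<mu>\<close>.\<close>
definition Var :: "(real \<Rightarrow> real) \<Rightarrow> (real \<Rightarrow> real) \<Rightarrow> real" where
  "Var \<mu> h = (\<integral>x. (h x)\<^sup>2 * \<mu> x \<partial>lborel) - (\<integral>x. h x * \<mu> x \<partial>lborel)\<^sup>2"


section \<open>The operators\<close>

definition pker :: "(real \<Rightarrow> real) \<Rightarrow> (real \<Rightarrow> real) \<Rightarrow> (real \<Rightarrow> real) \<Rightarrow> real \<Rightarrow> real \<Rightarrow> real" where
  "pker r w q x y = r x * w (x - y) * q y"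

definition Pop :: "(real \<Rightarrow> real) \<Rightarrow> (real \<Rightarrow> real) \<Rightarrow> (real \<Rightarrow> real) \<Rightarrow> (real \<Rightarrow> real) \<Rightarrow> real \<Rightarrow> real" where
  "Pop r w q v x = (\<integral>y. pker r w q x y * v y \<partial>lborel)"

definition Padj :: "(real \<Rightarrow> real) \<Rightarrow> (real \<Rightarrow> real) \<Rightarrow> (real \<Rightarrow> real) \<Rightarrow> (real \<Rightarrow> real) \<Rightarrow> real \<Rightarrow> real" where
  "Padj r w q v x = (\<integral>y. pker r w q y x * v y \<partial>lborel)"

definition wave_op ::
  "(real \<Rightarrow> real) \<Rightarrow> (real \<Rightarrow> real) \<Rightarrow> (real \<Rightarrow> real) \<Rightarrow> (real \<Rightarrow> real) \<Rightarrow> (real \<Rightarrow> real) \<Rightarrow> real \<Rightarrow> real" where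
  "wave_op f r w q v x = - f x * v x + Pop r w q v x"

definition frozen_op ::
  "real \<Rightarrow> (real \<Rightarrow> real) \<Rightarrow> (real \<Rightarrow> real) \<Rightarrow> (real \<Rightarrow> real) \<Rightarrow> (real \<Rightarrow> real) \<Rightarrow> (real \<Rightarrow> real) \<Rightarrow> real \<Rightarrow> real" where
  "frozen_op c f r w q v x = - f x * v x + c * wderiv v x + Pop r w q v x"

definition frozen_adj ::
  "real \<Rightarrow> (real \<Rightarrow> real) \<Rightarrow> (real \<Rightarrow> real) \<Rightarrow> (real \<Rightarrow> real) \<Rightarrow> (real \<Rightarrow> real) \<Rightarrow> (real \<Rightarrow> real) \<Rightarrow> real \<Rightarrow> real" where
  "frozen_adj c f r w q v x = - f x * v x - c * wderiv v x + Padj r w q v x"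

text \<open>\<open>u\<close> spans the kernel of \<open>A\<close> in the unweighted space \<open>H\<^sup>2\<close>.\<close>
definition spans_kernel :: "((real \<Rightarrow> real) \<Rightarrow> real \<Rightarrow> real) \<Rightarrow> (real \<Rightarrow> real) \<Rightarrow> bool" where
  "spans_kernel A u \<longleftrightarrow>
     u \<in> wH 2 (\<lambda>_. 1) \<and> \<not> (AE x in lborel. u x = 0) \<and> (AE x in lborel. A u x = 0) \<and>
     (\<forall>v\<in>wH 2 (\<lambda>_. 1). (AE x in lborel. A v x = 0) \<longrightarrow>
        (\<exists>a. AE x in lborel. v x = a * u x))"

definition symmetrizes :: "(real \<Rightarrow> real) \<Rightarrow> ((real \<Rightarrow> real) \<Rightarrow> real \<Rightarrow> real) \<Rightarrow> bool" where
  "symmetrizes \<mu> A \<longleftrightarrow> (\<forall>u\<in>wL2 \<mu>. \<forall>v\<in>wL2 \<mu>. winner \<mu> (A u) v = winner \<mu> u (A v))"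

definition symm_density :: "(real \<Rightarrow> real) \<Rightarrow> (real \<Rightarrow> real) \<Rightarrow> real \<Rightarrow> real" where
  "symm_density q r x = q x / r x"


section \<open>Constants and densities attached to the wave profile\<close>

definition p0 :: "(real \<Rightarrow> real) \<Rightarrow> (real \<Rightarrow> real) \<Rightarrow> (real \<Rightarrow> real) \<Rightarrow> real \<Rightarrow> real \<Rightarrow> real" where
  "p0 w q ux x y = w (x - y) * q y * ux y / conv w (\<lambda>z. q z * ux z) x"

definition Mconst ::
  "(real \<Rightarrow> real) \<Rightarrow> (real \<Rightarrow> real) \<Rightarrow> (real \<Rightarrow> real) \<Rightarrow> (real \<Rightarrow> real) \<Rightarrow> ennreal" where
  "Mconst w wx q ux =
     (SUP x. \<integral>\<^sup>+y\<in>{x - s |s. w s > 0}. ennreal ((wx (x - y) / w (x - y))\<^sup>2 * p0 w q ux x y) \<partial>lborel)"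

definition Zmu0 :: "(real \<Rightarrow> real) \<Rightarrow> (real \<Rightarrow> real) \<Rightarrow> (real \<Rightarrow> real) \<Rightarrow> (real \<Rightarrow> real) \<Rightarrow> real" where
  "Zmu0 r w q ux = (\<integral>x. q x / r x * Pop r w q ux x * ux x \<partial>lborel)"

definition mu0 :: "(real \<Rightarrow> real) \<Rightarrow> (real \<Rightarrow> real) \<Rightarrow> (real \<Rightarrow> real) \<Rightarrow> (real \<Rightarrow> real) \<Rightarrow> real \<Rightarrow> real" where
  "mu0 r w q ux x = 1 / Zmu0 r w q ux * (q x / r x * Pop r w q ux x * ux x)"

definition Z0 ::
  "(real \<Rightarrow> real) \<Rightarrow> (real \<Rightarrow> real) \<Rightarrow> (real \<Rightarrow> real) \<Rightarrow> (real \<Rightarrow> real) \<Rightarrow> (real \<Rightarrow> real) \<Rightarrow> real" where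
  "Z0 f r w q ux = (\<integral>x. q x / (r x * f x) * Pop r w q ux x * ux x \<partial>lborel)"

text \<open>\<open>k\<close> is the Poincare constant, \<open>M\<close> is used only when it is finite.\<close>
definition kappa0 :: "(real \<Rightarrow> real) \<Rightarrow> real \<Rightarrow> ennreal \<Rightarrow> real" where
  "kappa0 f k M = (INF x. f x) / 2 * (1 - k * enn2real M / (1 + k * enn2real M))"

definition slope_norm :: "(real \<Rightarrow> real) \<Rightarrow> (real \<Rightarrow> real) \<Rightarrow> real \<Rightarrow> ereal" where
  "slope_norm f ux k0 = ess_norm (\<lambda>x. wderiv ux x / (ux x * f x) * (k0 - f x))"

text \<open>
  Extended real valued, since the supremum norm may be infinite if the wave speed vanishes;
  recall \<open>0 * \<infinity> = 0\<close> in \<^typ>\<open>ereal\<close>.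
\<close>
definition kappa ::
  "(real \<Rightarrow> real) \<Rightarrow> (real \<Rightarrow> real) \<Rightarrow> (real \<Rightarrow> real) \<Rightarrow> (real \<Rightarrow> real) \<Rightarrow> (real \<Rightarrow> real) \<Rightarrow> real \<Rightarrow> real \<Rightarrow> ereal" where
  "kappa f r w q ux k0 t =
     ereal (k0 * (1 - 2 * t\<^sup>2 / Z0 f r w q ux *
                      (wnorm (symm_density q r) (\<lambda>x. wderiv ux x / f x))\<^sup>2))
     - ereal \<bar>t\<bar> * slope_norm f ux k0"

end

theory Submission
  imports Defs
begin

text \<open>
  Put \<open>g = w * (q ux)\<close> and divide a perturbation \<open>v\<close> by the profile derivative: \<open>v = h ux\<close>. The
  nonlocal part of the operator becomes the Markov kernel \<open>P\<close> with density
  \<open>w (x - y) q(y) ux(y) / g(x)\<close>. Symmetry of the operator makes the measure \<open>\<nu> = q ux g\<close> invariant under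
  \<open>P\<close>, and \<open>\<nu>\<close> is a multiple of the measure in the Poincare inequality.

  The first step is a spectral gap for \<open>P\<close>. The derivative of \<open>P h\<close> at \<open>x\<close> is the covariance, under the
  transition density at \<open>x\<close>, of \<open>h\<close> and the score \<open>w\<^sub>x / w\<close>, whose second moment is at most \<open>M\<close>. Hence
  \<open>\<bar>(P h)'\<bar>\<^sup>2\<close> is at most \<open>M\<close> times the conditional variance of \<open>h\<close> (\<open>D_bound\<close>). Integrating and
  applying the Poincare inequality to \<open>P h\<close> gives \<open>Var (P h) \<le> a Var h\<close> with \<open>a = k M / (1 + k M)\<close>
  and \<open>k\<close> the Poincare constant (\<open>P_variance_contraction\<close>), and then
  \<open>\<langle>(1 - P) h, h\<rangle> \<ge> (1 - a) / 2 Var h\<close> (\<open>spectral_gap\<close>).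

  In the second step the equation for the profile derivative, \<open>f ux - r g = c ux'\<close>, expresses
  \<open>- \<langle>L v, v\<rangle>\<close> as that Dirichlet form plus a drift term with a factor \<open>c\<close>. Replacing \<open>\<nu>\<close> by
  \<open>\<nu> / f\<close> and using the equation once more turns the variance of \<open>h\<close> into the norm of \<open>v\<close> minus
  the square of \<open>\<langle>v, ux\<rangle>\<close>, up to terms with a factor \<open>c\<close>, which \<open>\<kappa>(c)\<close> collects
  (\<open>coercive_bounded\<close>). A slightly better choice of constants when splitting the square of the mean of
  \<open>h\<close> gives a positive constant even where \<open>\<kappa>(c) = 0\<close>, that is, for \<open>\<bar>c\<bar> = c\<^sup>*\<close>. This is first proved for
  bounded \<open>h\<close>, for which the differentiation of the convolution is justified by the integrability of
  \<open>ux \<psi>\<close>, and extended by truncation (\<open>coercive\<close>).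

  It remains to see that \<open>c\<^sup>*\<close> is attained. If the supremum norm in \<open>\<kappa>\<close> is finite, \<open>\<kappa>\<close> is a
  concave quadratic function of \<open>\<bar>t\<bar>\<close>, positive at zero, and \<open>c\<^sup>*\<close> is its positive root. For \<open>c \<noteq> 0\<close> the norm
  is always finite, because \<open>ux\<close> dominates a multiple of \<open>g\<close> (\<open>slope_bounded\<close>); this uses that the
  logarithmic derivative of \<open>g\<close> is bounded by \<open>sqrt M\<close>.

  Weak derivatives are handled through absolutely continuous representatives, for which integration
  by parts and Gronwall's inequality are proved first.
\<close>

section \<open>Indefinite Lebesgue integrals on the line\<close>

text \<open>
  \<open>primitive U u\<close> says that \<open>U\<close> is locally absolutely continuous with derivative \<open>u\<close>. Stating
  this through the fundamental theorem of calculus avoids derivatives that exist only almost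
  everywhere: every argument below needs only integrals of \<open>u\<close>.
\<close>

definition primitive :: "(real \<Rightarrow> real) \<Rightarrow> (real \<Rightarrow> real) \<Rightarrow> bool" where
  "primitive U u \<longleftrightarrow> (\<forall>a b. set_integrable lborel {a..b} u) \<and>
     (\<forall>a b. a \<le> b \<longrightarrow> U b - U a = (LINT x:{a..b}|lborel. u x))"

lemma primitiveD:
  assumes "primitive U u"
  shows "set_integrable lborel {a..b} u" "a \<le> b \<Longrightarrow> U b - U a = (LINT x:{a..b}|lborel. u x)"
  using assms by (auto simp: primitive_def)

lemma locally_integrable_measurable:
  fixes u :: "real \<Rightarrow> real"
  assumes "\<And>a b. set_integrable lborel {a..b} u"
  shows "u \<in> borel_measurable borel"
proof (rule borel_measurable_LIMSEQ_real)
  fix x :: real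
  obtain N :: nat where N: "\<bar>x\<bar> \<le> real N" using real_arch_simple by blast
  have "\<forall>\<^sub>F n in sequentially. indicator {- real n..real n} x * u x = u x"
    using eventually_ge_at_top[of N] by eventually_elim (use N in \<open>auto simp: indicator_def\<close>)
  then show "(\<lambda>n. indicator {- real n..real n} x * u x) \<longlonglongrightarrow> u x"
    by (rule tendsto_eventually)
next
  fix n :: nat
  show "(\<lambda>x. indicator {- real n..real n} x * u x) \<in> borel_measurable borel"
    using borel_measurable_integrable[OF assms[of "-real n" "real n", unfolded set_integrable_def]] by simp
qed

lemma primitive_measurable: "primitive U u \<Longrightarrow> u \<in> borel_measurable borel"
  using locally_integrable_measurable primitiveD(1) by blast

lemma primitive_isCont:
  assumes "primitive U u"
  shows "isCont U x"
proof -
  have int: "u integrable_on {x - 1..x + 1}"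
    by (intro set_borel_integral_eq_integral primitiveD[OF assms])
  have "continuous_on {x - 1..x + 1} (\<lambda>y. U (x - 1) + integral {x - 1..y} u)"
    by (intro continuous_intros indefinite_integral_continuous_1 int)
  moreover have "U (x - 1) + integral {x - 1..y} u = U y" if "y \<in> {x - 1..x + 1}" for y
    using primitiveD[OF assms, of "x - 1" y] that
      set_borel_integral_eq_integral(2)[OF primitiveD(1)[OF assms, of "x - 1" y]] by simp
  ultimately have "continuous_on {x - 1..x + 1} U"
    by (metis (no_types, lifting) continuous_on_cong)
  then show ?thesis
    by (rule continuous_on_interior) simp
qed

lemma primitive_continuous: "primitive U u \<Longrightarrow> continuous_on S U"
  by (simp add: continuous_at_imp_continuous_on primitive_isCont)

lemma primitive_borel: "primitive U u \<Longrightarrow> U \<in> borel_measurable borel"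
  by (simp add: borel_measurable_continuous_onI primitive_continuous)

lemma set_integrable_mult_bounded:
  fixes u V :: "real \<Rightarrow> real"
  assumes "set_integrable lborel S u" "V \<in> borel_measurable borel" "\<And>x. x \<in> S \<Longrightarrow> \<bar>V x\<bar> \<le> B"
  shows "set_integrable lborel S (\<lambda>x. u x * V x)"
proof -
  have "integrable lborel (\<lambda>x. B * (indicator S x * u x))"
    using assms(1) by (simp add: set_integrable_def)
  moreover have "(\<lambda>x. indicator S x * u x * V x) \<in> borel_measurable lborel"
    using borel_measurable_integrable[OF assms(1)[unfolded set_integrable_def]] assms(2) by simp
  ultimately have "integrable lborel (\<lambda>x. indicator S x * u x * V x)"
    by (rule Bochner_Integration.integrable_bound)
      (use assms(3) in \<open>force intro!: always_eventually mult_right_mono 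
         simp: abs_mult indicator_def mult.commute[of "\<bar>u _\<bar>"]\<close>)
  then show ?thesis by (simp add: set_integrable_def mult.assoc)
qed

lemma continuous_locally_integrable:
  fixes U :: "real \<Rightarrow> real"
  assumes "continuous_on UNIV U"
  shows "set_integrable lborel {a..b} U"
proof -
  have "isCont U x" for x using assms by (simp add: continuous_on_eq_continuous_at)
  then show ?thesis
    using borel_integrable_atLeastAtMost[of a b U]
    by (simp add: set_integrable_def indicator_times_eq_if)
qed

lemma derivative_zero_outside_support:
  fixes \<phi> :: "real \<Rightarrow> real"
  assumes "(\<phi> has_real_derivative D) (at x)" "\<And>y. \<bar>y\<bar> > R \<Longrightarrow> \<phi> y = 0" "\<bar>x\<bar> > R"
  shows "D = 0"
proof (rule DERIV_unique[OF assms(1)])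
  have "\<forall>\<^sub>F y in nhds x. \<bar>y\<bar> > R"
    using assms(3) by (intro order_tendstoD(1)[OF tendsto_rabs[OF filterlim_ident]])
  then have "\<forall>\<^sub>F y in nhds x. \<phi> y = 0" by eventually_elim (rule assms(2))
  then show "(\<phi> has_real_derivative 0) (at x)"
    by (subst DERIV_cong_ev[where g="\<lambda>_. 0"]) auto
qed

lemma set_integrable_mult_continuous:
  fixes u V :: "real \<Rightarrow> real"
  assumes "set_integrable lborel {a..b} u" "continuous_on UNIV V"
  shows "set_integrable lborel {a..b} (\<lambda>x. u x * V x)"
proof -
  have "bounded (V ` {a..b})"
    by (intro compact_imp_bounded compact_continuous_image continuous_on_subset[OF assms(2)]) auto
  then obtain B where "\<forall>x\<in>V ` {a..b}. norm x \<le> B" unfolding bounded_iff by blast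
  then show ?thesis
    by (intro set_integrable_mult_bounded[OF assms(1), of V B] borel_measurable_continuous_onI assms(2)) auto
qed

lemma integrable_mult_compact_support:
  fixes u V :: "real \<Rightarrow> real"
  assumes "\<And>a b. set_integrable lborel {a..b} u" "continuous_on UNIV V" "\<And>x. \<bar>x\<bar> > R \<Longrightarrow> V x = 0"
  shows "integrable lborel (\<lambda>x. u x * V x)"
proof -
  have "integrable lborel (\<lambda>x. indicator {-R..R} x * (u x * V x))"
    using set_integrable_mult_continuous[OF assms(1,2)] by (simp add: set_integrable_def)
  moreover have "indicator {-R..R} x * (u x * V x) = u x * V x" for x
    by (cases "\<bar>x\<bar> > R") (auto simp: indicator_def assms(3))
  ultimately show ?thesis by simp
qed

text \<open>
  Integration by parts. Expanding \<open>V x = V a + \<integral>\<^sub>a\<^sup>x v\<close> in \<open>u V\<close> and \<open>U x = U b - \<integral>\<^sub>x\<^sup>b u\<close> in \<open>U v\<close>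
  leaves two iterated integrals of \<open>u x * v t\<close> over the triangle \<open>a \<le> t \<le> x \<le> b\<close>, which cancel by
  Fubini's theorem. All later calculus (quotients, exponential factors, squares) rests on this rule.
\<close>

lemma primitive_mult:
  assumes U: "primitive U u" and V: "primitive V v"
  shows "primitive (\<lambda>x. U x * V x) (\<lambda>x. u x * V x + U x * v x)"
proof -
  note cont = primitive_continuous[OF U] primitive_continuous[OF V]
  note [measurable] = primitive_measurable[OF U] primitive_measurable[OF V]
  have i1: "set_integrable lborel {a..b} (\<lambda>x. u x * V x)" for a b
    by (intro set_integrable_mult_continuous primitiveD[OF U] cont)
  have i2: "set_integrable lborel {a..b} (\<lambda>x. U x * v x)" for a b
    using set_integrable_mult_continuous[OF primitiveD(1)[OF V] cont(1)] by (simp add: mult.commute)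
  have eq: "U b * V b - U a * V a = (LINT x:{a..b}|lborel. u x * V x + U x * v x)" if "a \<le> b" for a b
  proof -
    let ?I = "\<lambda>x. indicator {a..b} x :: real"
    \<comment> \<open>the integrand on the triangle, extended by zero\<close>
    define F where "F x t = (?I x * u x) * (?I t * v t) * indicator {t..} x" for x t
    have iu: "integrable lborel (\<lambda>x. ?I x * u x)" and iv: "integrable lborel (\<lambda>x. ?I x * v x)"
      using primitiveD(1)[OF U, of a b] primitiveD(1)[OF V, of a b] by (auto simp: set_integrable_def)
    have "integrable (lborel \<Otimes>\<^sub>M lborel) (\<lambda>(x, t). (?I x * u x) * (?I t * v t))"
    proof (rule lborel_pair.Fubini_integrable)
      show "integrable lborel (\<lambda>x. LINT y|lborel. norm (case (x, y) of (x, t) \<Rightarrow> ?I x * u x * (?I t * v t)))"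
        using integrable_mult_left[OF integrable_norm[OF iu], of "LINT y|lborel. norm (?I y * v y)"]
        by (simp add: abs_mult)
      show "AE x in lborel. integrable lborel (\<lambda>y. case (x, y) of (x, t) \<Rightarrow> ?I x * u x * (?I t * v t))"
        using iv by simp
    qed measurable
    then have "integrable (lborel \<Otimes>\<^sub>M lborel) (\<lambda>(x, t). F x t)"
    proof (rule Bochner_Integration.integrable_bound)
      have "closed {p. snd p \<le> (fst p :: real)}"
        by (intro closed_Collect_le continuous_intros)
      then have "{p. snd p \<le> (fst p :: real)} \<in> sets (lborel \<Otimes>\<^sub>M lborel)"
        unfolding lborel_prod by simp
      then have "(\<lambda>p. indicator {p. snd p \<le> (fst p :: real)} p * (?I (fst p) * u (fst p) * (?I (snd p) * v (snd p))))
         \<in> borel_measurable (lborel \<Otimes>\<^sub>M lborel)" by measurable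
      then show "(\<lambda>(x, t). F x t) \<in> borel_measurable (lborel \<Otimes>\<^sub>M lborel)"
        by (rule measurable_cong[THEN iffD1, rotated]) (auto simp: F_def indicator_def)
    qed (auto simp: F_def abs_mult indicator_def)
    from lborel_pair.Fubini_integral[OF this]
    have fub: "(LINT t|lborel. LINT x|lborel. F x t) = (LINT x|lborel. LINT t|lborel. F x t)" .
    have inner1: "(LINT t|lborel. F x t) = ?I x * u x * (V x - V a)" for x
    proof (cases "x \<in> {a..b}")
      case True
      have "(LINT t|lborel. F x t) = (LINT t|lborel. ?I x * u x * (indicator {a..x} t * v t))"
        using True by (intro Bochner_Integration.integral_cong) (auto simp: F_def indicator_def)
      also have "\<dots> = ?I x * u x * (V x - V a)"
        using primitiveD(2)[OF V, of a x] True by (simp add: set_lebesgue_integral_def)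
      finally show ?thesis .
    qed (simp add: F_def)
    have inner2: "(LINT x|lborel. F x t) = ?I t * v t * (U b - U t)" for t
    proof (cases "t \<in> {a..b}")
      case True
      have "(LINT x|lborel. F x t) = (LINT x|lborel. ?I t * v t * (indicator {t..b} x * u x))"
        using True by (intro Bochner_Integration.integral_cong) (auto simp: F_def indicator_def)
      also have "\<dots> = ?I t * v t * (U b - U t)"
        using primitiveD(2)[OF U, of t b] True by (simp add: set_lebesgue_integral_def)
      finally show ?thesis .
    qed (simp add: F_def)
    have j1: "integrable lborel (\<lambda>x. ?I x * u x * V x)" and j2: "integrable lborel (\<lambda>x. ?I x * v x * U x)"
      using i1[of a b] i2[of a b] by (auto simp: set_integrable_def ac_simps)
    have k1: "(LINT x|lborel. ?I x * u x * V x) = (LINT x:{a..b}|lborel. u x * V x)"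
      and k2: "(LINT x|lborel. ?I x * v x * U x) = (LINT x:{a..b}|lborel. U x * v x)"
      by (simp_all add: set_lebesgue_integral_def ac_simps)
    have "(LINT x|lborel. ?I x * u x * (V x - V a)) = (LINT x:{a..b}|lborel. u x * V x) - (U b - U a) * V a"
      unfolding right_diff_distrib
      by (subst Bochner_Integration.integral_diff)
        (use iu j1 k1 primitiveD(2)[OF U that] in \<open>auto simp: set_lebesgue_integral_def\<close>)
    moreover have "(LINT x|lborel. ?I x * v x * (U b - U x)) = (V b - V a) * U b - (LINT x:{a..b}|lborel. U x * v x)"
      unfolding right_diff_distrib
      by (subst Bochner_Integration.integral_diff)
        (use iv j2 k2 primitiveD(2)[OF V that] in \<open>auto simp: set_lebesgue_integral_def\<close>)
    moreover have "(LINT x:{a..b}|lborel. u x * V x + U x * v x)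
       = (LINT x:{a..b}|lborel. u x * V x) + (LINT x:{a..b}|lborel. U x * v x)"
      by (rule set_integral_add) (use i1 i2 in auto)
    ultimately show ?thesis using fub unfolding inner1 inner2 by (simp add: algebra_simps)
  qed
  show ?thesis unfolding primitive_def using eq set_integral_add(1)[OF i1 i2] by blast
qed

lemma primitive_C1:
  assumes "\<And>x. (\<phi> has_real_derivative \<phi>' x) (at x)" "continuous_on UNIV \<phi>'"
  shows "primitive \<phi> \<phi>'"
proof -
  have c: "isCont \<phi>' x" for x
    using assms(2) by (simp add: continuous_on_eq_continuous_at)
  have "\<phi> b - \<phi> a = (LINT x:{a..b}|lborel. \<phi>' x)" if "a \<le> b" for a b
    using integral_FTC_atLeastAtMost[OF that, of \<phi> \<phi>'] assms that c
    by (simp add: set_lebesgue_integral_def has_real_derivative_iff_has_vector_derivative has_vector_derivative_at_within continuous_at_imp_continuous_on)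
  then show ?thesis
    unfolding primitive_def using continuous_locally_integrable[OF assms(2)] by blast
qed

lemma primitive_add_const: "primitive U u \<Longrightarrow> primitive (\<lambda>x. k + U x) u"
  unfolding primitive_def by simp

lemma primitive_linear:
  assumes "primitive U u" "primitive V v"
  shows "primitive (\<lambda>x. a * U x + b * V x) (\<lambda>x. a * u x + b * v x)"
proof -
  have i: "set_integrable lborel {s..t} (\<lambda>x. a * u x)" "set_integrable lborel {s..t} (\<lambda>x. b * v x)" for s t
    using primitiveD(1)[OF assms(1)] primitiveD(1)[OF assms(2)] by (auto simp: set_integrable_mult_right)
  have "a * U t + b * V t - (a * U s + b * V s) = (LINT x:{s..t}|lborel. a * u x + b * v x)" if "s \<le> t" for s t
    unfolding set_integral_add(2)[OF i] 
    using primitiveD(2)[OF assms(1) that] primitiveD(2)[OF assms(2) that] 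
    by (simp add: algebra_simps set_integral_mult_right flip: right_diff_distrib)
  then show ?thesis unfolding primitive_def using set_integral_add(1)[OF i] by blast
qed

lemma primitive_exists:
  assumes "\<And>a b. set_integrable lborel {a..b} u"
  obtains U where "primitive U u"
proof -
  define U where "U x = (if 0 \<le> x then (LINT t:{0..x}|lborel. u t) else - (LINT t:{x..0}|lborel. u t))" for x
  have split: "(LINT t:{a..c}|lborel. u t) = (LINT t:{a..b}|lborel. u t) + (LINT t:{b..c}|lborel. u t)"
    if "a \<le> b" "b \<le> c" for a b c
    using Henstock_Kurzweil_Integration.integral_combine[OF that, of u] assms
    by (simp add: set_borel_integral_eq_integral)
  have "U b - U a = (LINT x:{a..b}|lborel. u x)" if "a \<le> b" for a b
    using split[of 0 a b] split[of a 0 b] split[of a b 0] that by (auto simp: U_def)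
  then have "primitive U u" using assms unfolding primitive_def by blast
  then show ?thesis by (rule that)
qed

text \<open>
  A test function is itself a primitive of its derivative, so integration by parts applies to
  \<open>U * \<phi>\<close>; the boundary terms vanish outside the support.
\<close>

lemma primitive_weak_deriv:
  assumes "primitive U u"
  shows "has_weak_deriv U u"
  unfolding has_weak_deriv_def
proof (intro conjI allI impI)
  fix a b
  show "set_integrable lborel {a..b} U"
    by (intro continuous_locally_integrable primitive_continuous[OF assms])
  show "set_integrable lborel {a..b} u" using assms by (rule primitiveD)
next
  fix \<phi> \<phi>' :: "real \<Rightarrow> real"
  assume *: "(\<forall>x. (\<phi> has_real_derivative \<phi>' x) (at x)) \<and> continuous_on UNIV \<phi>' \<and> bounded {x. \<phi> x \<noteq> 0}"
  then obtain R where R: "\<forall>x\<in>{x. \<phi> x \<noteq> 0}. norm x \<le> R" unfolding bounded_iff by blast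
  have \<phi>0: "\<phi> x = 0" if "\<bar>x\<bar> > R" for x using R that by force
  have \<phi>'0: "\<phi>' x = 0" if "\<bar>x\<bar> > R" for x
    using derivative_zero_outside_support[of \<phi> "\<phi>' x" x R] * \<phi>0 that by blast
  have P\<phi>: "primitive \<phi> \<phi>'" using * by (intro primitive_C1) auto
  define S where "S = \<bar>R\<bar> + 1"
  have i1: "set_integrable lborel {-S..S} (\<lambda>x. u x * \<phi> x)"
    by (intro set_integrable_mult_continuous primitiveD[OF assms] primitive_continuous[OF P\<phi>])
  have i2: "set_integrable lborel {-S..S} (\<lambda>x. U x * \<phi>' x)"
    using set_integrable_mult_continuous[OF primitiveD(1)[OF P\<phi>] primitive_continuous[OF assms]] by (simp add: mult.commute)
  have "U S * \<phi> S - U (-S) * \<phi> (-S) = (LINT x:{-S..S}|lborel. u x * \<phi> x + U x * \<phi>' x)"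
    by (rule primitiveD(2)[OF primitive_mult[OF assms P\<phi>]]) (simp add: S_def)
  then have "0 = (LINT x:{-S..S}|lborel. u x * \<phi> x) + (LINT x:{-S..S}|lborel. U x * \<phi>' x)"
    unfolding set_integral_add(2)[OF i1 i2] using \<phi>0[of S] \<phi>0[of "-S"] by (simp add: S_def)
  moreover have "(LINT x:{-S..S}|lborel. u x * \<phi> x) = (LINT x|lborel. u x * \<phi> x)"
    unfolding set_lebesgue_integral_def
    by (intro Bochner_Integration.integral_cong) (auto simp: indicator_def S_def intro!: \<phi>0)
  moreover have "(LINT x:{-S..S}|lborel. U x * \<phi>' x) = (LINT x|lborel. U x * \<phi>' x)"
    unfolding set_lebesgue_integral_def
    by (intro Bochner_Integration.integral_cong) (auto simp: indicator_def S_def intro!: \<phi>'0)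
  ultimately show "(LINT x|lborel. U x * \<phi>' x) = - (LINT x|lborel. u x * \<phi> x)" by simp
qed

lemma has_weak_deriv_cong_AE:
  assumes "has_weak_deriv U u" "AE x in lborel. U x = V x" "AE x in lborel. u x = v x"
    "V \<in> borel_measurable borel" "v \<in> borel_measurable borel"
  shows "has_weak_deriv V v"
proof -
  have [measurable]: "U \<in> borel_measurable borel" "u \<in> borel_measurable borel"
    using assms(1) by (auto simp: has_weak_deriv_def intro: locally_integrable_measurable)
  note [measurable] = assms(4,5)
  have 1: "set_integrable lborel {a..b} V" "set_integrable lborel {a..b} v" for a b
  proof -
    have "set_integrable lborel {a..b} U" "set_integrable lborel {a..b} u" 
      using assms(1) by (auto simp: has_weak_deriv_def)
    then show "set_integrable lborel {a..b} V" "set_integrable lborel {a..b} v" 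
      unfolding set_integrable_def using assms(2,3)
      by (subst (asm) integrable_cong_AE; force)+
  qed
  have 2: "(LINT x|lborel. V x * \<phi>' x) = - (LINT x|lborel. v x * \<phi> x)"
    if *: "(\<forall>x. (\<phi> has_real_derivative \<phi>' x) (at x)) \<and> continuous_on UNIV \<phi>' \<and> bounded {x. \<phi> x \<noteq> 0}" for \<phi> \<phi>'
  proof -
    have [measurable]: "\<phi>' \<in> borel_measurable borel" using * by (auto intro: borel_measurable_continuous_onI)
    have "continuous_on UNIV \<phi>" using * DERIV_isCont continuous_at_imp_continuous_on by blast
    then have [measurable]: "\<phi> \<in> borel_measurable borel" by (auto intro: borel_measurable_continuous_onI)
    have "(LINT x|lborel. V x * \<phi>' x) = (LINT x|lborel. U x * \<phi>' x)"
      using assms(2) by (intro integral_cong_AE) auto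
    also have "\<dots> = - (LINT x|lborel. u x * \<phi> x)"
      using assms(1) * by (auto simp: has_weak_deriv_def)
    also have "(LINT x|lborel. u x * \<phi> x) = (LINT x|lborel. v x * \<phi> x)"
      using assms(3) by (intro integral_cong_AE) auto
    finally show ?thesis .
  qed
  show ?thesis unfolding has_weak_deriv_def using 1 2 by blast
qed

section \<open>Weak derivatives and absolutely continuous representatives\<close>

lemma primitive_has_derivative:
  assumes "primitive U u" "\<And>x. isCont u x"
  shows "(U has_real_derivative u x) (at x)"
proof -
  have "((\<lambda>y. integral {x - 1..y} u) has_real_derivative u x) (at x within {x - 1..x + 1})"
    by (rule integral_has_real_derivative) (auto intro: continuous_at_imp_continuous_on assms)
  then have "((\<lambda>y. integral {x - 1..y} u) has_real_derivative u x) (at x)"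
    by (simp add: at_within_Icc_at)
  then have "((\<lambda>y. U (x - 1) + integral {x - 1..y} u) has_real_derivative u x) (at x)"
    by (auto intro!: derivative_eq_intros)
  moreover have "\<forall>\<^sub>F y in nhds x. U (x - 1) + integral {x - 1..y} u = U y"
  proof -
    have "\<forall>\<^sub>F y in nhds x. x - 1 < y"
      by (rule order_tendstoD(1)[OF filterlim_ident]) simp
    then show ?thesis
    proof eventually_elim
      case (elim y)
      then show ?case using primitiveD(2)[OF assms(1), of "x - 1" y]
        set_borel_integral_eq_integral(2)[OF primitiveD(1)[OF assms(1), of "x - 1" y]] by simp
    qed
  qed
  ultimately show ?thesis by (subst (asm) DERIV_cong_ev) auto
qed

text \<open>
  On a bounded window, the sets over which the integral of \<open>e\<close> vanishes form a Dynkin system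
  containing the half-lines, hence all Borel sets.
\<close>

lemma primitive_const_imp_zero:
  assumes "primitive (\<lambda>_. K) e"
  shows "AE x in lborel. e x = 0"
proof -
  note [measurable] = primitive_measurable[OF assms]
  have "AE x in lborel. indicator {- real n..real n} x * e x = 0" for n :: nat
  proof (rule sigma_finite_measure.density_zero[OF sigma_finite_lborel])
    let ?k = "\<lambda>x. indicator {- real n..real n} x * e x"
    show int: "integrable lborel ?k"
      using primitiveD(1)[OF assms, of "- real n" "real n"] by (simp add: set_integrable_def)
    fix A :: "real set" assume "A \<in> sets lborel"
    then have A: "A \<in> sigma_sets UNIV (range (\<lambda>a::real. {..a}))"
      by (simp add: borel_eq_atMost sets_measure_of)
    show "(LINT x:A|lborel. ?k x) = 0"
    proof (rule sigma_sets_induct_disjoint[OF _ _ A])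
      show "Int_stable (range (\<lambda>a::real. {..a}))"
        by (auto simp: Int_stable_def)
      fix B assume "B \<in> range (\<lambda>a::real. {..a})"
      then obtain a where B: "B = {..a}" by auto
      show "(LINT x:B|lborel. ?k x) = 0"
      proof (cases "- real n \<le> min a (real n)")
        case True
        have "(LINT x:B|lborel. ?k x) = (LINT x:{- real n..min a (real n)}|lborel. e x)"
          unfolding set_lebesgue_integral_def B
          by (intro Bochner_Integration.integral_cong) (auto simp: indicator_def)
        then show ?thesis using primitiveD(2)[OF assms True] by simp
      next
        case False
        then have "(LINT x:B|lborel. ?k x) = (LINT x:{}|lborel. ?k x)"
          unfolding set_lebesgue_integral_def B
          by (intro Bochner_Integration.integral_cong) (auto simp: indicator_def)
        then show ?thesis by (simp add: set_lebesgue_integral_def)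
      qed
    next
      fix B :: "real set" assume B: "B \<in> sigma_sets UNIV (range (\<lambda>a::real. {..a}))" "(LINT x:B|lborel. ?k x) = 0"
      then have Bm: "B \<in> sets lborel" by (simp add: borel_eq_atMost sets_measure_of)
      have i: "set_integrable lborel C ?k" if "C \<in> sets lborel" for C
        unfolding set_integrable_def using int that integrable_mult_indicator by blast
      have "(LINT x:B \<union> (UNIV - B)|lborel. ?k x) = (LINT x:B|lborel. ?k x) + (LINT x:UNIV - B|lborel. ?k x)"
        using Bm by (intro set_integral_Un i) auto
      moreover have "(LINT x:B \<union> (UNIV - B)|lborel. ?k x) = (LINT x:{- real n..real n}|lborel. e x)"
        by (simp add: set_lebesgue_integral_def)
      moreover have "\<dots> = 0" using primitiveD(2)[OF assms, of "- real n" "real n"] by simp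
      ultimately show "(LINT x:UNIV - B|lborel. ?k x) = 0" using B by simp
    next
      fix B :: "nat \<Rightarrow> real set"
      assume B: "disjoint_family B" "range B \<subseteq> sigma_sets UNIV (range (\<lambda>a::real. {..a}))"
        "\<And>i. (LINT x:B i|lborel. ?k x) = 0"
      then have Bm: "B i \<in> sets lborel" for i by (auto simp: borel_eq_atMost sets_measure_of)
      have "(LINT x:(\<Union>i. B i)|lborel. ?k x) = (\<Sum>i. LINT x:B i|lborel. ?k x)"
      proof (rule lebesgue_integral_countable_add)
        show "set_integrable lborel (\<Union> (range B)) ?k"
          unfolding set_integrable_def using int Bm by (intro integrable_mult_indicator) auto
      qed (use B Bm in \<open>auto simp: disjoint_family_on_def\<close>)
      then show "(LINT x:(\<Union>i. B i)|lborel. ?k x) = 0" using B by simp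
    qed (auto simp: set_lebesgue_integral_def)
  qed
  then have "AE x in lborel. \<forall>n::nat. indicator {- real n..real n} x * e x = 0"
    unfolding AE_all_countable by blast
  then show ?thesis
  proof eventually_elim
    case (elim x)
    obtain N :: nat where "\<bar>x\<bar> \<le> real N" using real_arch_simple by blast
    then show ?case using spec[OF elim, of N] by (auto simp: indicator_def)
  qed
qed

lemma primitive_unique:
  assumes "primitive U u" "primitive U v"
  shows "AE x in lborel. u x = v x"
  using primitive_const_imp_zero[of 0 "\<lambda>x. u x - v x"] primitive_linear[OF assms, of 1 "-1"] by simp

text \<open>
  Every continuous function with compact support and mean zero is the derivative of a test
  function, so \<open>d\<close> annihilates all of them. Subtracting a multiple of one fixed bump \<open>\<theta>\<close> removes
  the restriction on the mean and turns the pairing of \<open>d\<close> with \<open>\<eta>\<close> into \<open>C\<close> times the integral of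
  \<open>\<eta>\<close>. Trapezoids increasing to the indicator of an interval then show that \<open>d - C\<close> has vanishing
  integral over every interval.
\<close>

lemma du_Bois_Reymond:
  assumes int: "\<And>a b. set_integrable lborel {a..b} d"
    and zero: "\<And>\<phi> \<phi>'. (\<And>x. (\<phi> has_real_derivative \<phi>' x) (at x)) \<Longrightarrow> continuous_on UNIV \<phi>' \<Longrightarrow>
      bounded {x. \<phi> x \<noteq> 0} \<Longrightarrow> (LINT x|lborel. d x * \<phi>' x) = 0"
  obtains C where "AE x in lborel. d x = C"
proof -
  note [measurable] = locally_integrable_measurable[OF int]
  have supp_int: "integrable lborel (\<lambda>x. d x * \<eta> x)" "integrable lborel \<eta>"
    if "continuous_on UNIV \<eta>" "\<And>x. \<bar>x\<bar> > R \<Longrightarrow> \<eta> x = 0" for \<eta> :: "real \<Rightarrow> real" and R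
  proof -
    show "integrable lborel (\<lambda>x. d x * \<eta> x)"
      by (rule integrable_mult_compact_support[OF int that])
    show "integrable lborel \<eta>"
      using integrable_mult_compact_support[of "\<lambda>_. 1", OF continuous_locally_integrable that] by simp
  qed
  have mean0: "(LINT x|lborel. d x * \<eta> x) = 0"
    if c: "continuous_on UNIV \<eta>" and s: "\<And>x. \<bar>x\<bar> > R \<Longrightarrow> \<eta> x = 0" and m: "(LINT x|lborel. \<eta> x) = 0"
    for \<eta> :: "real \<Rightarrow> real" and R
  proof -
    have cont: "isCont \<eta> x" for x using c by (simp add: continuous_on_eq_continuous_at)
    have s': "\<bar>x\<bar> \<le> R" if "\<eta> x \<noteq> 0" for x using s[of x] that by force
    obtain U where U: "primitive U \<eta>"
      using primitive_exists[OF continuous_locally_integrable[OF c]] .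
    define \<phi> where "\<phi> x = - U (- \<bar>R\<bar> - 1) + U x" for x
    have P: "primitive \<phi> \<eta>" unfolding \<phi>_def by (rule primitive_add_const[OF U])
    have "\<phi> x = 0" if "\<bar>x\<bar> > \<bar>R\<bar> + 1" for x
    proof (cases "x < 0")
      case True
      have "U (- \<bar>R\<bar> - 1) - U x = (LINT x:{x..- \<bar>R\<bar> - 1}|lborel. \<eta> x)"
        by (rule primitiveD(2)[OF U]) (use that True in simp)
      also have "\<dots> = (LINT x::real|lborel. (0::real))"
        unfolding set_lebesgue_integral_def
        by (intro Bochner_Integration.integral_cong) (use that True s in \<open>auto simp: indicator_def\<close>)
      finally show ?thesis by (simp add: \<phi>_def)
    next
      case False
      have "U x - U (- \<bar>R\<bar> - 1) = (LINT x:{- \<bar>R\<bar> - 1..x}|lborel. \<eta> x)"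
        by (rule primitiveD(2)[OF U]) (use that False in simp)
      also have "\<dots> = (LINT x|lborel. \<eta> x)"
        unfolding set_lebesgue_integral_def
        by (intro Bochner_Integration.integral_cong) (use that False in \<open>auto simp: indicator_def dest!: s'\<close>)
      finally show ?thesis using m by (simp add: \<phi>_def)
    qed
    then have "{x. \<phi> x \<noteq> 0} \<subseteq> {- (\<bar>R\<bar> + 1)..\<bar>R\<bar> + 1}"
      by (force simp: abs_le_iff)
    then have "bounded {x. \<phi> x \<noteq> 0}" by (meson bounded_closed_interval bounded_subset)
    then show ?thesis using zero[of \<phi> \<eta>] primitive_has_derivative[OF P cont] c by blast
  qed
  define \<theta> :: "real \<Rightarrow> real" where "\<theta> x = max 0 (1 - \<bar>x\<bar>)" for x
  define J where "J = (LINT x|lborel. \<theta> x)"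
  have \<theta>c: "continuous_on UNIV \<theta>" unfolding \<theta>_def by (intro continuous_intros)
  have \<theta>s: "\<theta> x = 0" if "\<bar>x\<bar> > 1" for x using that by (simp add: \<theta>_def)
  note \<theta>i = supp_int[OF \<theta>c \<theta>s]
  have "J \<noteq> 0"
  proof
    assume "J = 0"
    then have "AE x in lborel. \<theta> x = 0"
      using integral_nonneg_eq_0_iff_AE[OF \<theta>i(2)] by (simp add: J_def \<theta>_def)
    then have "AE x in lborel. x \<notin> {-1<..<1::real}"
      by eventually_elim (auto simp: \<theta>_def)
    then have "{-1<..<1::real} \<in> null_sets lborel"
      by (simp add: AE_iff_null_sets)
    then show False by (simp add: null_sets_def)
  qed
  define C where "C = (LINT x|lborel. d x * \<theta> x) / J"
  have lin: "(LINT x|lborel. d x * \<eta> x) = C * (LINT x|lborel. \<eta> x)"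
    if c: "continuous_on UNIV \<eta>" and s: "\<And>x. \<bar>x\<bar> > R \<Longrightarrow> \<eta> x = 0" for \<eta> :: "real \<Rightarrow> real" and R
  proof -
    let ?t = "(LINT x|lborel. \<eta> x) / J"
    note \<eta>i = supp_int[OF c s]
    have "(LINT x|lborel. d x * (\<eta> x - ?t * \<theta> x)) = 0"
    proof (rule mean0[where R="max R 1"])
      show "continuous_on UNIV (\<lambda>x. \<eta> x - ?t * \<theta> x)" by (intro continuous_intros c \<theta>c)
      show "\<eta> x - ?t * \<theta> x = 0" if "\<bar>x\<bar> > max R 1" for x using that s \<theta>s by simp
      show "(LINT x|lborel. \<eta> x - ?t * \<theta> x) = 0"
        by (subst Bochner_Integration.integral_diff)
          (use \<eta>i \<theta>i \<open>J \<noteq> 0\<close> in \<open>auto simp: J_def[symmetric]\<close>)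
    qed
    also have "(LINT x|lborel. d x * (\<eta> x - ?t * \<theta> x)) = (LINT x|lborel. d x * \<eta> x - ?t * (d x * \<theta> x))"
      by (intro Bochner_Integration.integral_cong) (auto simp: algebra_simps)
    also have "\<dots> = (LINT x|lborel. d x * \<eta> x) - ?t * (LINT x|lborel. d x * \<theta> x)"
      by (subst Bochner_Integration.integral_diff) (use \<eta>i \<theta>i in auto)
    finally show ?thesis by (simp add: C_def)
  qed
  have "primitive (\<lambda>_. 0) (\<lambda>x. d x - C)"
    unfolding primitive_def
  proof (intro conjI allI impI)
    have ci: "set_integrable lborel {a..b} (\<lambda>x. C)" for a b :: real
      by (intro continuous_locally_integrable continuous_intros)
    show "set_integrable lborel {a..b} (\<lambda>x. d x - C)" for a b
      using set_integral_diff(1)[OF int ci] .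
    fix a b :: real assume "a \<le> b"
    \<comment> \<open>trapezoids supported in \<open>(a, b)\<close> with slopes \<open>n\<close>\<close>
    define T where "T n x = max 0 (min 1 (real n * min (x - a) (b - x)))" for n :: nat and x
    have Tc: "continuous_on UNIV (T n)" for n unfolding T_def by (intro continuous_intros)
    have [measurable]: "T n \<in> borel_measurable borel" for n
      by (rule borel_measurable_continuous_onI[OF Tc])
    have Ts: "T n x = 0" if "x \<notin> {a<..<b}" for x n
    proof -
      have "real n * min (x - a) (b - x) \<le> 0" using that by (intro mult_nonneg_nonpos) auto
      then show ?thesis by (simp add: T_def)
    qed
    have lim: "(\<lambda>n. T n x) \<longlonglongrightarrow> indicator {a<..<b} x" for x
    proof (cases "x \<in> {a<..<b}")
      case True
      define \<epsilon> where "\<epsilon> = min (x - a) (b - x)"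
      have "\<epsilon> > 0" using True by (simp add: \<epsilon>_def)
      then obtain N :: nat where N: "real N * \<epsilon> > 1" using reals_Archimedean3 by blast
      have "\<forall>\<^sub>F n in sequentially. T n x = indicator {a<..<b} x"
        using eventually_ge_at_top[of N]
      proof eventually_elim
        case (elim n)
        have "real N * \<epsilon> \<le> real n * \<epsilon>" using elim \<open>\<epsilon> > 0\<close> by (intro mult_right_mono) auto
        with N have "1 \<le> real n * \<epsilon>" by linarith
        then show ?case using True by (simp add: T_def \<epsilon>_def[symmetric])
      qed
      then show ?thesis by (rule tendsto_eventually)
    qed (simp add: Ts)
    have bound: "\<bar>T n x\<bar> \<le> indicator {a..b} x" for n x
      using Ts[of x n] by (auto simp: T_def indicator_def)
    have i1: "integrable lborel (\<lambda>x. \<bar>d x\<bar> * indicator {a..b} x)"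
      using integrable_norm[OF int[of a b, unfolded set_integrable_def]] by (simp add: abs_mult mult.commute)
    have l1: "(\<lambda>n. LINT x|lborel. d x * T n x) \<longlonglongrightarrow> (LINT x|lborel. d x * indicator {a<..<b} x)"
    proof (rule integral_dominated_convergence[OF _ _ i1])
      show "AE x in lborel. (\<lambda>n. d x * T n x) \<longlonglongrightarrow> d x * indicator {a<..<b} x"
        using lim by (intro always_eventually allI tendsto_mult_left)
      show "AE x in lborel. norm (d x * T n x) \<le> \<bar>d x\<bar> * indicator {a..b} x" for n
        using bound by (auto simp: abs_mult intro!: mult_left_mono)
    qed auto
    have l2: "(\<lambda>n. LINT x|lborel. T n x) \<longlonglongrightarrow> (LINT x|lborel. indicator {a<..<b} x)"
    proof (rule integral_dominated_convergence[where w="indicator {a..b}"])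
      show "integrable lborel (indicator {a..b} :: real \<Rightarrow> real)"
        by (intro integrable_real_indicator) (auto simp: emeasure_lborel_Icc_eq)
      show "AE x in lborel. (\<lambda>n. T n x) \<longlonglongrightarrow> indicator {a<..<b} x"
        using lim by auto
      show "AE x in lborel. norm (T n x) \<le> indicator {a..b} x" for n
        using bound by auto
    qed auto
    have "(LINT x|lborel. d x * T n x) = C * (LINT x|lborel. T n x)" for n
      by (rule lin[OF Tc, where R="max \<bar>a\<bar> \<bar>b\<bar>"]) (auto intro!: Ts)
    then have "(LINT x|lborel. d x * indicator {a<..<b} x) = C * (LINT x|lborel. indicator {a<..<b} x)"
      using LIMSEQ_unique[OF l1] tendsto_mult_left[OF l2, of C] by simp
    also have "\<dots> = C * (b - a)" using \<open>a \<le> b\<close> by simp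
    finally have eq: "(LINT x|lborel. d x * indicator {a<..<b} x) = C * (b - a)" .
    have "(LINT x:{a..b}|lborel. d x) = (LINT x|lborel. d x * indicator {a<..<b} x)"
      unfolding set_lebesgue_integral_def
    proof (rule integral_cong_AE)
      have "AE x in lborel. x \<noteq> a \<and> x \<noteq> b" using AE_lborel_singleton[of a] AE_lborel_singleton[of b] by auto
      then show "AE x in lborel. indicat_real {a..b} x *\<^sub>R d x = d x * indicat_real {a<..<b} x"
        by eventually_elim (auto simp: indicator_def)
    qed auto
    moreover have "(LINT x:{a..b}|lborel. C) = C * (b - a)"
      using \<open>a \<le> b\<close> by (simp add: set_lebesgue_integral_def)
    ultimately show "0 - 0 = (LINT x:{a..b}|lborel. d x - C)"
      unfolding set_integral_diff(2)[OF int ci] using eq by simp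
  qed
  then have "AE x in lborel. d x - C = 0" by (rule primitive_const_imp_zero)
  then show ?thesis by (intro that[of C]) auto
qed

text \<open>
  The indefinite integral \<open>V\<close> of \<open>u'\<close> has the same weak derivative as \<open>u\<close>, so \<open>u - V\<close> is constant
  by the lemma of du Bois-Reymond. This gives access to pointwise calculus.
\<close>

lemma weak_deriv_primitive:
  assumes "has_weak_deriv u u'"
  obtains U where "primitive U u'" "AE x in lborel. u x = U x"
proof -
  have iu: "set_integrable lborel {a..b} u" and iu': "set_integrable lborel {a..b} u'" for a b
    using assms by (auto simp: has_weak_deriv_def)
  obtain V where V: "primitive V u'" using primitive_exists[OF iu'] .
  note wV = primitive_weak_deriv[OF V]
  have iV: "set_integrable lborel {a..b} V" for a b
    using wV by (auto simp: has_weak_deriv_def)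
  note iuV = set_integral_diff(1)[OF iu iV]
  obtain C where C: "AE x in lborel. u x - V x = C"
  proof (rule du_Bois_Reymond[of "\<lambda>x. u x - V x"])
    show "set_integrable lborel {a..b} (\<lambda>x. u x - V x)" for a b by (rule iuV)
    fix \<phi> \<phi>' :: "real \<Rightarrow> real"
    assume *: "\<And>x. (\<phi> has_real_derivative \<phi>' x) (at x)" "continuous_on UNIV \<phi>'" "bounded {x. \<phi> x \<noteq> 0}"
    obtain R where R: "\<forall>x\<in>{x. \<phi> x \<noteq> 0}. norm x \<le> R" using *(3) unfolding bounded_iff by blast
    have \<phi>0: "\<phi> x = 0" if "\<bar>x\<bar> > R" for x using R that by force
    have \<phi>'0: "\<phi>' x = 0" if "\<bar>x\<bar> > R" for x
      using derivative_zero_outside_support[of \<phi> "\<phi>' x" x R] * \<phi>0 that by blast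
    have i: "integrable lborel (\<lambda>x. k x * \<phi>' x)" if "\<And>a b. set_integrable lborel {a..b} k" for k :: "real \<Rightarrow> real"
      by (rule integrable_mult_compact_support[OF that *(2) \<phi>'0])
    have "(LINT x|lborel. (u x - V x) * \<phi>' x) = (LINT x|lborel. u x * \<phi>' x) - (LINT x|lborel. V x * \<phi>' x)"
      unfolding left_diff_distrib by (intro Bochner_Integration.integral_diff i iu iV)
    moreover have "(LINT x|lborel. u x * \<phi>' x) = - (LINT x|lborel. u' x * \<phi> x)"
      using assms * unfolding has_weak_deriv_def by blast
    moreover have "(LINT x|lborel. V x * \<phi>' x) = - (LINT x|lborel. u' x * \<phi> x)"
      using wV * unfolding has_weak_deriv_def by blast
    ultimately show "(LINT x|lborel. (u x - V x) * \<phi>' x) = 0" by simp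
  qed
  show ?thesis
  proof (rule that)
    show "primitive (\<lambda>x. C + V x) u'" by (rule primitive_add_const[OF V])
    show "AE x in lborel. u x = C + V x" using C by eventually_elim simp
  qed
qed

text \<open>
  The set where the inequality fails is open, and a nonempty open set is not null.
\<close>

lemma continuous_AE_le_imp_le:
  fixes u v :: "real \<Rightarrow> real"
  assumes "continuous_on UNIV u" "continuous_on UNIV v" "AE x in lborel. u x \<le> v x"
  shows "u x \<le> v x"
proof (rule ccontr)
  assume "\<not> u x \<le> v x"
  have "open {y. v y < u y}" using assms by (intro open_Collect_less) auto
  moreover have "x \<in> {y. v y < u y}" using \<open>\<not> u x \<le> v x\<close> by simp
  ultimately obtain e where e: "e > 0" "ball x e \<subseteq> {y. v y < u y}" by (meson openE)
  have "AE y in lborel. y \<notin> ball x e" using assms(3) by eventually_elim (use e in force)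
  then have "ball x e \<in> null_sets lborel" by (simp add: AE_iff_null_sets)
  then show False using e by (simp add: null_sets_def ball_eq_greaterThanLessThan)
qed

lemma weak_deriv_unique:
  assumes "has_weak_deriv u v" "has_weak_deriv u v'"
  shows "AE x in lborel. v x = v' x"
proof -
  obtain V where V: "primitive V v" "AE x in lborel. u x = V x" using weak_deriv_primitive[OF assms(1)] .
  obtain V' where V': "primitive V' v'" "AE x in lborel. u x = V' x" using weak_deriv_primitive[OF assms(2)] .
  have "AE x in lborel. V x \<le> V' x" "AE x in lborel. V' x \<le> V x"
    using V(2) V'(2) by (eventually_elim, simp)+
  then have "V x = V' x" for x
    using continuous_AE_le_imp_le[of V V'] continuous_AE_le_imp_le[of V' V] V V' primitive_continuous
    by (meson order_antisym)
  then have "V = V'" by auto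
  then show ?thesis using primitive_unique V V' by blast
qed

lemma wderiv_AE:
  assumes "has_weak_deriv u v"
  shows "AE x in lborel. wderiv u x = v x"
  using weak_deriv_unique[OF _ assms] someI[of "has_weak_deriv u", OF assms]
  unfolding wderiv_def by blast

section \<open>Linear differential inequalities\<close>

lemma primitive_mono:
  assumes "primitive U u" "AE x in lborel. u x \<ge> 0" "a \<le> b"
  shows "U a \<le> U b"
proof -
  have "0 \<le> (LINT x:{a..b}|lborel. u x)"
    unfolding set_lebesgue_integral_def
    by (rule integral_nonneg_AE) (use assms(2) in \<open>auto simp: indicator_def\<close>)
  then show ?thesis using primitiveD(2)[OF assms(1,3)] by simp
qed

lemma primitive_antimono:
  assumes "primitive U u" "AE x in lborel. u x \<le> 0" "a \<le> b"
  shows "U b \<le> U a"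
proof -
  have "primitive (\<lambda>x. - U x) (\<lambda>x. - u x)"
    using primitive_linear[OF assms(1,1), of "-1" 0] by simp
  from primitive_mono[OF this _ assms(3)] show ?thesis using assms(2) by simp
qed

lemma primitive_exp_mult:
  assumes "primitive U u"
  shows "primitive (\<lambda>x. exp (K * x) * U x) (\<lambda>x. exp (K * x) * (K * U x + u x))"
proof -
  have "primitive (\<lambda>x. exp (K * x)) (\<lambda>x. K * exp (K * x))"
    by (rule primitive_C1) (auto intro!: derivative_eq_intros continuous_intros)
  from primitive_mult[OF this assms] show ?thesis by (simp add: algebra_simps)
qed

text \<open>
  Gronwall's inequality in both directions of time: \<open>exp (K x) * U x\<close> increases and
  \<open>exp (- K x) * U x\<close> decreases, so a zero of a nonnegative \<open>U\<close> spreads to the whole line.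
\<close>

lemma primitive_zero_propagates:
  assumes U: "primitive U u" and nonneg: "\<And>x. U x \<ge> 0"
    and bound: "AE x in lborel. \<bar>u x\<bar> \<le> K * U x" and zero: "U x0 = 0"
  shows "U x = 0"
proof -
  have "exp (K * x) * U x \<le> exp (K * x0) * U x0" if "x \<le> x0"
    by (rule primitive_mono[OF primitive_exp_mult[OF U] _ that])
      (use bound in \<open>eventually_elim, auto simp: zero_le_mult_iff\<close>)
  moreover have "exp (-K * x) * U x \<le> exp (-K * x0) * U x0" if "x0 \<le> x"
    by (rule primitive_antimono[OF primitive_exp_mult[OF U] _ that])
      (use bound in \<open>eventually_elim, auto simp: mult_le_0_iff\<close>)
  ultimately have "U x \<le> 0" using zero by (cases "x \<le> x0") (auto simp: mult_le_0_iff)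
  then show ?thesis using nonneg[of x] by simp
qed

text \<open>
  Let \<open>E\<close> be the indefinite integral of the expected derivative \<open>- u / U\<^sup>2\<close>, normalised to agree with
  \<open>1 / U\<close> at the origin. Then \<open>y = E * U - 1\<close> solves the linear equation \<open>y' = (u / U) * y\<close> with
  \<open>y 0 = 0\<close>, so \<open>y\<^sup>2\<close> vanishes identically. The bound on \<open>u\<close> makes Gronwall's inequality applicable.
\<close>

lemma primitive_inverse:
  assumes U: "primitive U u" and pos: "\<And>x. U x > 0" and bound: "AE x in lborel. \<bar>u x\<bar> \<le> K * U x"
  shows "primitive (\<lambda>x. 1 / U x) (\<lambda>x. - u x / (U x)\<^sup>2)"
proof -
  define e where "e x = - u x / (U x)\<^sup>2" for x
  have "continuous_on UNIV (\<lambda>x. - 1 / (U x)\<^sup>2)"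
    using pos by (intro continuous_intros primitive_continuous[OF U]) (simp add: less_imp_neq[THEN not_sym])
  from set_integrable_mult_continuous[OF primitiveD(1)[OF U] this]
  have "set_integrable lborel {a..b} e" for a b by (simp add: e_def[abs_def])
  then obtain E0 where E0: "primitive E0 e" using primitive_exists by blast
  define E where "E x = (1 / U 0 - E0 0) + E0 x" for x
  have E: "primitive E e" unfolding E_def by (rule primitive_add_const[OF E0])
  define y where "y x = - 1 + E x * U x" for x
  define y' where "y' x = e x * U x + E x * u x" for x
  have y: "primitive y y'"
    unfolding y_def y'_def by (intro primitive_add_const primitive_mult E U)
  have y'eq: "y' x = (u x / U x) * y x" for x
    using pos[of x] by (simp add: y'_def y_def e_def field_simps power2_eq_square)
  have "y x * y x = 0" for x
  proof (rule primitive_zero_propagates[OF primitive_mult[OF y y]])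
    show "AE x in lborel. \<bar>y' x * y x + y x * y' x\<bar> \<le> 2 * K * (y x * y x)"
      using bound
    proof eventually_elim
      case (elim x)
      have "\<bar>u x / U x\<bar> \<le> K" using elim pos[of x] by (simp add: abs_divide pos_divide_le_eq)
      then have "\<bar>u x / U x\<bar> * (y x * y x) \<le> K * (y x * y x)" by (rule mult_right_mono) simp
      moreover have "y' x * y x + y x * y' x = 2 * ((u x / U x) * (y x * y x))" by (simp add: y'eq)
      ultimately show ?case by (simp add: abs_mult)
    qed
    show "y 0 * y 0 = 0" using pos[of 0] by (simp add: y_def E_def)
  qed simp
  then have "E x * U x = 1" for x by (simp add: y_def)
  then have "E x = 1 / U x" for x using pos[of x] by (simp add: field_simps)
  then have "E = (\<lambda>x. 1 / U x)" by auto
  then show ?thesis using E by (simp add: e_def[abs_def])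
qed

text \<open>
  Sobolev embedding: the increments of \<open>U\<^sup>2\<close> are integrals of \<open>2 * U * u'\<close>, hence at
  most the squared norm of \<open>u\<close> in \<open>H\<^sup>1\<close>.
\<close>

lemma H1_bounded:
  assumes wd: "has_weak_deriv u u'" and u2: "integrable lborel (\<lambda>x. (u x)\<^sup>2)" and u'2: "integrable lborel (\<lambda>x. (u' x)\<^sup>2)"
  obtains B where "AE x in lborel. \<bar>u x\<bar> \<le> B"
proof -
  obtain U where U: "primitive U u'" "AE x in lborel. u x = U x" using weak_deriv_primitive[OF wd] .
  note [measurable] = primitive_borel[OF U(1)] primitive_measurable[OF U(1)]
  have [measurable]: "u \<in> borel_measurable borel"
    using wd by (auto simp: has_weak_deriv_def intro: locally_integrable_measurable)
  have U2: "integrable lborel (\<lambda>x. (U x)\<^sup>2)"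
    using u2 U(2) by (subst integrable_cong_AE[where g="\<lambda>x. (u x)\<^sup>2"]) (auto elim: eventually_mono)
  let ?s = "\<lambda>x. (u' x)\<^sup>2 + (U x)\<^sup>2"
  have s: "integrable lborel ?s" using u'2 U2 by auto
  define K where "K = (LINT x|lborel. ?s x)"
  note P = primitive_mult[OF U(1) U(1)]
  have inc: "\<bar>U b * U b - U a * U a\<bar> \<le> K" if "a \<le> b" for a b
  proof -
    have "\<bar>U b * U b - U a * U a\<bar> = \<bar>LINT x:{a..b}|lborel. u' x * U x + U x * u' x\<bar>"
      using primitiveD(2)[OF P that] by simp
    also have "\<dots> \<le> (LINT x|lborel. \<bar>indicator {a..b} x *\<^sub>R (u' x * U x + U x * u' x)\<bar>)"
      unfolding set_lebesgue_integral_def by (rule integral_abs_bound)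
    also have "\<dots> \<le> K"
      unfolding K_def
    proof (rule integral_mono)
      show "integrable lborel (\<lambda>x. \<bar>indicator {a..b} x *\<^sub>R (u' x * U x + U x * u' x)\<bar>)"
        using primitiveD(1)[OF P, of a b] unfolding set_integrable_def by (rule integrable_abs)
      fix x
      have "2 * \<bar>u' x * U x\<bar> \<le> ?s x"
        using sum_squares_bound[of "\<bar>u' x\<bar>" "\<bar>U x\<bar>"] by (simp add: abs_mult)
      then show "\<bar>indicator {a..b} x *\<^sub>R (u' x * U x + U x * u' x)\<bar> \<le> ?s x"
        by (auto simp: indicator_def mult.commute)
    qed (rule s)
    finally show ?thesis .
  qed
  have "\<bar>U x\<bar> \<le> sqrt (U 0 * U 0 + K)" for x
  proof (rule real_le_rsqrt)
    have "U x * U x \<le> U 0 * U 0 + K"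
      using inc[of 0 x] inc[of x 0] by (cases "0 \<le> x") (auto simp: abs_le_iff)
    then show "\<bar>U x\<bar>\<^sup>2 \<le> U 0 * U 0 + K" by (simp add: power2_eq_square)
  qed
  then have "AE x in lborel. \<bar>u x\<bar> \<le> sqrt (U 0 * U 0 + K)"
    by (intro eventually_mono[OF U(2)]) metis
  then show ?thesis by (rule that)
qed

section \<open>Square integrable functions and convolutions\<close>

lemma abs_mult_le_sum_squares: "\<bar>a * b\<bar> \<le> a\<^sup>2 + b\<^sup>2" for a b :: real
proof -
  have "2 * \<bar>a * b\<bar> \<le> a\<^sup>2 + b\<^sup>2"
    using sum_squares_bound[of "\<bar>a\<bar>" "\<bar>b\<bar>"] by (simp add: abs_mult)
  then show ?thesis using abs_ge_zero[of "a * b"] by linarith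
qed

lemma abs_power2_le: "\<bar>a\<bar> \<le> b \<Longrightarrow> \<bar>a\<^sup>2\<bar> \<le> b\<^sup>2" for a b :: real
  by (simp add: power2_le_iff_abs_le order_trans[OF abs_ge_zero])

text \<open>
  The weight \<open>\<omega>\<close> is kept separate from the two factors, because below it is a transition density
  for which the factors are the score and the fluctuation of a function.
\<close>

lemma weighted_Cauchy_Schwarz:
  fixes \<omega> \<alpha> \<beta> :: "'a \<Rightarrow> real"
  assumes [measurable]: "\<omega> \<in> borel_measurable N" "\<alpha> \<in> borel_measurable N" "\<beta> \<in> borel_measurable N"
    and \<omega>: "\<And>x. \<omega> x \<ge> 0"
    and i: "integrable N (\<lambda>x. \<omega> x * (\<alpha> x)\<^sup>2)" "integrable N (\<lambda>x. \<omega> x * (\<beta> x)\<^sup>2)"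
  shows "integrable N (\<lambda>x. \<omega> x * \<alpha> x * \<beta> x)"
    and "(LINT x|N. \<omega> x * \<alpha> x * \<beta> x)\<^sup>2 \<le> (LINT x|N. \<omega> x * (\<alpha> x)\<^sup>2) * (LINT x|N. \<omega> x * (\<beta> x)\<^sup>2)"
proof -
  show ic: "integrable N (\<lambda>x. \<omega> x * \<alpha> x * \<beta> x)"
  proof (rule Bochner_Integration.integrable_bound[OF Bochner_Integration.integrable_add[OF i]])
    show "AE x in N. norm (\<omega> x * \<alpha> x * \<beta> x) \<le> norm (\<omega> x * (\<alpha> x)\<^sup>2 + \<omega> x * (\<beta> x)\<^sup>2)"
    proof (intro AE_I2)
      fix x
      have "\<bar>\<alpha> x * \<beta> x\<bar> \<le> (\<alpha> x)\<^sup>2 + (\<beta> x)\<^sup>2"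
        by (rule abs_mult_le_sum_squares)
      then have "\<omega> x * \<bar>\<alpha> x * \<beta> x\<bar> \<le> \<omega> x * ((\<alpha> x)\<^sup>2 + (\<beta> x)\<^sup>2)" using \<omega> by (rule mult_left_mono)
      then show "norm (\<omega> x * \<alpha> x * \<beta> x) \<le> norm (\<omega> x * (\<alpha> x)\<^sup>2 + \<omega> x * (\<beta> x)\<^sup>2)"
        using \<omega>[of x] by (simp add: abs_mult algebra_simps)
    qed
  qed measurable
  let ?A = "LINT x|N. \<omega> x * (\<alpha> x)\<^sup>2" and ?B = "LINT x|N. \<omega> x * (\<beta> x)\<^sup>2" and ?C = "LINT x|N. \<omega> x * \<alpha> x * \<beta> x"
  have q: "0 \<le> s\<^sup>2 * ?A - 2 * (s * t) * ?C + t\<^sup>2 * ?B" for s t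
  proof -
    have "0 \<le> (LINT x|N. \<omega> x * (s * \<alpha> x - t * \<beta> x)\<^sup>2)" by (simp add: \<omega>)
    also have "\<dots> = (LINT x|N. s\<^sup>2 * (\<omega> x * (\<alpha> x)\<^sup>2) - 2 * (s * t) * (\<omega> x * \<alpha> x * \<beta> x) + t\<^sup>2 * (\<omega> x * (\<beta> x)\<^sup>2))"
      by (intro Bochner_Integration.integral_cong) (auto simp: algebra_simps power2_eq_square)
    finally show ?thesis using i ic by simp
  qed
  show "?C\<^sup>2 \<le> ?A * ?B"
  proof (cases "?B = 0")
    case True
    have "?C = 0"
    proof (rule ccontr)
      assume "?C \<noteq> 0"
      have "2 * t * ?C \<le> ?A" for t using q[of 1 t] True by simp
      from this[of "(?A + 1) / (2 * ?C)"] show False using \<open>?C \<noteq> 0\<close> by simp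
    qed
    then show ?thesis using True by simp
  next
    case False
    then have "?B > 0" using \<omega> by (simp add: less_le)
    \<comment> \<open>the minimising choice \<open>s = B\<close>, \<open>t = C\<close> in the nonnegative quadratic form\<close>
    have "?B\<^sup>2 * ?A - 2 * (?B * ?C) * ?C + ?C\<^sup>2 * ?B = ?B * (?A * ?B - ?C\<^sup>2)"
      by (simp add: power2_eq_square algebra_simps)
    then have "0 \<le> ?B * (?A * ?B - ?C\<^sup>2)" using q[of ?B ?C] by simp
    then show ?thesis using \<open>?B > 0\<close> by (simp add: zero_le_mult_iff)
  qed
qed

lemma not_AE_False:
  assumes "AE x::real in lborel. False"
  shows False
proof -
  have "UNIV \<in> null_sets (lborel :: real measure)"
    using assms by (subst AE_iff_null_sets) auto
  then show ?thesis by (simp add: null_sets_def)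
qed

lemma integrable_reflect:
  fixes w :: "real \<Rightarrow> real"
  assumes "integrable lborel w"
  shows "integrable lborel (\<lambda>y. w (x - y))"
  using lborel_integrable_real_affine[OF assms, of "-1" x] by simp

lemma integral_reflect:
  fixes w :: "real \<Rightarrow> real"
  shows "(LINT y|lborel. w (x - y)) = (LINT y|lborel. w y)"
  using lborel_integral_real_affine[of "-1" w x] by simp

lemma AE_reflect:
  assumes "AE z in lborel. Q (z::real)"
  shows "AE y in lborel. Q (x - y)"
proof -
  obtain N where N: "{z. \<not> Q z} \<subseteq> N" "emeasure lborel N = 0" "N \<in> sets lborel"
    using assms by (auto elim!: AE_E)
  have [measurable]: "N \<in> sets borel" using N by simp
  have "(\<integral>\<^sup>+z. indicator N z \<partial>lborel) = ennreal \<bar>-1\<bar> * (\<integral>\<^sup>+y. indicator N (x + (-1) * y) \<partial>lborel)"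
    by (rule nn_integral_real_affine) auto
  then have "(\<integral>\<^sup>+y. indicator N (x - y) \<partial>lborel) = 0" using N by simp
  then have "AE y in lborel. indicator N (x - y) = (0::ennreal)"
    by (subst (asm) nn_integral_0_iff_AE) auto
  then show ?thesis by eventually_elim (use N in \<open>auto simp: indicator_def split: if_splits\<close>)
qed

lemma integrable_convolution_fst:
  fixes w \<alpha> :: "real \<Rightarrow> real"
  assumes "integrable lborel w" "integrable lborel \<alpha>"
  shows "integrable (lborel \<Otimes>\<^sub>M lborel) (\<lambda>(x, y). w (x - y) * \<alpha> x)"
proof (rule lborel_pair.Fubini_integrable)
  have [measurable]: "w \<in> borel_measurable borel" "\<alpha> \<in> borel_measurable borel" using assms by auto
  show "(\<lambda>(x, y). w (x - y) * \<alpha> x) \<in> borel_measurable (lborel \<Otimes>\<^sub>M lborel)" by measurable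
  show "AE x in lborel. integrable lborel (\<lambda>y. case (x, y) of (x, y) \<Rightarrow> w (x - y) * \<alpha> x)"
    by (auto intro!: integrable_mult_left integrable_reflect assms)
  have "(LINT y|lborel. norm (w (x - y) * \<alpha> x)) = (LINT y|lborel. \<bar>w y\<bar>) * \<bar>\<alpha> x\<bar>" for x
    using integral_reflect[of "\<lambda>z. \<bar>w z\<bar>" x] by (simp add: abs_mult)
  then show "integrable lborel (\<lambda>x. LINT y|lborel. norm (case (x, y) of (x, y) \<Rightarrow> w (x - y) * \<alpha> x))"
    using assms by auto
qed

lemma integrable_convolution_snd:
  fixes w \<alpha> :: "real \<Rightarrow> real"
  assumes "integrable lborel w" "integrable lborel \<alpha>"
  shows "integrable (lborel \<Otimes>\<^sub>M lborel) (\<lambda>(x, y). w (x - y) * \<alpha> y)"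
proof -
  have "integrable lborel (\<lambda>z. w (- z))" using integrable_reflect[OF assms(1), of 0] by simp
  from lborel_pair.integrable_product_swap[OF integrable_convolution_fst[OF this assms(2)]]
  show ?thesis by (simp add: case_prod_unfold)
qed

text \<open>
  Young's inequality for the bilinear form of a convolution with an integrable kernel, obtained from
  \<open>\<bar>\<alpha> x * \<beta> y\<bar> \<le> (\<alpha> x)\<^sup>2 + (\<beta> y)\<^sup>2\<close>. Integrability on the plane is the form in which it is used: it
  yields both Fubini's theorem and a dominating function for limits.
\<close>

lemma integrable_convolution_form:
  fixes w \<alpha> \<beta> :: "real \<Rightarrow> real"
  assumes w: "integrable lborel w" 
    and [measurable]: "\<alpha> \<in> borel_measurable borel" "\<beta> \<in> borel_measurable borel"
    and i: "integrable lborel (\<lambda>x. (\<alpha> x)\<^sup>2)" "integrable lborel (\<lambda>x. (\<beta> x)\<^sup>2)"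
  shows "integrable (lborel \<Otimes>\<^sub>M lborel) (\<lambda>(x, y). \<alpha> x * (w (x - y) * \<beta> y))"
proof (rule Bochner_Integration.integrable_bound)
  have [measurable]: "w \<in> borel_measurable borel" using w by auto
  have aw: "integrable lborel (\<lambda>x. \<bar>w x\<bar>)" using w by auto
  show "integrable (lborel \<Otimes>\<^sub>M lborel) (\<lambda>p. (case p of (x, y) \<Rightarrow> \<bar>w (x - y)\<bar> * (\<alpha> x)\<^sup>2) + (case p of (x, y) \<Rightarrow> \<bar>w (x - y)\<bar> * (\<beta> y)\<^sup>2))"
    by (intro Bochner_Integration.integrable_add integrable_convolution_fst[OF aw] integrable_convolution_snd[OF aw] i)
  show "(\<lambda>(x, y). \<alpha> x * (w (x - y) * \<beta> y)) \<in> borel_measurable (lborel \<Otimes>\<^sub>M lborel)" by measurable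
  have "\<bar>w (x - y)\<bar> * \<bar>\<alpha> x * \<beta> y\<bar> \<le> \<bar>w (x - y)\<bar> * ((\<alpha> x)\<^sup>2 + (\<beta> y)\<^sup>2)" for x y
    by (intro mult_left_mono abs_mult_le_sum_squares) simp
  then show "AE p in lborel \<Otimes>\<^sub>M lborel. norm (case p of (x, y) \<Rightarrow> \<alpha> x * (w (x - y) * \<beta> y)) \<le>
     norm ((case p of (x, y) \<Rightarrow> \<bar>w (x - y)\<bar> * (\<alpha> x)\<^sup>2) + (case p of (x, y) \<Rightarrow> \<bar>w (x - y)\<bar> * (\<beta> y)\<^sup>2))"
    by (intro AE_I2) (auto simp: abs_mult algebra_simps)
qed

lemma conv_measurable [measurable]:
  assumes [measurable]: "w \<in> borel_measurable borel" "v \<in> borel_measurable borel"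
  shows "conv w v \<in> borel_measurable borel"
proof -
  have "(\<lambda>x. LINT y|lborel. w (x - y) * v y) \<in> borel_measurable borel"
    by measurable
  then show ?thesis by (simp add: conv_def[abs_def])
qed

lemma integrable_mult_conv:
  assumes "integrable lborel w" "\<alpha> \<in> borel_measurable borel" "\<beta> \<in> borel_measurable borel"
    "integrable lborel (\<lambda>x. (\<alpha> x)\<^sup>2)" "integrable lborel (\<lambda>x. (\<beta> x)\<^sup>2)"
  shows "integrable lborel (\<lambda>x. \<alpha> x * conv w \<beta> x)"
    and "(LINT x|lborel. \<alpha> x * conv w \<beta> x) = (LINT p|(lborel \<Otimes>\<^sub>M lborel). \<alpha> (fst p) * (w (fst p - snd p) * \<beta> (snd p)))"
  using lborel_pair.integrable_fst[OF integrable_convolution_form[OF assms]]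
    lborel_pair.integral_fst[OF integrable_convolution_form[OF assms]]
  by (simp_all add: conv_def case_prod_unfold)

lemma integrable_mult_bounded:
  fixes u b :: "'a \<Rightarrow> real"
  assumes "integrable N u" "b \<in> borel_measurable N" "AE x in N. \<bar>b x\<bar> \<le> B"
  shows "integrable N (\<lambda>x. b x * u x)" "integrable N (\<lambda>x. u x * b x)"
proof -
  have "integrable N (\<lambda>x. B * u x)" using assms(1) by simp
  then show "integrable N (\<lambda>x. b x * u x)"
  proof (rule Bochner_Integration.integrable_bound)
    show "AE x in N. norm (b x * u x) \<le> norm (B * u x)"
      using assms(3) by eventually_elim (force simp: abs_mult intro!: mult_right_mono)
  qed (use assms in auto)
  then show "integrable N (\<lambda>x. u x * b x)" by (simp add: mult.commute)
qed

section \<open>The spectral gap of a reversible convolution kernel\<close>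

text \<open>
  The Markov kernel \<open>w (x - y) * \<phi> y / conv w \<phi> x\<close> smooths a function \<open>h\<close> into \<open>P h\<close> below; its
  reversible measure has the density \<open>\<phi> * conv w \<phi>\<close>. \<open>Fisher\<close> bounds the Fisher information of the
  transition densities with respect to their starting point \<open>x\<close>. Reversibility is stated only in
  the form of invariance of that measure, tested against bounded functions.
\<close>

locale reversible_convolution =
  fixes w wx \<phi> :: "real \<Rightarrow> real" and B M :: real
  assumes w_nonneg: "w x \<ge> 0" and w_int: "integrable lborel w" and w_one: "(LINT x|lborel. w x) = 1"
    and wx_deriv: "AE x in lborel. (w has_real_derivative wx x) (at x)" and wx_int: "integrable lborel wx"
    and \<phi>_meas: "\<phi> \<in> borel_measurable borel" and \<phi>_pos: "\<phi> x > 0"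
    and \<phi>_bdd: "AE x in lborel. \<phi> x \<le> B" and \<phi>_sq: "integrable lborel (\<lambda>x. (\<phi> x)\<^sup>2)"
    and weak_deriv: "h \<in> borel_measurable borel \<Longrightarrow> (\<And>x. \<bar>h x\<bar> \<le> b) \<Longrightarrow>
        has_weak_deriv (conv w (\<lambda>x. \<phi> x * h x)) (conv wx (\<lambda>x. \<phi> x * h x))"
    and M_nonneg: "M \<ge> 0"
    and Fisher: "(\<integral>\<^sup>+y\<in>{y. w (x - y) > 0}. ennreal ((wx (x - y) / w (x - y))\<^sup>2
        * (w (x - y) * \<phi> y / conv w \<phi> x)) \<partial>lborel) \<le> ennreal M"
    and reversible: "h \<in> borel_measurable borel \<Longrightarrow> (\<And>x. \<bar>h x\<bar> \<le> b) \<Longrightarrow>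
        (LINT x|lborel. \<phi> x * conv w (\<lambda>x. \<phi> x * h x) x) = (LINT x|lborel. \<phi> x * h x * conv w \<phi> x)"
begin

definition "g = conv w \<phi>"
definition "g' = conv wx \<phi>"
definition "P h x = conv w (\<lambda>y. \<phi> y * h y) x / g x"
text \<open>The derivative of \<open>P h\<close> according to the quotient rule.\<close>
definition "D h x = conv wx (\<lambda>y. \<phi> y * h y) x / g x - conv w (\<lambda>y. \<phi> y * h y) x * g' x / (g x)\<^sup>2"

lemma meas [measurable]:
  "w \<in> borel_measurable borel" "wx \<in> borel_measurable borel" "\<phi> \<in> borel_measurable borel"
  "g \<in> borel_measurable borel" "g' \<in> borel_measurable borel"
  using w_int wx_int \<phi>_meas by (auto simp: g_def g'_def)

lemma P_meas [measurable]: "h \<in> borel_measurable borel \<Longrightarrow> P h \<in> borel_measurable borel"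
  unfolding P_def[abs_def]
  by (intro borel_measurable_divide conv_measurable borel_measurable_times meas)

lemma D_meas [measurable]: "h \<in> borel_measurable borel \<Longrightarrow> D h \<in> borel_measurable borel"
  unfolding D_def[abs_def]
  by (intro borel_measurable_diff borel_measurable_divide borel_measurable_power conv_measurable borel_measurable_times meas)

lemma kernel_integrable:
  assumes [measurable]: "h \<in> borel_measurable borel" and h: "\<And>x. \<bar>h x\<bar> \<le> b" and u: "integrable lborel u"
  shows "integrable lborel (\<lambda>y. u (x - y) * (\<phi> y * h y))"
proof (rule integrable_mult_bounded(2)[OF integrable_reflect[OF u]])
  show "AE y in lborel. \<bar>\<phi> y * h y\<bar> \<le> B * b"
    using \<phi>_bdd
  proof eventually_elim
    case (elim y)
    then show ?case using h[of y] \<phi>_pos[of y] by (auto simp: abs_mult intro!: mult_mono)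
  qed
qed measurable

lemma kernel_integrable_1: "integrable lborel u \<Longrightarrow> integrable lborel (\<lambda>y. u (x - y) * \<phi> y)"
  using kernel_integrable[of "\<lambda>_. 1" 1 u x] by simp

lemma g_pos: "g x > 0"
proof -
  have nn: "0 \<le> w (x - y) * \<phi> y" for y using w_nonneg \<phi>_pos[of y] by (simp add: less_imp_le)
  have "g x \<noteq> 0"
  proof
    assume "g x = 0"
    then have "AE y in lborel. w (x - y) * \<phi> y = 0"
      using integral_nonneg_eq_0_iff_AE[OF kernel_integrable_1[OF w_int]] nn by (simp add: g_def conv_def)
    then have "AE y in lborel. w (x - y) = 0"
    proof eventually_elim
      case (elim y)
      then show ?case using \<phi>_pos[of y] by simp
    qed
    then have "(LINT y|lborel. w (x - y)) = (LINT y::real|lborel. (0::real))" by (intro integral_cong_AE) auto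
    then show False using w_one by (simp add: integral_reflect)
  qed
  moreover have "g x \<ge> 0" using nn by (simp add: g_def conv_def)
  ultimately show ?thesis by simp
qed

lemma g_le: "g x \<le> B"
proof -
  have "g x \<le> (LINT y|lborel. w (x - y) * B)"
    unfolding g_def conv_def
  proof (rule integral_mono_AE)
    show "AE y in lborel. w (x - y) * \<phi> y \<le> w (x - y) * B"
      using \<phi>_bdd by eventually_elim (use w_nonneg in \<open>auto intro!: mult_left_mono\<close>)
  qed (auto intro!: kernel_integrable_1 w_int integrable_reflect)
  then show ?thesis using w_one by (simp add: integral_reflect)
qed

lemma conv_bound:
  assumes "h \<in> borel_measurable borel" and h: "\<And>x. \<bar>h x\<bar> \<le> b"
  shows "\<bar>conv w (\<lambda>y. \<phi> y * h y) x\<bar> \<le> b * g x"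
proof -
  have "\<bar>conv w (\<lambda>y. \<phi> y * h y) x\<bar> \<le> (LINT y|lborel. \<bar>w (x - y) * (\<phi> y * h y)\<bar>)"
    unfolding conv_def by (rule integral_abs_bound)
  also have "\<dots> \<le> (LINT y|lborel. b * (w (x - y) * \<phi> y))"
  proof (rule integral_mono)
    fix y
    have "\<bar>h y\<bar> * (w (x - y) * \<phi> y) \<le> b * (w (x - y) * \<phi> y)"
      using h w_nonneg \<phi>_pos[of y] by (intro mult_right_mono) auto
    then show "\<bar>w (x - y) * (\<phi> y * h y)\<bar> \<le> b * (w (x - y) * \<phi> y)"
      using w_nonneg \<phi>_pos[of y] by (simp add: abs_mult ac_simps)
  qed (auto intro!: integrable_abs kernel_integrable[OF assms] kernel_integrable_1 w_int)
  finally show ?thesis by (simp add: g_def conv_def)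
qed

lemma P_bound:
  assumes "h \<in> borel_measurable borel" and "\<And>x. \<bar>h x\<bar> \<le> b"
  shows "\<bar>P h x\<bar> \<le> b"
  using conv_bound[OF assms, of x] g_pos[of x] by (simp add: P_def abs_divide pos_divide_le_eq)

text \<open>
  Where \<open>w\<close> vanishes it has a minimum, so its derivative vanishes there too. Hence the score
  \<open>wx / w\<close> captures all of \<open>wx\<close>, although it is only meaningful on the support of \<open>w\<close>.
\<close>

lemma wx_zero: "AE z in lborel. w z = 0 \<longrightarrow> wx z = 0"
  using wx_deriv
proof eventually_elim
  case (elim z)
  show ?case
  proof
    assume "w z = 0"
    then show "wx z = 0"
      using DERIV_local_min[OF elim, of 1] w_nonneg by auto
  qed
qed

lemma Fisher_integral:
  shows "integrable lborel (\<lambda>y. (w (x - y) * \<phi> y) * (wx (x - y) / w (x - y))\<^sup>2)"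
    and "(LINT y|lborel. (w (x - y) * \<phi> y) * (wx (x - y) / w (x - y))\<^sup>2) \<le> M * g x"
proof -
  let ?f = "\<lambda>y. (w (x - y) * \<phi> y) * (wx (x - y) / w (x - y))\<^sup>2"
  have nn: "?f y \<ge> 0" for y using w_nonneg \<phi>_pos[of y] by (simp add: less_imp_le)
  have "(\<integral>\<^sup>+y. ennreal (?f y) \<partial>lborel) = (\<integral>\<^sup>+y. ennreal (g x) * (ennreal ((wx (x - y) / w (x - y))\<^sup>2
        * (w (x - y) * \<phi> y / conv w \<phi> x)) * indicator {y. w (x - y) > 0} y) \<partial>lborel)"
  proof (rule nn_integral_cong)
    fix y
    show "ennreal (?f y) = ennreal (g x) * (ennreal ((wx (x - y) / w (x - y))\<^sup>2
        * (w (x - y) * \<phi> y / conv w \<phi> x)) * indicator {y. w (x - y) > 0} y)"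
    proof (cases "w (x - y) > 0")
      case True
      then show ?thesis
        using g_pos[of x] by (simp add: g_def[symmetric] ennreal_mult'[symmetric] ac_simps)
    next
      case False
      then have "w (x - y) = 0" using w_nonneg[of "x - y"] by simp
      then show ?thesis by simp
    qed
  qed
  also have "\<dots> = ennreal (g x) * (\<integral>\<^sup>+y\<in>{y. w (x - y) > 0}. ennreal ((wx (x - y) / w (x - y))\<^sup>2
        * (w (x - y) * \<phi> y / conv w \<phi> x)) \<partial>lborel)"
    unfolding g_def by (rule nn_integral_cmult) measurable
  also have "\<dots> \<le> ennreal (g x) * ennreal M" by (intro mult_left_mono Fisher) simp
  also have "\<dots> = ennreal (M * g x)" using g_pos[of x] M_nonneg by (simp add: ennreal_mult mult.commute)
  finally have le: "(\<integral>\<^sup>+y. ennreal (?f y) \<partial>lborel) \<le> ennreal (M * g x)" .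
  show i: "integrable lborel ?f"
    by (rule integrableI_nonneg) (use nn le in \<open>auto intro: le_less_trans\<close>)
  then show "(LINT y|lborel. ?f y) \<le> M * g x"
    using le nn_integral_eq_integral[OF i] nn g_pos[of x] M_nonneg by simp
qed

lemma score_identity:
  "conv wx (\<lambda>y. \<phi> y * h y) x = (LINT y|lborel. (w (x - y) * \<phi> y) * (wx (x - y) / w (x - y)) * h y)"
  if [measurable]: "h \<in> borel_measurable borel"
  unfolding conv_def
proof (rule integral_cong_AE)
  show "AE y in lborel. wx (x - y) * (\<phi> y * h y) = (w (x - y) * \<phi> y) * (wx (x - y) / w (x - y)) * h y"
    using AE_reflect[OF wx_zero, of x] by eventually_elim auto
qed measurable

text \<open>
  The logarithmic derivative of \<open>g\<close> at \<open>x\<close> is the mean of the score under the transition density, so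
  the Fisher information controls it.
\<close>

lemma score_bound: "\<bar>g' x\<bar> \<le> sqrt M * g x"
proof -
  let ?\<omega> = "\<lambda>y. w (x - y) * \<phi> y" and ?\<alpha> = "\<lambda>y. wx (x - y) / w (x - y)"
  have \<omega>: "?\<omega> y \<ge> 0" for y using w_nonneg \<phi>_pos[of y] by (simp add: less_imp_le)
  have "(g' x)\<^sup>2 = (LINT y|lborel. ?\<omega> y * ?\<alpha> y * 1)\<^sup>2"
    using score_identity[where h="\<lambda>_. 1" and x=x] by (simp add: g'_def)
  also have "\<dots> \<le> (LINT y|lborel. ?\<omega> y * (?\<alpha> y)\<^sup>2) * (LINT y|lborel. ?\<omega> y * 1\<^sup>2)"
    by (rule weighted_Cauchy_Schwarz(2)) (use \<omega> Fisher_integral(1) kernel_integrable_1[OF w_int] in auto)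
  also have "\<dots> \<le> (M * g x) * g x"
    using Fisher_integral(2)[of x] g_pos[of x] by (simp add: g_def[symmetric] conv_def[symmetric] mult_right_mono)
  also have "\<dots> = (sqrt M * g x)\<^sup>2" using M_nonneg by (simp add: power2_eq_square)
  finally show ?thesis
    using M_nonneg g_pos[of x] by (intro power2_le_imp_le[of "\<bar>g' x\<bar>"]) auto
qed

text \<open>
  Differentiating the kernel multiplies it by the centred score, so \<open>D h x\<close> is the covariance of
  the score and \<open>h\<close> under the transition density at \<open>x\<close>. Centring \<open>h\<close> instead of the score
  (\<open>h y - P h x\<close> below), the Cauchy-Schwarz inequality bounds its square by \<open>M\<close> times the
  conditional variance of \<open>h\<close>.
\<close>

lemma D_bound:
  assumes [measurable]: "h \<in> borel_measurable borel" and h: "\<And>x. \<bar>h x\<bar> \<le> b"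
  shows "(D h x)\<^sup>2 \<le> M * (P (\<lambda>y. (h y)\<^sup>2) x - (P h x)\<^sup>2)"
proof -
  let ?\<omega> = "\<lambda>y. w (x - y) * \<phi> y" and ?\<alpha> = "\<lambda>y. wx (x - y) / w (x - y)" and ?\<beta> = "\<lambda>y. h y - P h x"
  have \<omega>: "?\<omega> y \<ge> 0" for y using w_nonneg \<phi>_pos[of y] by (simp add: less_imp_le)
  have gx: "g x > 0" by (rule g_pos)
  have h2: "\<bar>(h y)\<^sup>2\<bar> \<le> b\<^sup>2" for y using h[of y] by (simp add: power2_le_iff_abs_le order_trans[OF abs_ge_zero])
  have i1: "integrable lborel (\<lambda>y. ?\<omega> y * h y)"
    using kernel_integrable[OF assms w_int, where x=x] by (simp add: mult.assoc)
  have i2: "integrable lborel (\<lambda>y. ?\<omega> y * (h y)\<^sup>2)"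
    using kernel_integrable[OF _ h2 w_int, where x=x] by (simp add: mult.assoc)
  have i0: "integrable lborel ?\<omega>" by (rule kernel_integrable_1[OF w_int])
  have e1: "(LINT y|lborel. ?\<omega> y * h y) = P h x * g x" and e0: "(LINT y|lborel. ?\<omega> y) = g x"
    and e2: "(LINT y|lborel. ?\<omega> y * (h y)\<^sup>2) = P (\<lambda>y. (h y)\<^sup>2) x * g x"
    using gx by (simp_all add: P_def conv_def mult.assoc) (simp add: g_def conv_def)
  have expand: "?\<omega> y * (?\<beta> y)\<^sup>2 = ?\<omega> y * (h y)\<^sup>2 - 2 * P h x * (?\<omega> y * h y) + (P h x)\<^sup>2 * ?\<omega> y" for y
    by (simp add: power2_eq_square algebra_simps)
  have ib: "integrable lborel (\<lambda>y. ?\<omega> y * (?\<beta> y)\<^sup>2)"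
    unfolding expand using i0 i1 i2 by auto
  have var: "(LINT y|lborel. ?\<omega> y * (?\<beta> y)\<^sup>2) = (P (\<lambda>y. (h y)\<^sup>2) x - (P h x)\<^sup>2) * g x"
  proof -
    have "(LINT y|lborel. ?\<omega> y * (?\<beta> y)\<^sup>2) = P (\<lambda>y. (h y)\<^sup>2) x * g x - 2 * P h x * (P h x * g x) + (P h x)\<^sup>2 * g x"
      unfolding expand using i0 i1 i2 e0 e1 e2 by simp
    then show ?thesis by (simp add: power2_eq_square algebra_simps)
  qed
  have a1: "integrable lborel (\<lambda>y. wx (x - y) * (\<phi> y * h y))" "integrable lborel (\<lambda>y. wx (x - y) * \<phi> y)"
    by (auto intro!: kernel_integrable[OF assms] kernel_integrable_1 wx_int)
  have "D h x * g x = conv wx (\<lambda>y. \<phi> y * h y) x - P h x * g' x"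
    using gx by (simp add: D_def P_def field_simps power2_eq_square)
  also have "\<dots> = conv wx (\<lambda>y. \<phi> y * ?\<beta> y) x"
  proof -
    have "wx (x - y) * (\<phi> y * ?\<beta> y) = wx (x - y) * (\<phi> y * h y) - P h x * (wx (x - y) * \<phi> y)" for y
      by (simp add: algebra_simps)
    then show ?thesis using a1 by (simp add: conv_def g'_def)
  qed
  also have "\<dots> = (LINT y|lborel. ?\<omega> y * ?\<alpha> y * ?\<beta> y)" by (rule score_identity) measurable
  finally have "(D h x * g x)\<^sup>2 = (LINT y|lborel. ?\<omega> y * ?\<alpha> y * ?\<beta> y)\<^sup>2" by simp
  also have "\<dots> \<le> (LINT y|lborel. ?\<omega> y * (?\<alpha> y)\<^sup>2) * (LINT y|lborel. ?\<omega> y * (?\<beta> y)\<^sup>2)"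
    by (rule weighted_Cauchy_Schwarz(2)) (use \<omega> Fisher_integral(1) ib in auto)
  also have "\<dots> \<le> (M * g x) * (LINT y|lborel. ?\<omega> y * (?\<beta> y)\<^sup>2)"
    by (intro mult_right_mono Fisher_integral(2)) (simp add: \<omega>)
  finally have "(D h x)\<^sup>2 * (g x)\<^sup>2 \<le> M * (P (\<lambda>y. (h y)\<^sup>2) x - (P h x)\<^sup>2) * (g x)\<^sup>2"
    unfolding var by (simp add: power_mult_distrib power2_eq_square ac_simps)
  then show ?thesis using gx by simp
qed

text \<open>
  The continuous representative of \<open>g\<close> is positive at every point, not merely almost everywhere: by
  the bound on the logarithmic derivative a single zero would spread to the whole line.
\<close>

lemma g_primitive:
  obtains G where "primitive G g'" "AE x in lborel. g x = G x" "\<And>x. G x > 0" "AE x in lborel. \<bar>g' x\<bar> \<le> sqrt M * G x"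
proof -
  have "has_weak_deriv g g'" using weak_deriv[of "\<lambda>_. 1" 1] by (simp add: g_def g'_def)
  then obtain G where G: "primitive G g'" "AE x in lborel. g x = G x" by (rule weak_deriv_primitive)
  have "AE x in lborel. 0 \<le> G x" using G(2)
  proof eventually_elim
    case (elim x) then show ?case using g_pos[of x] by simp
  qed
  then have nn: "0 \<le> G x" for x
    by (rule continuous_AE_le_imp_le[OF continuous_on_const primitive_continuous[OF G(1)]])
  have bd: "AE x in lborel. \<bar>g' x\<bar> \<le> sqrt M * G x"
    using G(2)
  proof eventually_elim
    case (elim x) then show ?case using score_bound[of x] by simp
  qed
  have "G x \<noteq> 0" for x
  proof
    assume "G x = 0"
    then have "G y = 0" for y by (rule primitive_zero_propagates[OF G(1) nn bd])
    then have "AE x::real in lborel. False"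
      by (intro eventually_mono[OF G(2)]) (metis g_pos less_irrefl)
    then show False by (rule not_AE_False)
  qed
  then have "G x > 0" for x using nn[of x] by (simp add: less_le)
  then show ?thesis using that G bd by blast
qed

lemma P_weak_deriv:
  assumes [measurable]: "h \<in> borel_measurable borel" and h: "\<And>x. \<bar>h x\<bar> \<le> b"
  shows "has_weak_deriv (P h) (D h)"
proof -
  obtain G where G: "primitive G g'" "AE x in lborel. g x = G x" "\<And>x. G x > 0" "AE x in lborel. \<bar>g' x\<bar> \<le> sqrt M * G x"
    using g_primitive by blast
  obtain H where H: "primitive H (conv wx (\<lambda>x. \<phi> x * h x))" "AE x in lborel. conv w (\<lambda>x. \<phi> x * h x) x = H x"
    using weak_deriv_primitive[OF weak_deriv[OF assms]] by blast
  have "primitive (\<lambda>x. H x * (1 / G x)) (\<lambda>x. conv wx (\<lambda>x. \<phi> x * h x) x * (1 / G x) + H x * (- g' x / (G x)\<^sup>2))"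
    by (intro primitive_mult H primitive_inverse[OF G(1,3,4)])
  then have "has_weak_deriv (\<lambda>x. H x * (1 / G x)) (\<lambda>x. conv wx (\<lambda>x. \<phi> x * h x) x * (1 / G x) + H x * (- g' x / (G x)\<^sup>2))"
    by (rule primitive_weak_deriv)
  then show ?thesis
  proof (rule has_weak_deriv_cong_AE)
    show "AE x in lborel. H x * (1 / G x) = P h x"
      using H(2) G(2) by eventually_elim (simp add: P_def)
    show "AE x in lborel. conv wx (\<lambda>x. \<phi> x * h x) x * (1 / G x) + H x * (- g' x / (G x)\<^sup>2) = D h x"
      using H(2) G(2) by eventually_elim (simp add: D_def)
  qed (intro P_meas D_meas assms(1))+
qed

definition "\<nu> x = \<phi> x * g x"
definition "Z = (LINT x|lborel. \<nu> x)"

lemma \<nu>_meas [measurable]: "\<nu> \<in> borel_measurable borel"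
  unfolding \<nu>_def[abs_def] by (intro borel_measurable_times meas)

lemma \<nu>_pos: "\<nu> x > 0"
  using \<phi>_pos g_pos by (simp add: \<nu>_def)

lemma \<nu>_int: "integrable lborel \<nu>"
  using integrable_mult_conv(1)[OF w_int \<phi>_meas \<phi>_meas \<phi>_sq \<phi>_sq] by (simp add: \<nu>_def[abs_def] g_def)

lemma bounded_\<nu>_int:
  assumes "b \<in> borel_measurable borel" "\<And>x. \<bar>b x\<bar> \<le> C"
  shows "integrable lborel (\<lambda>x. b x * \<nu> x)"
  using integrable_mult_bounded(1)[OF \<nu>_int, of b C] assms by simp

lemma Z_pos: "Z > 0"
proof -
  have "Z \<noteq> 0"
  proof
    assume "Z = 0"
    then have "AE x in lborel. \<nu> x = 0"
      using integral_nonneg_eq_0_iff_AE[OF \<nu>_int] \<nu>_pos by (simp add: Z_def less_imp_le)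
    then have "AE x::real in lborel. False"
      by (rule eventually_mono) (metis \<nu>_pos less_irrefl)
    then show False by (rule not_AE_False)
  qed
  moreover have "Z \<ge> 0" unfolding Z_def using \<nu>_pos by (simp add: less_imp_le)
  ultimately show ?thesis by simp
qed

lemma P_\<nu>: "P h x * \<nu> x = \<phi> x * conv w (\<lambda>y. \<phi> y * h y) x"
  using g_pos[of x] by (simp add: P_def \<nu>_def)

lemma P_stationary:
  assumes "h \<in> borel_measurable borel" "\<And>x. \<bar>h x\<bar> \<le> b"
  shows "(LINT x|lborel. P h x * \<nu> x) = (LINT x|lborel. h x * \<nu> x)"
  using reversible[OF assms] unfolding P_\<nu> by (simp add: \<nu>_def g_def ac_simps)

text \<open>
  The Poincare inequality for the smoothed function \<open>P h\<close> bounds its variance by \<open>k\<close> times its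
  Dirichlet energy, and the energy is at most \<open>M\<close> times the mean conditional variance, which is the
  variance lost from \<open>h\<close> to \<open>P h\<close>. Thus \<open>Var (P h) \<le> k * M * (Var h - Var (P h))\<close>; both variances
  appear multiplied by the total mass \<open>Z\<close>.
\<close>

lemma P_variance_contraction:
  assumes k: "k > 0"
    and poincare: "\<And>h. h \<in> wH 1 (\<lambda>x. 1 / Z * \<nu> x) \<Longrightarrow>
      Var (\<lambda>x. 1 / Z * \<nu> x) h \<le> k * (LINT x|lborel. (wderiv h x)\<^sup>2 * (1 / Z * \<nu> x))"
    and h_meas: "h \<in> borel_measurable borel" and h: "\<And>x. \<bar>h x\<bar> \<le> b"
  shows "(LINT x|lborel. (P h x)\<^sup>2 * \<nu> x) - (LINT x|lborel. h x * \<nu> x)\<^sup>2 / Z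
    \<le> k * M / (1 + k * M) * ((LINT x|lborel. (h x)\<^sup>2 * \<nu> x) - (LINT x|lborel. h x * \<nu> x)\<^sup>2 / Z)"
proof -
  note [measurable] = h_meas
  note Pm [measurable] = P_meas[OF h_meas] and Dm [measurable] = D_meas[OF h_meas]
  have h2: "\<bar>(h x)\<^sup>2\<bar> \<le> b\<^sup>2" for x by (rule abs_power2_le[OF h])
  have h2m: "(\<lambda>x. (h x)\<^sup>2) \<in> borel_measurable borel" by measurable
  note Pb = P_bound[OF h_meas h]
  note P2b = abs_power2_le[OF Pb]
  have Db: "\<bar>(D h x)\<^sup>2\<bar> \<le> M * b\<^sup>2" for x
  proof -
    have "(D h x)\<^sup>2 \<le> M * (P (\<lambda>y. (h y)\<^sup>2) x - (P h x)\<^sup>2)" by (rule D_bound[OF h_meas h])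
    also have "\<dots> \<le> M * b\<^sup>2"
    proof (rule mult_left_mono[OF _ M_nonneg])
      have "P (\<lambda>y. (h y)\<^sup>2) x \<le> b\<^sup>2" using P_bound[OF h2m h2, of x] by (simp add: abs_le_iff)
      then show "P (\<lambda>y. (h y)\<^sup>2) x - (P h x)\<^sup>2 \<le> b\<^sup>2" using zero_le_power2[of "P h x"] by linarith
    qed
    finally show ?thesis by simp
  qed
  have P2m: "(\<lambda>x. (P h x)\<^sup>2) \<in> borel_measurable borel" and D2m: "(\<lambda>x. (D h x)\<^sup>2) \<in> borel_measurable borel"
    by measurable
  note iP2 = bounded_\<nu>_int[OF P2m P2b] and iD2 = bounded_\<nu>_int[OF D2m Db]
  have wd: "has_weak_deriv (P h) (D h)" by (rule P_weak_deriv[OF h_meas h])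
  then have wd': "has_weak_deriv (P h) (wderiv (P h))"
    unfolding wderiv_def by (rule someI[of "has_weak_deriv (P h)"])
  then have [measurable]: "wderiv (P h) \<in> borel_measurable borel"
    by (auto simp: has_weak_deriv_def intro: locally_integrable_measurable)
  have AE_D: "AE x in lborel. (D h x)\<^sup>2 * \<nu> x = (wderiv (P h) x)\<^sup>2 * \<nu> x"
    using wderiv_AE[OF wd] by eventually_elim simp
  have iW: "integrable lborel (\<lambda>x. (wderiv (P h) x)\<^sup>2 * \<nu> x)"
    using iD2 integrable_cong_AE[THEN iffD1, OF _ _ AE_D] by simp
  have "P h \<in> wH 1 (\<lambda>x. 1 / Z * \<nu> x)"
    unfolding wH_def weakly_differentiable_def wL2_def
    using wd iP2 iW by (auto simp: le_Suc_eq)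
  from poincare[OF this] 
  have "Var (\<lambda>x. 1 / Z * \<nu> x) (P h) \<le> k * ((LINT x|lborel. (wderiv (P h) x)\<^sup>2 * \<nu> x) / Z)"
    by simp
  also have "(LINT x|lborel. (wderiv (P h) x)\<^sup>2 * \<nu> x) = (LINT x|lborel. (D h x)\<^sup>2 * \<nu> x)"
    using AE_D by (intro integral_cong_AE) (auto elim: eventually_mono)
  finally have v1: "Var (\<lambda>x. 1 / Z * \<nu> x) (P h) \<le> k * ((LINT x|lborel. (D h x)\<^sup>2 * \<nu> x) / Z)" .
  have "(LINT x|lborel. (D h x)\<^sup>2 * \<nu> x) \<le> (LINT x|lborel. M * (P (\<lambda>y. (h y)\<^sup>2) x * \<nu> x - (P h x)\<^sup>2 * \<nu> x))"
  proof (rule integral_mono[OF iD2])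
    show "integrable lborel (\<lambda>x. M * (P (\<lambda>y. (h y)\<^sup>2) x * \<nu> x - (P h x)\<^sup>2 * \<nu> x))"
      using bounded_\<nu>_int[OF P_meas[OF h2m] P_bound[OF h2m h2]] iP2 by auto
    fix x
    show "(D h x)\<^sup>2 * \<nu> x \<le> M * (P (\<lambda>y. (h y)\<^sup>2) x * \<nu> x - (P h x)\<^sup>2 * \<nu> x)"
      using mult_right_mono[OF D_bound[OF h_meas h, of x], of "\<nu> x"] \<nu>_pos[of x] by (simp add: algebra_simps)
  qed
  also have "\<dots> = M * ((LINT x|lborel. (h x)\<^sup>2 * \<nu> x) - (LINT x|lborel. (P h x)\<^sup>2 * \<nu> x))"
    using bounded_\<nu>_int[OF P_meas[OF h2m] P_bound[OF h2m h2]] iP2 P_stationary[OF h2m h2] by simp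
  finally have v2: "(LINT x|lborel. (D h x)\<^sup>2 * \<nu> x)
     \<le> M * ((LINT x|lborel. (h x)\<^sup>2 * \<nu> x) - (LINT x|lborel. (P h x)\<^sup>2 * \<nu> x))" .
  define X where "X = (LINT x|lborel. (P h x)\<^sup>2 * \<nu> x)"
  define Y where "Y = (LINT x|lborel. h x * \<nu> x)\<^sup>2 / Z"
  define H where "H = (LINT x|lborel. (h x)\<^sup>2 * \<nu> x)"
  have "Var (\<lambda>x. 1 / Z * \<nu> x) (P h) = (X - Y) / Z"
    using P_stationary[OF h_meas h] Z_pos by (simp add: Var_def X_def Y_def field_simps power2_eq_square)
  with v1 have "(X - Y) / Z \<le> (k * (LINT x|lborel. (D h x)\<^sup>2 * \<nu> x)) / Z" by simp
  then have "X - Y \<le> k * (LINT x|lborel. (D h x)\<^sup>2 * \<nu> x)" using Z_pos by (simp add: divide_le_cancel)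
  also have "\<dots> \<le> k * (M * (H - X))" using v2 k by (intro mult_left_mono) (simp_all add: X_def H_def)
  finally have "(X - Y) * (1 + k * M) \<le> k * M * (H - Y)" by (simp add: algebra_simps)
  moreover have "1 + k * M > 0" using k M_nonneg by (simp add: add_pos_nonneg)
  ultimately have "X - Y \<le> k * M * (H - Y) / (1 + k * M)" by (simp add: pos_le_divide_eq)
  then show ?thesis by (simp add: X_def Y_def H_def)
qed

text \<open>
  From \<open>2 * h * P h \<le> h\<^sup>2 + (P h)\<^sup>2\<close> and the contraction of the variance; \<open>h\<close> and \<open>P h\<close> have the same
  mean. The left side is the inner product of \<open>h\<close> and \<open>P h\<close> for the reversible measure.
\<close>

lemma spectral_gap:
  assumes k: "k > 0"
    and poincare: "\<And>h. h \<in> wH 1 (\<lambda>x. 1 / Z * \<nu> x) \<Longrightarrow>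
      Var (\<lambda>x. 1 / Z * \<nu> x) h \<le> k * (LINT x|lborel. (wderiv h x)\<^sup>2 * (1 / Z * \<nu> x))"
    and h_meas: "h \<in> borel_measurable borel" and h: "\<And>x. \<bar>h x\<bar> \<le> b"
  shows "(LINT x|lborel. \<phi> x * h x * conv w (\<lambda>y. \<phi> y * h y) x)
    \<le> (LINT x|lborel. (h x)\<^sup>2 * \<nu> x) - (1 - k * M / (1 + k * M)) / 2 *
        ((LINT x|lborel. (h x)\<^sup>2 * \<nu> x) - (LINT x|lborel. h x * \<nu> x)\<^sup>2 / Z)"
proof -
  note [measurable] = h_meas P_meas[OF h_meas]
  have hm2: "(\<lambda>x. (h x)\<^sup>2) \<in> borel_measurable borel" and Pm2: "(\<lambda>x. (P h x)\<^sup>2) \<in> borel_measurable borel"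
    by measurable
  note i = bounded_\<nu>_int[OF hm2 abs_power2_le[OF h]] bounded_\<nu>_int[OF Pm2 abs_power2_le[OF P_bound[OF h_meas h]]]
  have "(LINT x|lborel. \<phi> x * h x * conv w (\<lambda>y. \<phi> y * h y) x) = (LINT x|lborel. h x * P h x * \<nu> x)"
    using P_\<nu>[of h] by (intro Bochner_Integration.integral_cong) (auto simp: mult.assoc mult.left_commute)
  also have "\<dots> \<le> (LINT x|lborel. ((h x)\<^sup>2 * \<nu> x + (P h x)\<^sup>2 * \<nu> x) / 2)"
  proof (rule integral_mono)
    show "integrable lborel (\<lambda>x. ((h x)\<^sup>2 * \<nu> x + (P h x)\<^sup>2 * \<nu> x) / 2)" using i by auto
    show "integrable lborel (\<lambda>x. h x * P h x * \<nu> x)"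
    proof (rule bounded_\<nu>_int)
      show "\<bar>h x * P h x\<bar> \<le> b * b" for x
        using h[of x] P_bound[OF h_meas h, of x] by (auto simp: abs_mult intro!: mult_mono)
    qed measurable
    fix x
    have "2 * (h x * P h x) \<le> (h x)\<^sup>2 + (P h x)\<^sup>2" using sum_squares_bound[of "h x" "P h x"] by simp
    then show "h x * P h x * \<nu> x \<le> ((h x)\<^sup>2 * \<nu> x + (P h x)\<^sup>2 * \<nu> x) / 2"
      using mult_right_mono[of "2 * (h x * P h x)" "(h x)\<^sup>2 + (P h x)\<^sup>2" "\<nu> x"] \<nu>_pos[of x] by (simp add: algebra_simps)
  qed
  also have "\<dots> = ((LINT x|lborel. (h x)\<^sup>2 * \<nu> x) + (LINT x|lborel. (P h x)\<^sup>2 * \<nu> x)) / 2"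
    using i by simp
  finally have "(LINT x|lborel. \<phi> x * h x * conv w (\<lambda>y. \<phi> y * h y) x)
    \<le> ((LINT x|lborel. (h x)\<^sup>2 * \<nu> x) + (LINT x|lborel. (P h x)\<^sup>2 * \<nu> x)) / 2" .
  moreover have "Q \<le> H - (1 - a) / 2 * (H - Y)" if "Q \<le> (H + X) / 2" "X - Y \<le> a * (H - Y)" for Q H X Y a :: real
  proof -
    have "H - (1 - a) / 2 * (H - Y) = (H + (Y + a * (H - Y))) / 2" by (simp add: field_simps)
    moreover have "X \<le> Y + a * (H - Y)" using that(2) by simp
    then have "(H + X) / 2 \<le> (H + (Y + a * (H - Y))) / 2" by simp
    ultimately show ?thesis using that(1) by simp
  qed
  ultimately show ?thesis using P_variance_contraction[OF assms] by blast
qed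

end

section \<open>Coercivity of the wave operator\<close>

lemma integral_linear3:
  fixes a b d :: "'a \<Rightarrow> real"
  assumes "integrable N a" "integrable N b" "integrable N d"
  shows "(LINT x|N. a x - s * b x + t * d x) = (LINT x|N. a x) - s * (LINT x|N. b x) + t * (LINT x|N. d x)"
  using assms by simp

text \<open>
  Here \<open>u\<close> is the derivative of the wave profile and \<open>u'\<close> its weak derivative. The numbers \<open>f0\<close>, \<open>F\<close>
  and so on are bounds of the coefficients; \<open>f0\<close> is also a factor of the constant \<open>\<kappa>0\<close>.
\<close>

locale travelling_wave = reversible_convolution +
  fixes f r q u u' :: "real \<Rightarrow> real" and c k f0 F r0 R q0 Q :: real
  assumes f_meas [measurable]: "f \<in> borel_measurable borel" and f_bounds: "f0 > 0" "f0 \<le> f x" "f x \<le> F"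
    and r_meas [measurable]: "r \<in> borel_measurable borel" and r_bounds: "r0 > 0" "r0 \<le> r x" "r x \<le> R"
    and q_meas [measurable]: "q \<in> borel_measurable borel" and q_bounds: "q0 > 0" "q0 \<le> q x" "q x \<le> Q"
    and \<phi>_eq: "\<phi> x = q x * u x" and u_pos: "u x > 0"
    and u_sq: "integrable lborel (\<lambda>x. (u x)\<^sup>2)" and u'_sq: "integrable lborel (\<lambda>x. (u' x)\<^sup>2)"
    and u_weak: "has_weak_deriv u u'"
    and wave_eq: "AE x in lborel. c * u' x = f x * u x - r x * conv w \<phi> x"
    and k_pos: "k > 0"
    and poincare: "h \<in> wH 1 (\<lambda>x. 1 / Z * \<nu> x) \<Longrightarrow>
      Var (\<lambda>x. 1 / Z * \<nu> x) h \<le> k * (LINT x|lborel. (wderiv h x)\<^sup>2 * (1 / Z * \<nu> x))"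
begin

definition "m x = q x / r x"
definition "\<kappa>0 = f0 / 2 * (1 - k * M / (1 + k * M))"
text \<open>\<open>N2\<close> is the squared norm of \<open>u' / f\<close>, and \<open>Zf\<close> the total mass of \<open>\<nu> / f\<close>.\<close>
definition "N2 = (LINT x|lborel. u' x / f x * (u' x / f x) * m x)"
definition "Zf = (LINT x|lborel. \<nu> x / f x)"

lemma pos: "f x > 0" "r x > 0" "q x > 0" "m x > 0"
  using f_bounds(1) f_bounds(2)[of x] r_bounds(1) r_bounds(2)[of x] q_bounds(1) q_bounds(2)[of x] by (auto simp: m_def)

lemma m_meas [measurable]: "m \<in> borel_measurable borel"
  unfolding m_def[abs_def] by measurable

lemma u_meas [measurable]: "u \<in> borel_measurable borel" "u' \<in> borel_measurable borel"
  using u_weak by (auto simp: has_weak_deriv_def intro: locally_integrable_measurable)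

lemma m_upper: "m x \<le> Q / r0" and m_lower: "q0 / R \<le> m x" and m_lower_pos: "q0 / R > 0"
  using pos[of x] r_bounds(1) r_bounds(2,3)[of x] q_bounds(1) q_bounds(2,3)[of x]
  by (auto simp: m_def intro!: frac_le divide_pos_pos)

lemma \<kappa>0_pos: "\<kappa>0 > 0"
proof -
  have "1 + k * M > 0" using k_pos M_nonneg by (simp add: add_pos_nonneg)
  then show ?thesis using f_bounds(1) by (simp add: \<kappa>0_def field_simps)
qed

lemma weighted_square_int:
  assumes "integrable lborel (\<lambda>x. (v x)\<^sup>2)"
  shows "integrable lborel (\<lambda>x. m x * (v x)\<^sup>2)"
  using m_upper pos(4) by (intro integrable_mult_bounded(1)[OF assms, of m "Q / r0"]) (auto simp: abs_of_pos)

lemma q_square_int: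
  assumes v2: "integrable lborel (\<lambda>x. m x * (v x)\<^sup>2)"
  shows "integrable lborel (\<lambda>x. (q x * v x)\<^sup>2)"
proof -
  have "integrable lborel (\<lambda>x. (q x * r x) * (m x * (v x)\<^sup>2))"
  proof (rule integrable_mult_bounded(1)[OF v2])
    show "AE x in lborel. \<bar>q x * r x\<bar> \<le> Q * R"
    proof (intro AE_I2)
      fix x
      show "\<bar>q x * r x\<bar> \<le> Q * R"
        using pos(2,3)[of x] q_bounds(3)[of x] r_bounds(3)[of x] by (auto simp: abs_mult intro!: mult_mono)
    qed
  qed measurable
  moreover have "(q x * r x) * (m x * (v x)\<^sup>2) = (q x * v x)\<^sup>2" for x
    using pos[of x] by (simp add: m_def power2_eq_square)
  ultimately show ?thesis by simp
qed

lemma u'_over_f_int: "integrable lborel (\<lambda>x. m x * (u' x / f x)\<^sup>2)"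
proof (rule weighted_square_int)
  have "integrable lborel (\<lambda>x. (1 / (f x)\<^sup>2) * (u' x)\<^sup>2)"
  proof (rule integrable_mult_bounded(1)[OF u'_sq])
    show "AE x in lborel. \<bar>1 / (f x)\<^sup>2\<bar> \<le> 1 / f0\<^sup>2"
      using f_bounds by (auto intro!: divide_left_mono power_mono mult_pos_pos zero_less_power pos)
  qed measurable
  then show "integrable lborel (\<lambda>x. (u' x / f x)\<^sup>2)" by (simp add: power_divide)
qed

lemma \<nu>_over_f_int: "integrable lborel (\<lambda>x. \<nu> x / f x)"
proof -
  have "\<bar>1 / f x\<bar> \<le> 1 / f0" for x
    using f_bounds(1) f_bounds(2)[of x] pos(1)[of x] by (simp add: frac_le)
  then show ?thesis using bounded_\<nu>_int[of "\<lambda>x. 1 / f x" "1 / f0"] by simp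
qed

lemma Zf_pos: "Zf > 0"
proof -
  have p: "\<nu> x / f x > 0" for x using \<nu>_pos pos by simp
  have "Zf \<noteq> 0"
  proof
    assume "Zf = 0"
    then have "AE x in lborel. \<nu> x / f x = 0"
      using integral_nonneg_eq_0_iff_AE[OF \<nu>_over_f_int] p by (simp add: Zf_def less_imp_le)
    then have "AE x::real in lborel. False"
      by (rule eventually_mono) (metis p less_irrefl)
    then show False by (rule not_AE_False)
  qed
  moreover have "Zf \<ge> 0" unfolding Zf_def using p by (simp add: less_imp_le)
  ultimately show ?thesis by simp
qed

text \<open>
  If \<open>u'\<close> vanished almost everywhere, \<open>u\<close> would be a nonzero constant and not square integrable.
\<close>

lemma N2_pos: "N2 > 0"
proof -
  have eq: "N2 = (LINT x|lborel. m x * (u' x / f x)\<^sup>2)"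
    unfolding N2_def by (intro Bochner_Integration.integral_cong) (auto simp: power2_eq_square)
  have nn: "0 \<le> m x * (u' x / f x)\<^sup>2" for x using pos by (simp add: less_imp_le)
  have "N2 \<noteq> 0"
  proof
    assume "N2 = 0"
    then have "AE x in lborel. m x * (u' x / f x)\<^sup>2 = 0"
      using integral_nonneg_eq_0_iff_AE[OF u'_over_f_int] nn eq by simp
    then have u'0: "AE x in lborel. u' x = 0"
    proof eventually_elim
      case (elim x) then show ?case using pos[of x] by simp
    qed
    obtain U where U: "primitive U u'" "AE x in lborel. u x = U x" using weak_deriv_primitive[OF u_weak] .
    have "U a \<le> U b" if "a \<le> b" for a b
      by (rule primitive_mono[OF U(1) _ that]) (use u'0 in \<open>auto elim: eventually_mono\<close>)
    moreover have "U b \<le> U a" if "a \<le> b" for a b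
      by (rule primitive_antimono[OF U(1) _ that]) (use u'0 in \<open>auto elim: eventually_mono\<close>)
    ultimately have const: "U x = U 0" for x by (metis linear order_antisym)
    have "integrable lborel (\<lambda>x::real. (U 0)\<^sup>2)"
    proof (subst integrable_cong_AE[where g="\<lambda>x. (u x)\<^sup>2"])
      show "AE x in lborel. (U 0)\<^sup>2 = (u x)\<^sup>2"
        by (rule eventually_mono[OF U(2)]) (metis const)
    qed (use u_sq in auto)
    then have i: "integrable lborel (\<lambda>x::real. (1 / (U 0)\<^sup>2) * (U 0)\<^sup>2)" by (rule integrable_mult_right)
    have "U 0 = 0"
    proof (rule ccontr)
      assume "U 0 \<noteq> 0"
      with i have "integrable lborel (indicator UNIV :: real \<Rightarrow> real)" by simp
      then show False unfolding integrable_indicator_iff by simp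
    qed
    then have "AE x::real in lborel. False"
      by (intro eventually_mono[OF U(2)]) (metis const u_pos less_irrefl)
    then show False by (rule not_AE_False)
  qed
  moreover have "N2 \<ge> 0" unfolding eq using nn by simp
  ultimately show ?thesis by simp
qed

text \<open>
  Write \<open>v = h * u\<close>. The quadratic form on the right is the sum of the Dirichlet form of \<open>P\<close> at \<open>h\<close> and
  of the integral of \<open>W\<close>, which is \<open>c * (u' / u) * m * v\<^sup>2\<close> by the wave equation. The spectral gap
  bounds the Dirichlet form below by the variance of \<open>h\<close> for \<open>\<nu>\<close>, and passing to the measure \<open>\<nu> / f\<close> costs the
  factor \<open>f0\<close>. As \<open>\<nu> / f = m * u\<^sup>2 - c * m * u * u' / f\<close>, the integrals of \<open>h\<^sup>2\<close> and \<open>h\<close> for it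
  are those of \<open>m * v\<^sup>2\<close> and \<open>m * v * u\<close>, up to terms with a factor \<open>c\<close>. Those quadratic in \<open>v\<close> combine with \<open>W\<close> into the
  term controlled by \<open>S\<close>.
  The square of the mean is split by \<open>(a - b)\<^sup>2 \<le> 3 a\<^sup>2 + (3/2) b\<^sup>2\<close> rather than by
  \<open>2 a\<^sup>2 + 2 b\<^sup>2\<close>; the factor \<open>3/2 < 2\<close> is what leaves a gap at the critical wave speed itself.
\<close>

lemma coercive_bounded:
  assumes v_meas [measurable]: "v \<in> borel_measurable borel" and v: "\<And>x. \<bar>v x\<bar> \<le> b * u x"
    and S: "AE x in lborel. \<bar>c\<bar> * \<bar>u' x / (u x * f x) * (\<kappa>0 - f x)\<bar> \<le> \<bar>c\<bar> * S"
  shows "(\<kappa>0 * (1 - 3 / 2 * c\<^sup>2 * N2 / Zf) - \<bar>c\<bar> * S) * (LINT x|lborel. m x * (v x)\<^sup>2)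
      - 3 * \<kappa>0 / Zf * (LINT x|lborel. m x * v x * u x)\<^sup>2
    \<le> (LINT x|lborel. f x * (m x * (v x)\<^sup>2)) - (LINT x|lborel. q x * v x * conv w (\<lambda>y. q y * v y) x)"
proof -
  define h where "h x = v x / u x" for x
  have h_meas [measurable]: "h \<in> borel_measurable borel" unfolding h_def[abs_def] by measurable
  have h: "\<bar>h x\<bar> \<le> b" for x using v[of x] u_pos[of x] by (simp add: h_def abs_divide pos_divide_le_eq)
  have \<phi>h: "\<phi> x * h x = q x * v x" for x using u_pos[of x] by (simp add: \<phi>_eq h_def)
  have h2m: "(\<lambda>x. (h x)\<^sup>2) \<in> borel_measurable borel" by measurable
  note ih = bounded_\<nu>_int[OF h_meas h] and ih2 = bounded_\<nu>_int[OF h2m abs_power2_le[OF h]]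
  define T where "T x = m x * (v x)\<^sup>2" for x
  define W where "W x = f x * T x - (h x)\<^sup>2 * \<nu> x" for x
  define a where "a = k * M / (1 + k * M)"
  define J where "J = (LINT x|lborel. T x)"
  define A where "A = (LINT x|lborel. m x * v x * u x)"
  define E where "E = (LINT x|lborel. m x * v x * (u' x / f x))"
  define H where "H = (LINT x|lborel. (h x)\<^sup>2 * \<nu> x)"
  define I where "I = (LINT x|lborel. h x * \<nu> x)"
  define H' where "H' = (LINT x|lborel. (h x)\<^sup>2 * \<nu> x / f x)"
  define I' where "I' = (LINT x|lborel. h x * \<nu> x / f x)"
  have a1: "(1 - a) / 2 \<ge> 0"
  proof -
    have "1 + k * M > 0" using k_pos M_nonneg by (simp add: add_pos_nonneg)
    then show ?thesis by (simp add: a_def field_simps)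
  qed
  have inv_f: "\<bar>1 / f x\<bar> \<le> 1 / f0" for x
    using f_bounds(1) f_bounds(2)[of x] pos(1)[of x] by (simp add: frac_le)
  have over_f: "integrable lborel (\<lambda>x. s x / f x)" if "integrable lborel s" for s
    using integrable_mult_bounded(1)[OF that, of "\<lambda>x. 1 / f x" "1 / f0"] inv_f by simp
  have v2: "integrable lborel (\<lambda>x. (v x)\<^sup>2)"
  proof (rule Bochner_Integration.integrable_bound)
    show "integrable lborel (\<lambda>x. b\<^sup>2 * (u x)\<^sup>2)" using u_sq by simp
    show "AE x in lborel. norm ((v x)\<^sup>2) \<le> norm (b\<^sup>2 * (u x)\<^sup>2)"
      using abs_power2_le[OF v] by (intro AE_I2) (simp add: power_mult_distrib)
  qed measurable
  have iT: "integrable lborel T" using weighted_square_int[OF v2] by (simp add: T_def[abs_def])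
  have ifT: "integrable lborel (\<lambda>x. f x * T x)"
    using f_bounds(3) pos(1) by (intro integrable_mult_bounded(1)[OF iT, of f F]) (auto simp: abs_of_pos)
  have iW: "integrable lborel W" unfolding W_def[abs_def] using ifT ih2 by auto
  have T_nn: "T x \<ge> 0" for x using pos by (simp add: T_def less_imp_le)
  have u2: "integrable lborel (\<lambda>x. m x * (u x)\<^sup>2)" by (rule weighted_square_int[OF u_sq])
  have m_nn: "m x \<ge> 0" for x using pos by (simp add: less_imp_le)
  have iA: "integrable lborel (\<lambda>x. m x * v x * u x)"
    by (rule weighted_Cauchy_Schwarz(1)) (use m_nn iT u2 in \<open>auto simp: T_def[abs_def]\<close>)
  have iE: "integrable lborel (\<lambda>x. m x * v x * (u' x / f x))"
    by (rule weighted_Cauchy_Schwarz(1)) (use m_nn iT u'_over_f_int in \<open>auto simp: T_def[abs_def]\<close>)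
  have N2: "N2 = (LINT x|lborel. m x * (u' x / f x)\<^sup>2)"
    unfolding N2_def by (intro Bochner_Integration.integral_cong) (auto simp: power2_eq_square)
  have E2: "E\<^sup>2 \<le> J * N2"
    unfolding E_def J_def T_def N2
    by (rule weighted_Cauchy_Schwarz(2)) (use m_nn iT u'_over_f_int in \<open>auto simp: T_def[abs_def]\<close>)
  have wave: "AE x in lborel. \<nu> x = m x * u x * (f x * u x - c * u' x)"
    using wave_eq
  proof eventually_elim
    case (elim x)
    then have "f x * u x - c * u' x = r x * g x" by (simp add: g_def)
    moreover have "\<nu> x = m x * u x * (r x * g x)" using pos[of x] by (simp add: \<nu>_def \<phi>_eq m_def)
    ultimately show ?case by simp
  qed
  have W_eq: "AE x in lborel. W x = c * (u' x / u x) * T x"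
    using wave
  proof eventually_elim
    case (elim x)
    have "(h x)\<^sup>2 * (m x * u x * (f x * u x - c * u' x)) = T x * (f x - c * (u' x / u x))"
      using u_pos[of x] by (simp add: h_def T_def field_simps power2_eq_square)
    then show ?case unfolding W_def elim by (simp add: algebra_simps)
  qed
  have "H' = (LINT x|lborel. T x - W x / f x)"
    unfolding H'_def
    by (intro Bochner_Integration.integral_cong) (use pos(1) in \<open>auto simp: W_def field_simps less_imp_neq[THEN not_sym]\<close>)
  also have "\<dots> = J - (LINT x|lborel. W x / f x)"
    unfolding J_def by (intro Bochner_Integration.integral_diff iT over_f iW)
  finally have H': "H' = J - (LINT x|lborel. W x / f x)" .
  have "I' = (LINT x|lborel. m x * v x * u x - c * (m x * v x * (u' x / f x)))"
    unfolding I'_def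
  proof (rule integral_cong_AE)
    show "AE x in lborel. h x * \<nu> x / f x = m x * v x * u x - c * (m x * v x * (u' x / f x))"
      using wave
    proof eventually_elim
      case (elim x)
      show ?case unfolding elim using u_pos[of x] pos(1)[of x] by (simp add: h_def field_simps)
    qed
  qed measurable
  also have "\<dots> = A - c * E"
    unfolding A_def E_def Bochner_Integration.integral_diff[OF iA integrable_mult_right[OF iE]] integral_mult_right_zero ..
  finally have I': "I' = A - c * E" .
  have "H - I\<^sup>2 / Z \<ge> f0 * (H' - I'\<^sup>2 / Zf)"
  proof -
    \<comment> \<open>the mean for \<open>\<nu>\<close>; the mean for \<open>\<nu> / f\<close> can only decrease the second moment\<close>
    define s where "s = I / Z"
    have ex: "(h x - s)\<^sup>2 * \<nu> x = (h x)\<^sup>2 * \<nu> x - 2 * s * (h x * \<nu> x) + s\<^sup>2 * \<nu> x" for x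
      by (simp add: power2_eq_square algebra_simps)
    have ex': "(h x - s)\<^sup>2 * \<nu> x / f x = (h x)\<^sup>2 * \<nu> x / f x - 2 * s * (h x * \<nu> x / f x) + s\<^sup>2 * (\<nu> x / f x)" for x
      unfolding ex by (simp add: add_divide_distrib diff_divide_distrib)
    have i0: "integrable lborel (\<lambda>x. (h x - s)\<^sup>2 * \<nu> x)" unfolding ex using ih ih2 \<nu>_int by auto
    have "f0 * (LINT x|lborel. (h x - s)\<^sup>2 * \<nu> x / f x) = (LINT x|lborel. f0 * ((h x - s)\<^sup>2 * \<nu> x / f x))"
      by (rule integral_mult_right_zero[symmetric])
    also have "\<dots> \<le> (LINT x|lborel. (h x - s)\<^sup>2 * \<nu> x)"
    proof (rule integral_mono)
      show "integrable lborel (\<lambda>x. f0 * ((h x - s)\<^sup>2 * \<nu> x / f x))" by (rule integrable_mult_right[OF over_f[OF i0]])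
      fix x
      have "f0 / f x \<le> 1" using f_bounds(2)[of x] pos(1)[of x] by simp
      then have "f0 / f x * ((h x - s)\<^sup>2 * \<nu> x) \<le> 1 * ((h x - s)\<^sup>2 * \<nu> x)"
        using \<nu>_pos[of x] by (intro mult_right_mono) auto
      then show "f0 * ((h x - s)\<^sup>2 * \<nu> x / f x) \<le> (h x - s)\<^sup>2 * \<nu> x" by simp
    qed (rule i0)
    finally have e1: "f0 * (LINT x|lborel. (h x - s)\<^sup>2 * \<nu> x / f x) \<le> (LINT x|lborel. (h x - s)\<^sup>2 * \<nu> x)" .
    have e2: "(LINT x|lborel. (h x - s)\<^sup>2 * \<nu> x) = H - 2 * s * I + s\<^sup>2 * Z"
      unfolding ex H_def I_def Z_def by (rule integral_linear3[OF ih2 ih \<nu>_int])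
    have e3: "(LINT x|lborel. (h x - s)\<^sup>2 * \<nu> x / f x) = H' - 2 * s * I' + s\<^sup>2 * Zf"
      unfolding ex' H'_def I'_def Zf_def by (rule integral_linear3[OF over_f[OF ih2] over_f[OF ih] \<nu>_over_f_int])
    have e4: "H - 2 * s * I + s\<^sup>2 * Z = H - I\<^sup>2 / Z"
      using Z_pos by (simp add: s_def field_simps power2_eq_square)
    have e5: "H' - I'\<^sup>2 / Zf \<le> H' - 2 * s * I' + s\<^sup>2 * Zf"
    proof -
      have "0 \<le> (s * Zf - I')\<^sup>2 / Zf" using Zf_pos by simp
      also have "\<dots> = I'\<^sup>2 / Zf - 2 * s * I' + s\<^sup>2 * Zf"
        using Zf_pos by (simp add: field_simps power2_eq_square)
      finally show ?thesis by simp
    qed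
    have "f0 * (H' - I'\<^sup>2 / Zf) \<le> f0 * (LINT x|lborel. (h x - s)\<^sup>2 * \<nu> x / f x)"
      unfolding e3 using f_bounds(1) by (intro mult_left_mono e5) simp
    also note e1
    also have "(LINT x|lborel. (h x - s)\<^sup>2 * \<nu> x) = H - I\<^sup>2 / Z" unfolding e2 e4 ..
    finally show ?thesis .
  qed
  then have "(1 - a) / 2 * (f0 * (H' - I'\<^sup>2 / Zf)) \<le> (1 - a) / 2 * (H - I\<^sup>2 / Z)"
    using a1 by (rule mult_left_mono)
  moreover have "(1 - a) / 2 * (f0 * (H' - I'\<^sup>2 / Zf)) = \<kappa>0 * (H' - I'\<^sup>2 / Zf)"
    by (simp add: \<kappa>0_def a_def)
  ultimately have "\<kappa>0 * (H' - I'\<^sup>2 / Zf) \<le> (1 - a) / 2 * (H - I\<^sup>2 / Z)" by (simp only:)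
  moreover have "(LINT x|lborel. q x * v x * conv w (\<lambda>y. q y * v y) x) \<le> H - (1 - a) / 2 * (H - I\<^sup>2 / Z)"
    using spectral_gap[OF k_pos poincare h_meas h] unfolding \<phi>h H_def I_def a_def by blast
  moreover have "(LINT x|lborel. W x) = (LINT x|lborel. f x * T x) - H"
    unfolding W_def[abs_def] H_def by (intro Bochner_Integration.integral_diff ifT ih2)
  ultimately have main: "(LINT x|lborel. W x) + \<kappa>0 * (H' - I'\<^sup>2 / Zf)
      \<le> (LINT x|lborel. f x * T x) - (LINT x|lborel. q x * v x * conv w (\<lambda>y. q y * v y) x)"
    by linarith
  have drift: "- (\<bar>c\<bar> * S) * J \<le> (LINT x|lborel. W x) - \<kappa>0 * (LINT x|lborel. W x / f x)"
  proof -
    have "- (\<bar>c\<bar> * S) * J = (LINT x|lborel. - (\<bar>c\<bar> * S) * T x)" by (simp add: J_def)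
    also have "\<dots> \<le> (LINT x|lborel. W x - \<kappa>0 * (W x / f x))"
    proof (rule integral_mono_AE)
      show "integrable lborel (\<lambda>x. - (\<bar>c\<bar> * S) * T x)" using iT by simp
      show "integrable lborel (\<lambda>x. W x - \<kappa>0 * (W x / f x))"
        by (intro Bochner_Integration.integrable_diff integrable_mult_right iW over_f)
      show "AE x in lborel. - (\<bar>c\<bar> * S) * T x \<le> W x - \<kappa>0 * (W x / f x)"
        using W_eq S
      proof eventually_elim
        case (elim x)
        have e: "W x - \<kappa>0 * (W x / f x) = - (c * (u' x / (u x * f x) * (\<kappa>0 - f x))) * T x"
          unfolding elim(1) using u_pos[of x] pos(1)[of x] by (simp add: field_simps)
        have le: "- (\<bar>c\<bar> * S) \<le> - (c * (u' x / (u x * f x) * (\<kappa>0 - f x)))"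
          using elim(2) abs_ge_self[of "c * (u' x / (u x * f x) * (\<kappa>0 - f x))"]
          unfolding abs_mult[symmetric] by simp
        show ?case unfolding e using le T_nn by (rule mult_right_mono)
      qed
    qed
    also have "\<dots> = (LINT x|lborel. W x) - \<kappa>0 * (LINT x|lborel. W x / f x)"
      unfolding Bochner_Integration.integral_diff[OF iW integrable_mult_right[OF over_f[OF iW]]]
        integral_mult_right_zero ..
    finally show ?thesis .
  qed
  have "I'\<^sup>2 \<le> 3 * A\<^sup>2 + 3 / 2 * c\<^sup>2 * (J * N2)"
  proof -
    have "0 \<le> (2 * A + c * E)\<^sup>2" by simp
    then have "(A - c * E)\<^sup>2 \<le> 3 * A\<^sup>2 + 3 / 2 * (c\<^sup>2 * E\<^sup>2)"
      by (simp add: power2_eq_square algebra_simps)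
    also have "c\<^sup>2 * E\<^sup>2 \<le> c\<^sup>2 * (J * N2)" using E2 by (intro mult_left_mono) auto
    finally show ?thesis by (simp add: I')
  qed
  then have "\<kappa>0 / Zf * I'\<^sup>2 \<le> \<kappa>0 / Zf * (3 * A\<^sup>2 + 3 / 2 * c\<^sup>2 * (J * N2))"
    using \<kappa>0_pos Zf_pos by (intro mult_left_mono) auto
  also have "\<dots> = 3 * \<kappa>0 / Zf * A\<^sup>2 + \<kappa>0 * (3 / 2 * c\<^sup>2 * N2 / Zf) * J"
    by (simp add: algebra_simps)
  finally have last: "\<kappa>0 / Zf * I'\<^sup>2 \<le> 3 * \<kappa>0 / Zf * A\<^sup>2 + \<kappa>0 * (3 / 2 * c\<^sup>2 * N2 / Zf) * J" .
  have e1: "\<kappa>0 * (H' - I'\<^sup>2 / Zf) = \<kappa>0 * J - \<kappa>0 * (LINT x|lborel. W x / f x) - \<kappa>0 / Zf * I'\<^sup>2"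
    unfolding H' by (simp add: algebra_simps)
  have e2: "(\<kappa>0 * (1 - 3 / 2 * c\<^sup>2 * N2 / Zf) - \<bar>c\<bar> * S) * J
      = \<kappa>0 * J - \<kappa>0 * (3 / 2 * c\<^sup>2 * N2 / Zf) * J - (\<bar>c\<bar> * S) * J"
    by (simp add: algebra_simps)
  have "(\<kappa>0 * (1 - 3 / 2 * c\<^sup>2 * N2 / Zf) - \<bar>c\<bar> * S) * J - 3 * \<kappa>0 / Zf * A\<^sup>2
     \<le> (LINT x|lborel. W x) + \<kappa>0 * (H' - I'\<^sup>2 / Zf)"
    unfolding e1 e2 using last drift by simp
  from order_trans[OF this main] show ?thesis unfolding J_def A_def T_def .
qed

text \<open>
  Both sides are continuous along the truncations of \<open>v\<close> to the sets where \<open>\<bar>v\<bar> \<le> n * u\<close>, by dominated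
  convergence. The detour is needed because the differentiation of convolutions is available
  only for functions \<open>\<phi> * h\<close> with \<open>h\<close> bounded.
\<close>

lemma coercive:
  assumes v_meas [measurable]: "v \<in> borel_measurable borel" and v2: "integrable lborel (\<lambda>x. m x * (v x)\<^sup>2)"
    and S: "AE x in lborel. \<bar>c\<bar> * \<bar>u' x / (u x * f x) * (\<kappa>0 - f x)\<bar> \<le> \<bar>c\<bar> * S"
  shows "(\<kappa>0 * (1 - 3 / 2 * c\<^sup>2 * N2 / Zf) - \<bar>c\<bar> * S) * (LINT x|lborel. m x * (v x)\<^sup>2)
      - 3 * \<kappa>0 / Zf * (LINT x|lborel. m x * v x * u x)\<^sup>2
    \<le> (LINT x|lborel. f x * (m x * (v x)\<^sup>2)) - (LINT x|lborel. q x * v x * conv w (\<lambda>y. q y * v y) x)"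
proof -
  define t where "t n x = (if \<bar>v x\<bar> \<le> real n * u x then v x else 0)" for n :: nat and x
  have [measurable]: "t n \<in> borel_measurable borel" for n unfolding t_def[abs_def] by measurable
  have t_le: "\<bar>t n x\<bar> \<le> \<bar>v x\<bar>" for n x by (simp add: t_def)
  have t_sq: "(t n x)\<^sup>2 \<le> (v x)\<^sup>2" for n x using t_le by (simp add: abs_le_square_iff)
  have t_lim: "(\<lambda>n. t n x) \<longlonglongrightarrow> v x" for x
  proof -
    obtain N :: nat where "\<bar>v x\<bar> / u x \<le> real N" using real_arch_simple by blast
    then have N: "\<bar>v x\<bar> \<le> real N * u x" using u_pos[of x] by (simp add: pos_divide_le_eq)
    have "\<forall>\<^sub>F n in sequentially. t n x = v x"
      using eventually_ge_at_top[of N]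
    proof eventually_elim
      case (elim n)
      have "real N * u x \<le> real n * u x" using elim u_pos[of x] by (intro mult_right_mono) auto
      then show ?case using N by (simp add: t_def)
    qed
    then show ?thesis by (rule tendsto_eventually)
  qed
  have qv: "integrable lborel (\<lambda>x. (q x * v x)\<^sup>2)" by (rule q_square_int[OF v2])
  have qt: "integrable lborel (\<lambda>x. (q x * t n x)\<^sup>2)" for n
  proof (rule Bochner_Integration.integrable_bound[OF qv])
    show "AE x in lborel. norm ((q x * t n x)\<^sup>2) \<le> norm ((q x * v x)\<^sup>2)"
      using t_sq by (intro AE_I2) (auto simp: power_mult_distrib intro!: mult_left_mono)
  qed measurable
  have u2: "integrable lborel (\<lambda>x. m x * (u x)\<^sup>2)" by (rule weighted_square_int[OF u_sq])
  have m_nn: "m x \<ge> 0" for x using pos by (simp add: less_imp_le)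
  have l1: "(\<lambda>n. LINT x|lborel. m x * (t n x)\<^sup>2) \<longlonglongrightarrow> (LINT x|lborel. m x * (v x)\<^sup>2)"
  proof (rule integral_dominated_convergence[OF _ _ v2])
    show "AE x in lborel. (\<lambda>n. m x * (t n x)\<^sup>2) \<longlonglongrightarrow> m x * (v x)\<^sup>2"
      by (intro AE_I2 tendsto_intros t_lim)
    show "AE x in lborel. norm (m x * (t n x)\<^sup>2) \<le> m x * (v x)\<^sup>2" for n
      using t_sq m_nn by (intro AE_I2) (auto simp: abs_mult intro!: mult_left_mono)
  qed measurable
  have fv: "integrable lborel (\<lambda>x. f x * (m x * (v x)\<^sup>2))"
    using f_bounds(3) pos(1) by (intro integrable_mult_bounded(1)[OF v2, of f F]) (auto simp: abs_of_pos)
  have l2: "(\<lambda>n. LINT x|lborel. f x * (m x * (t n x)\<^sup>2)) \<longlonglongrightarrow> (LINT x|lborel. f x * (m x * (v x)\<^sup>2))"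
  proof (rule integral_dominated_convergence[OF _ _ fv])
    show "AE x in lborel. (\<lambda>n. f x * (m x * (t n x)\<^sup>2)) \<longlonglongrightarrow> f x * (m x * (v x)\<^sup>2)"
      by (intro AE_I2 tendsto_intros t_lim)
    show "AE x in lborel. norm (f x * (m x * (t n x)\<^sup>2)) \<le> f x * (m x * (v x)\<^sup>2)" for n
      using t_sq m_nn pos(1) by (intro AE_I2) (auto simp: abs_mult less_imp_le intro!: mult_left_mono)
  qed measurable
  have iA: "integrable lborel (\<lambda>x. m x * v x * u x)"
    by (rule weighted_Cauchy_Schwarz(1)) (use m_nn v2 u2 in auto)
  have l3: "(\<lambda>n. LINT x|lborel. m x * t n x * u x) \<longlonglongrightarrow> (LINT x|lborel. m x * v x * u x)"
  proof (rule integral_dominated_convergence[OF _ _ integrable_norm[OF iA]])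
    show "AE x in lborel. (\<lambda>n. m x * t n x * u x) \<longlonglongrightarrow> m x * v x * u x"
      by (intro AE_I2 tendsto_intros t_lim)
    show "AE x in lborel. norm (m x * t n x * u x) \<le> norm (m x * v x * u x)" for n
      using t_le by (intro AE_I2) (auto simp: abs_mult intro!: mult_left_mono mult_right_mono)
  qed measurable
  have qvm: "(\<lambda>x. q x * v x) \<in> borel_measurable borel" "(\<lambda>x. q x * t n x) \<in> borel_measurable borel" for n
    by measurable
  have l4: "(\<lambda>n. LINT x|lborel. q x * t n x * conv w (\<lambda>y. q y * t n y) x)
      \<longlonglongrightarrow> (LINT x|lborel. q x * v x * conv w (\<lambda>y. q y * v y) x)"
    unfolding integrable_mult_conv(2)[OF w_int qvm(1) qvm(1) qv qv]
      integrable_mult_conv(2)[OF w_int qvm(2) qvm(2) qt qt]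
  proof (rule integral_dominated_convergence)
    note [measurable] = meas(1)
    show "integrable (lborel \<Otimes>\<^sub>M lborel) (\<lambda>p. norm (case p of (x, y) \<Rightarrow> q x * v x * (w (x - y) * (q y * v y))))"
      by (intro integrable_norm integrable_convolution_form w_int qv qvm)
    show "AE p in lborel \<Otimes>\<^sub>M lborel. (\<lambda>n. q (fst p) * t n (fst p) * (w (fst p - snd p) * (q (snd p) * t n (snd p))))
       \<longlonglongrightarrow> q (fst p) * v (fst p) * (w (fst p - snd p) * (q (snd p) * v (snd p)))"
      by (intro AE_I2 tendsto_intros t_lim)
    show "AE p in lborel \<Otimes>\<^sub>M lborel. norm (q (fst p) * t n (fst p) * (w (fst p - snd p) * (q (snd p) * t n (snd p))))
       \<le> norm (case p of (x, y) \<Rightarrow> q x * v x * (w (x - y) * (q y * v y)))" for n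
      using t_le by (intro AE_I2) (auto simp: abs_mult intro!: mult_mono)
    show "(\<lambda>p. q (fst p) * v (fst p) * (w (fst p - snd p) * (q (snd p) * v (snd p)))) \<in> borel_measurable (lborel \<Otimes>\<^sub>M lborel)"
      by measurable
    show "(\<lambda>p. q (fst p) * t n (fst p) * (w (fst p - snd p) * (q (snd p) * t n (snd p)))) \<in> borel_measurable (lborel \<Otimes>\<^sub>M lborel)" for n
      by measurable
  qed
  show ?thesis
  proof (rule LIMSEQ_le)
    show "\<exists>N. \<forall>n\<ge>N. (\<kappa>0 * (1 - 3 / 2 * c\<^sup>2 * N2 / Zf) - \<bar>c\<bar> * S) * (LINT x|lborel. m x * (t n x)\<^sup>2)
      - 3 * \<kappa>0 / Zf * (LINT x|lborel. m x * t n x * u x)\<^sup>2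
    \<le> (LINT x|lborel. f x * (m x * (t n x)\<^sup>2)) - (LINT x|lborel. q x * t n x * conv w (\<lambda>y. q y * t n y) x)"
    proof (intro exI allI impI)
      fix n
      show "(\<kappa>0 * (1 - 3 / 2 * c\<^sup>2 * N2 / Zf) - \<bar>c\<bar> * S) * (LINT x|lborel. m x * (t n x)\<^sup>2)
      - 3 * \<kappa>0 / Zf * (LINT x|lborel. m x * t n x * u x)\<^sup>2
    \<le> (LINT x|lborel. f x * (m x * (t n x)\<^sup>2)) - (LINT x|lborel. q x * t n x * conv w (\<lambda>y. q y * t n y) x)"
        by (rule coercive_bounded[OF _ _ S, where b="real n"]) (use u_pos in \<open>auto simp: t_def less_imp_le\<close>)
    qed
  qed (intro tendsto_intros l1 l2 l3 l4)+
qed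

section \<open>The logarithmic derivative of the wave profile\<close>

text \<open>
  By the wave equation \<open>c * u' / u = f - r * g / u\<close>, so it suffices to bound \<open>g / u\<close>, that is, to show
  \<open>d = u - l * g \<ge> 0\<close> for some \<open>l > 0\<close>. Since \<open>\<bar>g'\<bar> \<le> sqrt M * g\<close>, the choice of \<open>l\<close> below gives
  \<open>c * d' \<le> F * d\<close>. Following the line in the direction of the sign of \<open>c\<close>, a negative value of \<open>d\<close>
  would therefore grow exponentially, whereas \<open>d \<ge> - l * g\<close> is bounded below.
\<close>

lemma slope_bounded:
  assumes c: "c \<noteq> 0"
  obtains S where "AE x in lborel. \<bar>u' x / (u x * f x) * (\<kappa>0 - f x)\<bar> \<le> S"
proof -
  define l where "l = r0 / (F + \<bar>c\<bar> * sqrt M)"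
  have F: "F > 0" using f_bounds(1) f_bounds(2,3)[of 0] by linarith
  have den: "F + \<bar>c\<bar> * sqrt M > 0" using F M_nonneg by (simp add: add_pos_nonneg)
  have l: "l > 0" using den r_bounds(1) by (simp add: l_def)
  have r0: "r0 = F * l + \<bar>c\<bar> * sqrt M * l" 
  proof -
    have "l * (F + \<bar>c\<bar> * sqrt M) = r0" using den by (simp add: l_def)
    then show ?thesis by (simp add: algebra_simps)
  qed
  obtain U where U: "primitive U u'" "AE x in lborel. u x = U x" using weak_deriv_primitive[OF u_weak] .
  obtain G where G: "primitive G g'" "AE x in lborel. g x = G x" "\<And>x. G x > 0" "AE x in lborel. \<bar>g' x\<bar> \<le> sqrt M * G x"
    using g_primitive by blast
  define d where "d x = 1 * U x + - l * G x" for x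
  define d' where "d' x = 1 * u' x + - l * g' x" for x
  have d: "primitive d d'" unfolding d_def d'_def by (rule primitive_linear[OF U(1) G(1)])
  have d'_le: "AE x in lborel. c * d' x \<le> F * d x"
    using wave_eq U(2) G(2)
  proof eventually_elim
    case (elim x)
    have "f x * u x \<le> F * U x" using f_bounds(3)[of x] u_pos[of x] elim(2) by (simp add: mult_right_mono)
    moreover have "r0 * G x \<le> r x * conv w \<phi> x"
      using r_bounds(2)[of x] g_pos[of x] elim(3) by (simp add: g_def mult_right_mono)
    moreover have "- (c * l * g' x) \<le> \<bar>c\<bar> * sqrt M * l * G x"
    proof -
      have "- (c * l * g' x) \<le> \<bar>c * l * g' x\<bar>" by simp
      also have "\<dots> = \<bar>c\<bar> * l * \<bar>g' x\<bar>" using l by (simp add: abs_mult)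
      also have "\<dots> \<le> \<bar>c\<bar> * l * (sqrt M * g x)"
        using l by (intro mult_left_mono score_bound) auto
      finally show ?thesis using elim(3) by (simp add: ac_simps)
    qed
    moreover have "r0 * G x = F * l * G x + \<bar>c\<bar> * sqrt M * l * G x" by (subst r0) (simp add: distrib_right)
    moreover have "c * d' x = c * u' x - c * l * g' x" by (simp add: d'_def algebra_simps)
    moreover have "F * d x = F * U x - F * l * G x" by (simp add: d_def algebra_simps)
    ultimately show ?case using elim(1) by linarith
  qed
  have decay: "exp (- F / c * (x0 + c * t)) * d (x0 + c * t) \<le> exp (- F / c * x0) * d x0" if "t \<ge> 0" for t x0
  proof -
    have E: "primitive (\<lambda>x. exp (- F / c * x) * d x) (\<lambda>x. exp (- F / c * x) * (- F / c * d x + d' x))"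
      by (rule primitive_exp_mult[OF d])
    show ?thesis
    proof (cases "c > 0")
      case True
      have "AE x in lborel. exp (- F / c * x) * (- F / c * d x + d' x) \<le> 0"
        using d'_le
      proof eventually_elim
        case (elim x)
        then have "- F / c * d x + d' x \<le> 0" using True by (simp add: field_simps)
        then show ?case by (simp add: mult_le_0_iff)
      qed
      then show ?thesis
        using primitive_antimono[OF E, of x0 "x0 + c * t"] True that by simp
    next
      case False
      then have "c < 0" using c by simp
      have "AE x in lborel. 0 \<le> exp (- F / c * x) * (- F / c * d x + d' x)"
        using d'_le
      proof eventually_elim
        case (elim x)
        then have "- F / c * d x + d' x \<ge> 0" using \<open>c < 0\<close> by (simp add: field_simps)
        then show ?case by (simp add: zero_le_mult_iff)
      qed
      then show ?thesis
        using primitive_mono[OF E, of "x0 + c * t" x0] \<open>c < 0\<close> that by (simp add: mult_nonpos_nonneg)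
    qed
  qed
  have G_le: "G x \<le> B" for x
  proof (rule continuous_AE_le_imp_le[OF primitive_continuous[OF G(1)] continuous_on_const])
    show "AE x in lborel. G x \<le> B" by (rule eventually_mono[OF G(2)]) (metis g_le)
  qed
  have "AE x in lborel. 0 \<le> U x" by (rule eventually_mono[OF U(2)]) (metis u_pos less_imp_le)
  then have U_nn: "0 \<le> U x" for x
    by (rule continuous_AE_le_imp_le[OF continuous_on_const primitive_continuous[OF U(1)]])
  have d_ge: "- l * B \<le> d x" for x
  proof -
    have "- l * B \<le> - l * G x" using G_le[of x] l by simp
    then show ?thesis using U_nn[of x] by (simp add: d_def)
  qed
  have d_nn: "d x0 \<ge> 0" for x0
  proof (rule ccontr)
    assume "\<not> d x0 \<ge> 0"
    then have neg: "d x0 < 0" by simp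
    have B: "B > 0" using G_le[of 0] G(3)[of 0] by linarith
    \<comment> \<open>the time after which even the linear lower bound of the exponential contradicts \<open>d_ge\<close>\<close>
    define t where "t = l * B / (F * - d x0)"
    have t: "t \<ge> 0"
      unfolding t_def using l B F neg by (intro divide_nonneg_pos mult_pos_pos mult_nonneg_nonneg) auto
    have "exp (- F / c * x0) * (exp (- F * t) * d (x0 + c * t)) \<le> exp (- F / c * x0) * d x0"
    proof -
      have "- F / c * (x0 + c * t) = - F / c * x0 + - F * t" using c by (simp add: field_simps)
      then show ?thesis using decay[OF t, of x0] by (simp only: exp_add mult.assoc)
    qed
    then have "exp (- F * t) * d (x0 + c * t) \<le> d x0" by simp
    then have "exp (F * t) * (exp (- F * t) * d (x0 + c * t)) \<le> exp (F * t) * d x0"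
      by (rule mult_left_mono) simp
    moreover have "exp (F * t) * exp (- F * t) = 1" by (simp add: exp_add[symmetric])
    ultimately have "d (x0 + c * t) \<le> exp (F * t) * d x0"
      by (simp only: mult.assoc[symmetric] mult_1_left)
    also have "\<dots> \<le> (1 + F * t) * d x0"
      using neg exp_ge_add_one_self[of "F * t"] by (simp add: mult_right_mono_neg)
    also have "\<dots> = d x0 - l * B" using neg F by (simp add: t_def field_simps)
    finally show False using d_ge[of "x0 + c * t"] neg by simp
  qed
  show ?thesis
  proof (rule that)
    show "AE x in lborel. \<bar>u' x / (u x * f x) * (\<kappa>0 - f x)\<bar> \<le> (F + R / l) / (\<bar>c\<bar> * f0) * (\<kappa>0 + F)"
      using wave_eq U(2) G(2)
    proof eventually_elim
      case (elim x)
      have "l * g x \<le> u x" using d_nn[of x] elim by (simp add: d_def)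
      then have gu: "g x \<le> u x / l" using l by (simp add: pos_le_divide_eq mult.commute)
      have "\<bar>c\<bar> * \<bar>u' x\<bar> = \<bar>f x * u x - r x * g x\<bar>"
        using elim(1) by (simp add: g_def abs_mult[symmetric])
      also have "\<dots> \<le> f x * u x + r x * g x"
        using pos[of x] u_pos[of x] g_pos[of x] abs_triangle_ineq4[of "f x * u x" "r x * g x"] by (simp add: abs_mult)
      also have "\<dots> \<le> F * u x + R * (u x / l)"
        using pos[of x] u_pos[of x] g_pos[of x] f_bounds(3)[of x] r_bounds(3)[of x] gu
        by (intro add_mono mult_mono) auto
      also have "\<dots> = (F + R / l) * u x" by (simp add: field_simps)
      finally have 1: "\<bar>u' x\<bar> / u x \<le> (F + R / l) / \<bar>c\<bar>"
        using c u_pos[of x] by (simp add: pos_divide_le_eq pos_le_divide_eq mult.commute)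
      have FR: "0 \<le> (F + R / l) / \<bar>c\<bar>"
        using F l r_bounds(3)[of 0] pos(2)[of 0] by (intro divide_nonneg_nonneg add_nonneg_nonneg) auto
      have 2: "\<bar>u' x\<bar> / u x * (1 / f x) \<le> (F + R / l) / \<bar>c\<bar> * (1 / f0)"
        using 1 FR f_bounds(1) f_bounds(2)[of x] pos(1)[of x] u_pos[of x] by (intro mult_mono) (auto simp: frac_le)
      have 3: "\<bar>\<kappa>0 - f x\<bar> \<le> \<kappa>0 + F" using \<kappa>0_pos pos(1)[of x] f_bounds(3)[of x] by simp
      have "\<bar>u' x\<bar> / u x * (1 / f x) * \<bar>\<kappa>0 - f x\<bar> \<le> (F + R / l) / \<bar>c\<bar> * (1 / f0) * (\<kappa>0 + F)"
        by (intro mult_mono 2 3 mult_nonneg_nonneg FR) (use f_bounds(1) in auto)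
      then show ?case using pos(1)[of x] u_pos[of x] by (simp add: abs_mult abs_divide)
    qed
  qed
qed

end

section \<open>Stability of the travelling wave operator\<close>

lemma integrable_power2_mult_bounded:
  fixes a v :: "'a \<Rightarrow> real"
  assumes "integrable N (\<lambda>x. (v x)\<^sup>2)" "a \<in> borel_measurable N" "\<And>x. \<bar>a x\<bar> \<le> C"
  shows "integrable N (\<lambda>x. (a x * v x)\<^sup>2)"
  unfolding power_mult_distrib
proof (rule integrable_mult_bounded(1)[OF assms(1)])
  show "AE x in N. \<bar>(a x)\<^sup>2\<bar> \<le> C\<^sup>2" by (intro AE_I2 abs_power2_le assms(3))
qed (use assms(2) in measurable)

lemma Pop_eq: "Pop r w q v x = r x * conv w (\<lambda>y. q y * v y) x"
proof -
  have "Pop r w q v x = (LINT y|lborel. r x * (w (x - y) * (q y * v y)))"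
    unfolding Pop_def pker_def by (intro Bochner_Integration.integral_cong) (auto simp: ac_simps)
  then show ?thesis by (simp add: conv_def)
qed

lemma winner_wave_op:
  assumes w: "integrable lborel w"
    and [measurable]: "f \<in> borel_measurable borel" "r \<in> borel_measurable borel" "q \<in> borel_measurable borel"
      "v1 \<in> borel_measurable borel" "v2 \<in> borel_measurable borel"
    and b: "\<And>x. \<bar>f x\<bar> \<le> F" "\<And>x. \<bar>q x\<bar> \<le> Q" "r0 > 0" "\<And>x. r0 \<le> r x"
    and v: "integrable lborel (\<lambda>x. (v1 x)\<^sup>2)" "integrable lborel (\<lambda>x. (v2 x)\<^sup>2)"
  shows "winner (symm_density q r) (wave_op f r w q v1) v2 =
    - (LINT x|lborel. f x * v1 x * v2 x * (q x / r x)) + (LINT x|lborel. q x * v2 x * conv w (\<lambda>y. q y * v1 y) x)"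
proof -
  have rpos: "r x > 0" for x using b(3) b(4)[of x] by linarith
  have "integrable lborel (\<lambda>x. v1 x * v2 x)"
    using weighted_Cauchy_Schwarz(1)[of "\<lambda>_. 1" lborel v1 v2] v by simp
  then have "integrable lborel (\<lambda>x. (f x * (q x / r x)) * (v1 x * v2 x))"
  proof (rule integrable_mult_bounded(1))
    show "AE x in lborel. \<bar>f x * (q x / r x)\<bar> \<le> F * (Q / r0)"
    proof (intro AE_I2)
      fix x
      have "\<bar>q x\<bar> / r x \<le> Q / r0"
        using b(2)[of x] b(3) b(4)[of x] by (intro frac_le) auto
      then have "\<bar>f x\<bar> * (\<bar>q x\<bar> / r x) \<le> F * (Q / r0)"
        using b(1)[of x] rpos[of x] by (intro mult_mono) auto
      then show "\<bar>f x * (q x / r x)\<bar> \<le> F * (Q / r0)" using rpos[of x] by (simp add: abs_mult abs_divide)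
    qed
  qed measurable
  then have i1: "integrable lborel (\<lambda>x. f x * v1 x * v2 x * (q x / r x))" by (simp add: ac_simps)
  have qsq: "integrable lborel (\<lambda>x. (q x * v x)\<^sup>2)" if "integrable lborel (\<lambda>x. (v x)\<^sup>2)" for v
    by (rule integrable_power2_mult_bounded[OF that _ b(2)]) measurable
  have m: "(\<lambda>x. q x * v1 x) \<in> borel_measurable borel" "(\<lambda>x. q x * v2 x) \<in> borel_measurable borel" by measurable
  have i2: "integrable lborel (\<lambda>x. q x * v2 x * conv w (\<lambda>y. q y * v1 y) x)"
    by (rule integrable_mult_conv(1)[OF w m(2,1) qsq[OF v(2)] qsq[OF v(1)]])
  have "winner (symm_density q r) (wave_op f r w q v1) v2
    = (LINT x|lborel. - (f x * v1 x * v2 x * (q x / r x)) + q x * v2 x * conv w (\<lambda>y. q y * v1 y) x)"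
    unfolding winner_def wave_op_def symm_density_def Pop_eq
    by (intro Bochner_Integration.integral_cong) (auto simp: field_simps less_imp_neq[OF rpos, THEN not_sym])
  then show ?thesis using i1 i2 by simp
qed

text \<open>
  The threshold \<open>s\<close> is the positive root of the quadratic; it is the critical wave speed when the
  quadratic is \<open>\<kappa>\<close> as a function of \<open>\<bar>t\<bar>\<close>.
\<close>

lemma quadratic_threshold:
  fixes \<alpha> \<beta> k :: real
  assumes "\<alpha> > 0" "\<beta> \<ge> 0" "k > 0"
  obtains s where "s > 0" "\<And>t. t \<ge> 0 \<Longrightarrow> k - \<alpha> * t\<^sup>2 - \<beta> * t \<le> 0 \<longleftrightarrow> s \<le> t"
    "\<And>t. 0 \<le> t \<Longrightarrow> t \<le> s \<Longrightarrow> 0 \<le> k - \<alpha> * t\<^sup>2 - \<beta> * t"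
proof -
  define d where "d = sqrt (\<beta>\<^sup>2 + 4 * \<alpha> * k)"
  define s where "s = (d - \<beta>) / (2 * \<alpha>)"
  have "\<beta>\<^sup>2 < \<beta>\<^sup>2 + 4 * \<alpha> * k" using assms by simp
  then have "\<beta> < d" unfolding d_def using assms(2) by (simp add: real_less_rsqrt)
  then have s: "s > 0" using assms by (simp add: s_def)
  have d2: "d\<^sup>2 = \<beta>\<^sup>2 + 4 * \<alpha> * k" using assms by (simp add: d_def)
  have d: "d = 2 * \<alpha> * s + \<beta>" using assms by (simp add: s_def)
  have "4 * \<alpha> * (\<alpha> * s\<^sup>2 + \<beta> * s) = 4 * \<alpha> * k"
    using d2 unfolding d by (simp add: power2_eq_square algebra_simps)
  then have root: "\<alpha> * s\<^sup>2 + \<beta> * s = k" using assms by simp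
  have lt: "\<alpha> * a\<^sup>2 + \<beta> * a < \<alpha> * b\<^sup>2 + \<beta> * b" if "0 \<le> a" "a < b" for a b
  proof -
    have "a\<^sup>2 < b\<^sup>2" using that by (simp add: power_strict_mono)
    then have "\<alpha> * a\<^sup>2 < \<alpha> * b\<^sup>2" using assms by simp
    moreover have "\<beta> * a \<le> \<beta> * b" using that assms by (simp add: mult_left_mono)
    ultimately show ?thesis by simp
  qed
  show ?thesis
  proof (rule that[OF s])
    fix t :: real assume t: "t \<ge> 0"
    show "k - \<alpha> * t\<^sup>2 - \<beta> * t \<le> 0 \<longleftrightarrow> s \<le> t"
      using lt[of t s] lt[of s t] root t s by (cases t s rule: linorder_cases) auto
    show "0 \<le> k - \<alpha> * t\<^sup>2 - \<beta> * t" if "t \<le> s"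
      using lt[of t s] root t that by (cases "t = s") auto
  qed
qed

lemma ess_norm_nonneg: "ess_norm u \<ge> 0"
proof (rule ccontr)
  assume "\<not> ess_norm u \<ge> 0"
  then have neg: "ess_norm u < 0" by simp
  have "AE x in lborel. ereal \<bar>u x\<bar> \<le> ess_norm u"
    unfolding ess_norm_def by (rule esssup_AE)
  then have "AE x::real in lborel. False"
    by (rule eventually_mono) (metis neg abs_ge_zero ereal_less_eq(5) order_le_less_trans less_irrefl)
  then show False by (rule not_AE_False)
qed

theorem theorem8:
  fixes c \<kappa>00 :: real and f r q w wx ux \<psi> :: "real \<Rightarrow> real"
  assumes f: "continuous_on UNIV f" "bounded (range f)" "(INF x. f x) > 0"
    and r: "continuous_on UNIV r" "bounded (range r)" "(INF x. r x) > 0"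
    and q: "continuous_on UNIV q" "bounded (range q)" "(INF x. q x) > 0"
    and w: "\<forall>x. w x \<ge> 0" "integrable lborel w" "(\<integral>x. w x \<partial>lborel) = 1"
    and wx: "AE x in lborel. (w has_real_derivative wx x) (at x)" "integrable lborel wx"
    and symm: "symmetrizes (symm_density q r) (wave_op f r w q)"
    and ux: "spans_kernel (frozen_op c f r w q) ux" "\<forall>x. ux x > 0"
    and \<psi>: "spans_kernel (frozen_adj c f r w q) \<psi>" "\<forall>x. \<psi> x > 0"
    and normalized: "winner (\<lambda>_. 1) ux \<psi> = 1"
    and deriv_conv: "\<forall>v\<in>wL2 (\<lambda>x. \<psi> x / ux x). has_weak_deriv (conv w v) (conv wx v)"
    and M_finite: "Mconst w wx q ux < \<infinity>"
    and poincare: "\<kappa>00 > 0"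
      "\<forall>h\<in>wH 1 (mu0 r w q ux).
         Var (mu0 r w q ux) h \<le> \<kappa>00 * (\<integral>x. (wderiv h x)\<^sup>2 * mu0 r w q ux x \<partial>lborel)"
  shows "\<exists>cstar>0.
     (let k0 = kappa0 f \<kappa>00 (Mconst w wx q ux);
          A = {\<bar>t\<bar> |t::real. kappa f r w q ux k0 t \<le> 0}
      in c \<noteq> 0 \<or> slope_norm f ux k0 < \<infinity> \<longrightarrow> cstar \<in> A \<and> (\<forall>s\<in>A. cstar \<le> s)) \<and>
     (\<bar>c\<bar> \<le> cstar \<longrightarrow>
        (\<exists>\<kappa>>0. \<exists>Z>0. \<forall>v\<in>wL2 (symm_density q r).
           winner (symm_density q r) (wave_op f r w q v) v
             \<le> - \<kappa> * (wnorm (symm_density q r) v)\<^sup>2 + Z * (winner (symm_density q r) v ux)\<^sup>2))"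
proof -
  have bounds: "\<exists>C. \<forall>x. \<bar>a x\<bar> \<le> C" "(INF x. a x) \<le> a x" "a \<in> borel_measurable borel"
    if "continuous_on UNIV a" "bounded (range a)" for a :: "real \<Rightarrow> real" and x
  proof -
    show "\<exists>C. \<forall>x. \<bar>a x\<bar> \<le> C" using that(2) by (auto simp: bounded_iff)
    show "(INF x. a x) \<le> a x" by (intro cINF_lower bounded_imp_bdd_below that) auto
    show "a \<in> borel_measurable borel" by (rule borel_measurable_continuous_onI[OF that(1)])
  qed
  obtain F R Q where b: "\<And>x. \<bar>f x\<bar> \<le> F" "\<And>x. \<bar>r x\<bar> \<le> R" "\<And>x. \<bar>q x\<bar> \<le> Q"
    using bounds(1)[OF f(1,2)] bounds(1)[OF r(1,2)] bounds(1)[OF q(1,2)] by blast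
  note inf = bounds(2)[OF f(1,2)] bounds(2)[OF r(1,2)] bounds(2)[OF q(1,2)]
  note [measurable] = bounds(3)[OF f(1,2)] bounds(3)[OF r(1,2)] bounds(3)[OF q(1,2)]
  have rpos: "r x > 0" and qpos: "q x > 0" for x
    using inf(2,3)[of x] r(3) q(3) by linarith+
  have upos: "ux x > 0" and \<psi>pos: "\<psi> x > 0" for x using ux(2) \<psi>(2) by auto
  have uH: "ux \<in> wH 2 (\<lambda>_. 1)" and \<psi>H: "\<psi> \<in> wH 2 (\<lambda>_. 1)"
    using ux(1) \<psi>(1) by (auto simp: spans_kernel_def)
  have um [measurable]: "ux \<in> borel_measurable borel" and \<psi>m [measurable]: "\<psi> \<in> borel_measurable borel"
    and u2: "integrable lborel (\<lambda>x. (ux x)\<^sup>2)"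
  proof -
    have "(wderiv ^^ 0) ux \<in> wL2 (\<lambda>_. 1)" "(wderiv ^^ 0) \<psi> \<in> wL2 (\<lambda>_. 1)"
      using uH \<psi>H unfolding wH_def by blast+
    then show "ux \<in> borel_measurable borel" "\<psi> \<in> borel_measurable borel" "integrable lborel (\<lambda>x. (ux x)\<^sup>2)"
      by (simp_all add: wL2_def)
  qed
  have du2: "integrable lborel (\<lambda>x. (wderiv ux x)\<^sup>2)"
  proof -
    have "(wderiv ^^ 1) ux \<in> wL2 (\<lambda>_. 1)" using uH unfolding wH_def by (simp add: le_Suc_eq numeral_2_eq_2)
    then show ?thesis by (simp add: wL2_def)
  qed
  have uwd: "has_weak_deriv ux (wderiv ux)"
  proof -
    have "weakly_differentiable ux" using uH by (fastforce simp: wH_def less_Suc_eq numeral_2_eq_2)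
    then show ?thesis unfolding weakly_differentiable_def wderiv_def by (rule someI_ex)
  qed
  obtain B where B: "AE x in lborel. \<bar>ux x\<bar> \<le> B" using H1_bounded[OF uwd u2 du2] .
  define \<phi> where "\<phi> x = q x * ux x" for x
  have \<phi>m [measurable]: "\<phi> \<in> borel_measurable borel" unfolding \<phi>_def[abs_def] by measurable
  have \<phi>pos: "\<phi> x > 0" for x using upos qpos by (simp add: \<phi>_def)
  define M where "M = enn2real (Mconst w wx q ux)"
  interpret K: reversible_convolution w wx \<phi> "Q * B" M
  proof
    show "w x \<ge> 0" for x using w by simp
    show "integrable lborel w" "(LINT x|lborel. w x) = 1" by fact+
    show "AE x in lborel. (w has_real_derivative wx x) (at x)" "integrable lborel wx" by fact+
    show "\<phi> \<in> borel_measurable borel" "\<phi> x > 0" for x by fact+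
    show "AE x in lborel. \<phi> x \<le> Q * B"
      using B
    proof eventually_elim
      case (elim x)
      then show ?case using b(3)[of x] qpos[of x] upos[of x] by (auto simp: \<phi>_def intro!: mult_mono)
    qed
    show "integrable lborel (\<lambda>x. (\<phi> x)\<^sup>2)"
      unfolding \<phi>_def by (rule integrable_power2_mult_bounded[OF u2 _ b(3)]) measurable
    show "M \<ge> 0" by (simp add: M_def)
    show "(\<integral>\<^sup>+y\<in>{y. w (x - y) > 0}. ennreal ((wx (x - y) / w (x - y))\<^sup>2
        * (w (x - y) * \<phi> y / conv w \<phi> x)) \<partial>lborel) \<le> ennreal M" for x
    proof -
      have set_eq: "{x - s |s. w s > 0} = {y. w (x - y) > 0}"
      proof (intro set_eqI iffI)
        fix y assume "y \<in> {y. w (x - y) > 0}"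
        then show "y \<in> {x - s |s. w s > 0}" by (auto intro!: exI[of _ "x - y"])
      qed auto
      have "(\<integral>\<^sup>+y\<in>{y. w (x - y) > 0}. ennreal ((wx (x - y) / w (x - y))\<^sup>2
        * (w (x - y) * \<phi> y / conv w \<phi> x)) \<partial>lborel)
        = (\<integral>\<^sup>+y\<in>{x - s |s. w s > 0}. ennreal ((wx (x - y) / w (x - y))\<^sup>2 * p0 w q ux x y) \<partial>lborel)"
        unfolding set_eq p0_def \<phi>_def[abs_def] by (simp add: mult.assoc)
      also have "\<dots> \<le> Mconst w wx q ux" unfolding Mconst_def by (rule SUP_upper) simp
      also have "\<dots> = ennreal M" using M_finite by (simp add: M_def)
      finally show ?thesis .
    qed
    fix h :: "real \<Rightarrow> real" and C :: real
    assume hm [measurable]: "h \<in> borel_measurable borel" and h: "\<And>x. \<bar>h x\<bar> \<le> C"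
    show "has_weak_deriv (conv w (\<lambda>x. \<phi> x * h x)) (conv wx (\<lambda>x. \<phi> x * h x))"
    proof -
      have "integrable lborel (\<lambda>x. ux x * \<psi> x * 1)"
        using normalized not_integrable_integral_eq[of lborel "\<lambda>x. ux x * \<psi> x * 1"] by (auto simp: winner_def)
      then have "integrable lborel (\<lambda>x. (q x * h x)\<^sup>2 * (ux x * \<psi> x * 1))"
      proof (rule integrable_mult_bounded(1))
        have "\<bar>q x * h x\<bar> \<le> Q * C" for x
          unfolding abs_mult using b(3)[of x] h[of x] by (intro mult_mono) auto
        then show "AE x in lborel. \<bar>(q x * h x)\<^sup>2\<bar> \<le> (Q * C)\<^sup>2"
          by (intro AE_I2 abs_power2_le)
      qed measurable
      moreover have "(q x * h x)\<^sup>2 * (ux x * \<psi> x * 1) = (\<phi> x * h x)\<^sup>2 * (\<psi> x / ux x)" for x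
        using upos[of x] by (simp add: \<phi>_def power2_eq_square)
      \<comment> \<open>the square integrals of \<open>\<phi> * h\<close> for the weight \<open>\<psi> / ux\<close> are integrals of \<open>ux * \<psi>\<close> times a bounded function\<close>
      ultimately have "(\<lambda>x. \<phi> x * h x) \<in> wL2 (\<lambda>x. \<psi> x / ux x)" by (simp add: wL2_def)
      then show ?thesis using deriv_conv by blast
    qed
    show "(LINT x|lborel. \<phi> x * conv w (\<lambda>x. \<phi> x * h x) x) = (LINT x|lborel. \<phi> x * h x * conv w \<phi> x)"
    proof -
      define v where "v x = ux x * h x" for x
      have vm [measurable]: "v \<in> borel_measurable borel" unfolding v_def[abs_def] by measurable
      have v2: "integrable lborel (\<lambda>x. (v x)\<^sup>2)"
        using integrable_power2_mult_bounded[OF u2, of h C] h by (simp add: v_def mult.commute)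
      have L2: "s \<in> wL2 (symm_density q r)" if "s \<in> borel_measurable borel" "integrable lborel (\<lambda>x. (s x)\<^sup>2)" for s
      proof -
        have "integrable lborel (\<lambda>x. (s x)\<^sup>2 * (q x / r x))"
        proof (rule integrable_mult_bounded(2)[OF that(2)])
          show "AE x in lborel. \<bar>q x / r x\<bar> \<le> Q / (INF x. r x)"
          proof (intro AE_I2)
            fix x
            have "\<bar>q x\<bar> / r x \<le> Q / (INF x. r x)" using b(3)[of x] r(3) inf(2)[of x] by (intro frac_le) auto
            then show "\<bar>q x / r x\<bar> \<le> Q / (INF x. r x)" using rpos[of x] by simp
          qed
        qed measurable
        then show ?thesis using that by (simp add: wL2_def symm_density_def)
      qed
      \<comment> \<open>symmetry of the operator, in which the contributions of \<open>f\<close> cancel\<close>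
      have "winner (symm_density q r) (wave_op f r w q v) ux = winner (symm_density q r) v (wave_op f r w q ux)"
        using symm L2[OF vm v2] L2[OF um u2] by (simp add: symmetrizes_def)
      also have "\<dots> = winner (symm_density q r) (wave_op f r w q ux) v"
        unfolding winner_def by (simp add: mult.commute)
      finally have "(LINT x|lborel. q x * ux x * conv w (\<lambda>y. q y * v y) x) = (LINT x|lborel. q x * v x * conv w (\<lambda>y. q y * ux y) x)"
        using winner_wave_op[OF w(2) _ _ _ vm um b(1) b(3) r(3) inf(2) v2 u2]
          winner_wave_op[OF w(2) _ _ _ um vm b(1) b(3) r(3) inf(2) u2 v2] by (simp add: ac_simps)
      moreover have "(\<lambda>y. q y * v y) = (\<lambda>y. \<phi> y * h y)" by (simp add: \<phi>_def v_def mult.assoc)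
      moreover have "(\<lambda>y. q y * ux y) = \<phi>" by (simp add: \<phi>_def[abs_def])
      moreover have "q x * v x = \<phi> x * h x" "q x * ux x = \<phi> x" for x by (simp_all add: \<phi>_def v_def)
      ultimately show ?thesis by simp
    qed
  qed
  have \<phi>_fun: "(\<lambda>y. q y * ux y) = \<phi>" by (simp add: \<phi>_def[abs_def])
  have \<nu>_eq: "q x / r x * Pop r w q ux x * ux x = K.\<nu> x" for x
    using rpos[of x] unfolding Pop_eq \<phi>_fun by (simp add: K.\<nu>_def K.g_def \<phi>_def)
  have mu0_eq: "mu0 r w q ux = (\<lambda>x. 1 / K.Z * K.\<nu> x)"
    unfolding mu0_def[abs_def] Zmu0_def \<nu>_eq K.Z_def ..
  interpret T: travelling_wave w wx \<phi> "Q * B" M f r q ux "wderiv ux" c \<kappa>00 "INF x. f x" F "INF x. r x" R "INF x. q x" Q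
  proof
    show "f \<in> borel_measurable borel" "r \<in> borel_measurable borel" "q \<in> borel_measurable borel" by measurable
    show "f x \<le> F" "r x \<le> R" "q x \<le> Q" for x using b[of x] by (auto simp: abs_le_iff)
    show "AE x in lborel. c * wderiv ux x = f x * ux x - r x * conv w \<phi> x"
    proof -
      have "AE x in lborel. frozen_op c f r w q ux x = 0" using ux(1) by (simp add: spans_kernel_def)
      then show ?thesis by eventually_elim (simp add: frozen_op_def Pop_eq \<phi>_fun)
    qed
    show "h \<in> wH 1 (\<lambda>x. 1 / K.Z * K.\<nu> x) \<Longrightarrow> Var (\<lambda>x. 1 / K.Z * K.\<nu> x) h
      \<le> \<kappa>00 * (LINT x|lborel. (wderiv h x)\<^sup>2 * (1 / K.Z * K.\<nu> x))" for h
      using poincare(2) unfolding mu0_eq by blast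
  qed (use f(3) r(3) q(3) inf u2 du2 uwd upos poincare(1) in \<open>auto simp: \<phi>_def\<close>)
  define k0 where "k0 = kappa0 f \<kappa>00 (Mconst w wx q ux)"
  have k0: "k0 = T.\<kappa>0" unfolding k0_def kappa0_def T.\<kappa>0_def unfolding M_def ..
  have k0_pos: "k0 > 0" using T.\<kappa>0_pos k0 by simp
  have m_eq: "symm_density q r = T.m" by (simp add: symm_density_def[abs_def] T.m_def[abs_def])
  have Z0_eq: "Z0 f r w q ux = T.Zf"
  proof -
    have "q x / (r x * f x) * Pop r w q ux x * ux x = K.\<nu> x / f x" for x
      unfolding \<nu>_eq[symmetric] by simp
    then show ?thesis by (simp add: Z0_def T.Zf_def)
  qed
  have N2_eq: "(wnorm (symm_density q r) (\<lambda>x. wderiv ux x / f x))\<^sup>2 = T.N2"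
    using T.N2_pos unfolding wnorm_def winner_def m_eq T.N2_def by simp
  define \<alpha> where "\<alpha> = 2 * k0 * T.N2 / T.Zf"
  have \<alpha>: "\<alpha> > 0" using k0_pos T.N2_pos T.Zf_pos by (simp add: \<alpha>_def)
  have kappa_eq: "kappa f r w q ux k0 t = ereal (k0 - \<alpha> * t\<^sup>2) - ereal \<bar>t\<bar> * slope_norm f ux k0" for t
    unfolding kappa_def Z0_eq N2_eq by (simp add: \<alpha>_def algebra_simps)
  have gap: "\<exists>\<kappa>>0. \<exists>Z>0. \<forall>v\<in>wL2 (symm_density q r).
           winner (symm_density q r) (wave_op f r w q v) v
             \<le> - \<kappa> * (wnorm (symm_density q r) v)\<^sup>2 + Z * (winner (symm_density q r) v ux)\<^sup>2"
    if S: "AE x in lborel. \<bar>c\<bar> * \<bar>wderiv ux x / (ux x * f x) * (k0 - f x)\<bar> \<le> \<bar>c\<bar> * S"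
      and nn: "0 \<le> k0 - \<alpha> * c\<^sup>2 - \<bar>c\<bar> * S" for S
  proof -
    define \<kappa> where "\<kappa> = k0 * (1 - 3 / 2 * c\<^sup>2 * T.N2 / T.Zf) - \<bar>c\<bar> * S"
    have \<kappa>_eq: "\<kappa> = (k0 - \<alpha> * c\<^sup>2 - \<bar>c\<bar> * S) + \<alpha> / 4 * c\<^sup>2"
      by (simp add: \<kappa>_def \<alpha>_def field_simps)
    \<comment> \<open>the term \<open>\<alpha> / 4 * c\<^sup>2\<close> keeps the constant positive when the first summand vanishes\<close>
    have "\<kappa> > 0"
    proof (cases "c = 0")
      case True then show ?thesis using k0_pos by (simp add: \<kappa>_def)
    next
      case False
      then have "\<alpha> / 4 * c\<^sup>2 > 0" using \<alpha> by simp
      then show ?thesis using nn unfolding \<kappa>_eq by linarith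
    qed
    moreover have "3 * k0 / T.Zf > 0" using k0_pos T.Zf_pos by simp
    moreover have "winner (symm_density q r) (wave_op f r w q v) v
             \<le> - \<kappa> * (wnorm (symm_density q r) v)\<^sup>2 + 3 * k0 / T.Zf * (winner (symm_density q r) v ux)\<^sup>2"
      if v: "v \<in> wL2 (symm_density q r)" for v
    proof -
      have vm [measurable]: "v \<in> borel_measurable borel" and mv: "integrable lborel (\<lambda>x. T.m x * (v x)\<^sup>2)"
        using v unfolding wL2_def m_eq by (auto simp: mult.commute)
      have v2: "integrable lborel (\<lambda>x. (v x)\<^sup>2)"
      proof -
        have "integrable lborel (\<lambda>x. (1 / T.m x) * (T.m x * (v x)\<^sup>2))"
        proof (rule integrable_mult_bounded(1)[OF mv])
          show "AE x in lborel. \<bar>1 / T.m x\<bar> \<le> 1 / ((INF x. q x) / R)"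
          proof (intro AE_I2)
            fix x
            have "1 / T.m x \<le> 1 / ((INF x. q x) / R)"
              by (intro divide_left_mono T.m_lower mult_pos_pos T.pos(4) T.m_lower_pos) auto
            then show "\<bar>1 / T.m x\<bar> \<le> 1 / ((INF x. q x) / R)" using T.pos(4)[of x] by simp
          qed
        qed measurable
        then show ?thesis using T.pos(4) by (simp add: less_imp_neq[THEN not_sym])
      qed
      have "winner (symm_density q r) (wave_op f r w q v) v =
         - (LINT x|lborel. f x * (T.m x * (v x)\<^sup>2)) + (LINT x|lborel. q x * v x * conv w (\<lambda>y. q y * v y) x)"
        using winner_wave_op[OF w(2) _ _ _ vm vm b(1) b(3) r(3) inf(2) v2 v2]
        by (simp add: T.m_def power2_eq_square ac_simps)
      moreover have "(wnorm (symm_density q r) v)\<^sup>2 = (LINT x|lborel. T.m x * (v x)\<^sup>2)"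
      proof -
        have "winner (symm_density q r) v v = (LINT x|lborel. T.m x * (v x)\<^sup>2)"
          unfolding winner_def m_eq by (simp add: power2_eq_square ac_simps)
        moreover have "0 \<le> (LINT x|lborel. T.m x * (v x)\<^sup>2)" using T.pos(4) by (simp add: less_imp_le)
        ultimately show ?thesis by (simp add: wnorm_def)
      qed
      moreover have "winner (symm_density q r) v ux = (LINT x|lborel. T.m x * v x * ux x)"
        unfolding winner_def m_eq by (simp add: ac_simps)
      moreover have "\<kappa> * (LINT x|lborel. T.m x * (v x)\<^sup>2) - 3 * k0 / T.Zf * (LINT x|lborel. T.m x * v x * ux x)\<^sup>2
          \<le> (LINT x|lborel. f x * (T.m x * (v x)\<^sup>2)) - (LINT x|lborel. q x * v x * conv w (\<lambda>y. q y * v y) x)"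
        using T.coercive[OF vm mv S[unfolded k0]] unfolding \<kappa>_def k0 .
      ultimately show ?thesis by simp
    qed
    ultimately show ?thesis by blast
  qed
  have slope_AE: "AE x in lborel. ereal \<bar>wderiv ux x / (ux x * f x) * (k0 - f x)\<bar> \<le> slope_norm f ux k0"
    unfolding slope_norm_def ess_norm_def by (rule esssup_AE)
  have c0: "c = 0" if "slope_norm f ux k0 = \<infinity>"
  proof (rule ccontr)
    assume "c \<noteq> 0"
    then obtain S where "AE x in lborel. \<bar>wderiv ux x / (ux x * f x) * (T.\<kappa>0 - f x)\<bar> \<le> S"
      by (rule T.slope_bounded)
    then have "slope_norm f ux k0 \<le> ereal S"
      unfolding slope_norm_def ess_norm_def k0 by (intro esssup_I) auto
    then show False using that by simp
  qed
  show ?thesis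
  proof (cases "slope_norm f ux k0 = \<infinity>")
    case True
    then have "c = 0" by (rule c0)
    \<comment> \<open>\<open>kappa\<close> is then \<open>-\<infinity>\<close> away from zero, and every positive threshold has the gap property\<close>
    then show ?thesis
      using True gap[of 0] k0_pos unfolding k0_def[symmetric] by (intro exI[of _ 1]) auto
  next
    case False
    moreover have "slope_norm f ux k0 \<ge> 0" unfolding slope_norm_def by (rule ess_norm_nonneg)
    ultimately obtain S where S: "slope_norm f ux k0 = ereal S" "S \<ge> 0"
      by (cases "slope_norm f ux k0") auto
    obtain s where s: "s > 0" "\<And>t. t \<ge> 0 \<Longrightarrow> k0 - \<alpha> * t\<^sup>2 - S * t \<le> 0 \<longleftrightarrow> s \<le> t"
      "\<And>t. 0 \<le> t \<Longrightarrow> t \<le> s \<Longrightarrow> 0 \<le> k0 - \<alpha> * t\<^sup>2 - S * t"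
      using quadratic_threshold[OF \<alpha> S(2) k0_pos] by blast
    have kappa_le: "kappa f r w q ux k0 t \<le> 0 \<longleftrightarrow> s \<le> \<bar>t\<bar>" for t
      using s(2)[of "\<bar>t\<bar>"] unfolding kappa_eq S by (simp add: mult.commute)
    have "\<bar>s\<bar> = s" using s(1) by simp
    then have "s \<in> {\<bar>t\<bar> |t. kappa f r w q ux k0 t \<le> 0}" unfolding kappa_le by (intro CollectI exI[of _ s]) auto
    moreover have "\<forall>x\<in>{\<bar>t\<bar> |t. kappa f r w q ux k0 t \<le> 0}. s \<le> x" unfolding kappa_le by auto
    moreover have "AE x in lborel. \<bar>c\<bar> * \<bar>wderiv ux x / (ux x * f x) * (k0 - f x)\<bar> \<le> \<bar>c\<bar> * S"
      using slope_AE unfolding S by (rule eventually_mono) (intro mult_left_mono; simp only: ereal_less_eq abs_ge_zero)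
    moreover have "0 \<le> k0 - \<alpha> * c\<^sup>2 - \<bar>c\<bar> * S" if "\<bar>c\<bar> \<le> s"
      using s(3)[of "\<bar>c\<bar>"] that by (simp add: mult.commute)
    ultimately show ?thesis
      using s(1) gap[of S] unfolding k0_def[symmetric] Let_def by blast
  qed
qed

end
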